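(* Let $\nu$ be a mixture model on $\mathcal M$ with density $\rho=\sum_{k=1}^N w_k\rho_k$ as described in the context (in particular, the operators $\Delta_{\rho_k}$ and $\Delta_\rho$ have discrete point spectrum with orthonormal bases of eigenfunctions). Let $w_{max}:=\max_i w_i$ and $w_{min}:=\min_i w_i$. Let $\sigma\in(0,\pi/4)$ and suppose $$\mathcal S<\frac{w_{min}(1-\cos^2(\sigma))}{w_{max}\cos^2(\sigma)N^2}.$$ Define $$\tau:=4\left(\sqrt{\frac{\Theta(1-N\mathcal S)}{\mathcal C}}-\frac{\sqrt{N\mathcal S}}{1-\mathcal S}\right)^{-1}+\sqrt{\mathcal S},\qquad \delta^*:=\frac{w_{max}\cos^2(\sigma)N^2\mathcal S}{w_{min}(1-\cos^2(\sigma))}.$$ Suppose that $$\tau-\sqrt{\mathcal S}>0,\qquad \tau N<1,$$ and that $s,t>0$ satisfy $$\frac{t^2\sin^2(s)}{N w_{max}}\ \ge\ N\left(\frac{\tau-\sqrt{\mathcal S}}{2}\right)^2+4N^{3/2}\left(\frac{1}{\sqrt{1-N\tau}}-1\right),\qquad s+\sigma<\frac{\pi}{4}.$$ Then the probability measure $\mu:=F_\sharp\nu$ on $\mathbb R^N$ has an orthogonal cone structure with parameters $\left(\sigma+s,\ \delta+t^2,\ \frac{1-\sin(s)}{\sqrt{w_{max}}}\right)$ for any $\delta\in[\delta^*,1)$, where $F$ is the continuum Laplacian embedding defined in the context.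
   Context: Setting. $\mathcal M$ is a smooth, connected, orientable $m$-dimensional manifold embedded in $\mathbb R^d$, either compact without boundary or the whole of $\mathbb R^d$; $dx$ denotes integration with respect to its volume form, and $\nabla$, $\operatorname{div}$, $\Delta$ are the gradient, divergence and Laplace–Beltrami operator on $\mathcal M$. $N\ge 2$ is an integer, $\rho_1,\dots,\rho_N\in C^1(\mathcal M)$ are probability densities with respect to $dx$ (nonnegative, $\int_{\mathcal M}\rho_k\,dx=1$), $w_1,\dots,w_N>0$ with $\sum_k w_k=1$, and $\rho:=\sum_{k=1}^N w_k\rho_k$ is assumed to satisfy $\rho(x)>0$ for all $x\in\mathcal M$. The measure $\nu$ is $d\nu=\rho\,dx$. For a density $\varrho$, $\langle u,v\rangle_\varrho:=\int_{\mathcal M}uv\varrho\,dx$, $\|u\|_\varrho^2=\langle u,u\rangle_\varrho$, and $L^2(\varrho)$ is the corresponding space; $H^1(\mathcal M,\varrho)=\{u\in L^2(\varrho):\int(|\nabla u|^2+|u|^2)\varrho\,dx<\infty\}$. The operator $\Delta_\varrho$ acts on smooth functions by $\Delta_\varrho u=-\frac1\varrho\operatorname{div}(\varrho\nabla u)=-\Delta u-\frac1\varrho\nabla\varrho\cdot\nabla u$, so that $\langle\Delta_\varrho u,v\rangle_\varrho=\int\nabla u\cdot\nabla v\,\varrho\,dx$. Standing assumption: the operators $\Delta_{\rho_k}$ ($k=1,\dots,N$) and $\Delta_\rho$ have a discrete point spectrum with an associated orthonormal basis of eigenfunctions of $L^2(\rho_k)$, respectively $L^2(\rho)$. Parameters.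 $q_k:=\sqrt{w_k\rho_k/\rho}$. Overlapping parameter: $\mathcal S:=\max_{i\ne j}\int_{\mathcal M}\frac{\rho_i\rho_j}{\rho}\,dx$. Coupling parameter: $\mathcal C:=\max_k\mathcal C_k$, $\mathcal C_k:=\frac14\int_{\{\rho_k>0\}}\left|\frac{\nabla\rho_k}{\rho_k}-\frac{\nabla\rho}{\rho}\right|^2\rho_k\,dx$. Indivisibility parameter: $\Theta:=\min_k\Theta_k$, $\Theta_k:=\min_{u\perp\mathbf 1}\frac{\int_{\mathcal M}|\nabla u|^2\rho_k\,dx}{\langle u,u\rangle_{\rho_k}}$, where $\mathbf 1$ is the constant function one and $\perp$ is with respect to $\langle\cdot,\cdot\rangle_{\rho_k}$ (over nonzero $u\in H^1(\mathcal M,\rho_k)$); equivalently $\Theta_k$ is the second eigenvalue of $\Delta_{\rho_k}$. Embedding. $u_1,\dots,u_N$ are the first $N$ eigenfunctions of $\Delta_\rho$, orthonormal with respect to $\langle\cdot,\cdot\rangle_\rho$, corresponding to its $N$ smallest eigenvalues (with multiplicity), and $F:\mathcal M\to\mathbb R^N$, $F(x)=(u_1(x),\dots,u_N(x))$. $F_\sharp\nu$ is the push-forward of $\nu$. Orthogonal cone structure. A probability measure $\mu$ on $\mathbb R^k$ has an orthogonal cone structure with parameters $(\sigma,\delta,r)$, $\sigma\in(0,\pi/4)$, $\delta\in[0,1)$, $r>0$, if there is an orthonormal basis $e_1,\dots,e_k$ of $\mathbb R^k$ with $\mu\left(\bigcup_{j=1}^k C(e_j,\sigma,r)\right)\ge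 1-\delta$, where $C(e_j,\sigma,r)=\{z\in\mathbb R^k:\frac{z\cdot e_j}{|z|}>\cos(\sigma),\ |z|>r\}$. If the second parameter is $\ge1$, the defining inequality is vacuous and the property is understood to hold trivially. *)

theory Defs
  imports "HOL-Analysis.Analysis"
begin

section \<open>Embedded manifolds\<close>

primrec Ck_on :: "nat \<Rightarrow> ('a::real_normed_vector \<Rightarrow> 'b::real_normed_vector) \<Rightarrow> 'a set \<Rightarrow> bool" where
  "Ck_on 0 f U = continuous_on U f"
| "Ck_on (Suc k) f U =
     ((\<forall>x\<in>U. f differentiable (at x)) \<and> (\<forall>v. Ck_on k (\<lambda>x. frechet_derivative f (at x) v) U))"

text \<open>Only used for open \<open>U\<close>.\<close>
definition smooth_on :: "('a::real_normed_vector \<Rightarrow> 'b::real_normed_vector) \<Rightarrow> 'a set \<Rightarrow> bool" where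
  "smooth_on f U \<longleftrightarrow> (\<forall>k. Ck_on k f U)"

text \<open>
  The dimension of the manifold is the cardinality of the index type \<open>'m\<close>; the argument of type
  \<open>'m itself\<close> carries it wherever it does not appear otherwise.
\<close>
definition local_params :: "'a::euclidean_space set \<Rightarrow> ((real^'m) set \<times> (real^'m \<Rightarrow> 'a)) set" where
  "local_params M = {(U, \<phi>). open U \<and> smooth_on \<phi> U \<and>
     (\<forall>x\<in>U. inj (frechet_derivative \<phi> (at x))) \<and>
     openin (top_of_set M) (\<phi> ` U) \<and> (\<exists>\<psi>. homeomorphism U (\<phi> ` U) \<phi> \<psi>)}"

definition smooth_submanifold :: "'m::finite itself \<Rightarrow> 'a::euclidean_space set \<Rightarrow> bool" where
  "smooth_submanifold T M \<longleftrightarrow>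
     (\<forall>p\<in>M. \<exists>(U, \<phi>) \<in> (local_params M :: ((real^'m) set \<times> (real^'m \<Rightarrow> 'a)) set). p \<in> \<phi> ` U)"

text \<open>
  At a common point \<open>\<phi> x = \<psi> y\<close>, the matrix \<open>A\<close> below is the Jacobian of the change of
  coordinates from \<open>\<phi>\<close> to \<open>\<psi>\<close>.
\<close>
definition orientable :: "'m::finite itself \<Rightarrow> 'a::euclidean_space set \<Rightarrow> bool" where
  "orientable T M \<longleftrightarrow>
     (\<exists>\<A> \<subseteq> (local_params M :: ((real^'m) set \<times> (real^'m \<Rightarrow> 'a)) set).
        (\<forall>p\<in>M. \<exists>(U, \<phi>)\<in>\<A>. p \<in> \<phi> ` U) \<and>
        (\<forall>(U, \<phi>)\<in>\<A>. \<forall>(V, \<psi>)\<in>\<A>. \<forall>x\<in>U. \<forall>y\<in>V. \<phi> x = \<psi> y \<longrightarrow>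
           (\<exists>A::real^'m^'m. det A > 0 \<and>
              (\<forall>v. frechet_derivative \<phi> (at x) v = frechet_derivative \<psi> (at y) (A *v v)))))"

definition gram :: "(real^'m \<Rightarrow> 'a::euclidean_space) \<Rightarrow> real^'m \<Rightarrow> real^'m^'m" where
  "gram \<phi> x = (\<chi> i j. frechet_derivative \<phi> (at x) (axis i 1) \<bullet> frechet_derivative \<phi> (at x) (axis j 1))"

text \<open>
  \<open>V\<close> is the Riemannian volume measure \<open>dx\<close> of \<open>M\<close>: the Borel measure on \<open>M\<close> which in local
  coordinates is \<open>sqrt (det g)\<close> times Lebesgue measure, \<open>g\<close> being the metric induced by the
  ambient inner product. These conditions determine \<open>V\<close> uniquely, as countably many images of
  local parametrizations cover \<open>M\<close>.
\<close>
definition is_volume_measure :: "'m::finite itself \<Rightarrow> 'a::euclidean_space set \<Rightarrow> 'a measure \<Rightarrow> bool" where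
  "is_volume_measure T M V \<longleftrightarrow>
     sets V = sets (restrict_space borel M) \<and>
     (\<forall>(U, \<phi>) \<in> (local_params M :: ((real^'m) set \<times> (real^'m \<Rightarrow> 'a)) set).
        \<forall>A\<in>sets V. A \<subseteq> \<phi> ` U \<longrightarrow>
          emeasure V A =
            (\<integral>\<^sup>+x\<in>U. ennreal (indicator A (\<phi> x) * sqrt (det (gram \<phi> x))) \<partial>lborel))"

definition tangent_space :: "'a::euclidean_space set \<Rightarrow> 'a \<Rightarrow> 'a set" where
  "tangent_space M p =
     {v. \<exists>\<gamma>::real \<Rightarrow> 'a. (\<forall>t. \<gamma> t \<in> M) \<and> \<gamma> 0 = p \<and> (\<gamma> has_vector_derivative v) (at 0)}"

text \<open>
  The derivative of \<open>f\<close> along \<open>M\<close> is determined only on the tangent space; the gradient is the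
  tangent vector representing it.
\<close>
definition grad :: "'a::euclidean_space set \<Rightarrow> ('a \<Rightarrow> real) \<Rightarrow> 'a \<Rightarrow> 'a" where
  "grad M f p =
     (THE g. g \<in> tangent_space M p \<and> (f has_derivative (\<lambda>v. g \<bullet> v)) (at p within M))"

definition C1_on_manifold :: "'a::euclidean_space set \<Rightarrow> ('a \<Rightarrow> real) \<Rightarrow> bool" where
  "C1_on_manifold M f \<longleftrightarrow>
     (\<forall>p\<in>M. f differentiable (at p within M)) \<and> continuous_on M (grad M f)"

section \<open>Weighted Lebesgue and Sobolev spaces\<close>

text \<open>
  Throughout, \<open>V\<close> is the volume measure of \<open>M\<close> and \<open>\<rho>\<close> a density with respect to it. Elements of
  \<open>L\<^sup>2(\<rho>)\<close> are represented by functions, of which only the values on \<open>M\<close> matter.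
\<close>

definition L2 :: "'a measure \<Rightarrow> ('a \<Rightarrow> real) \<Rightarrow> ('a \<Rightarrow> real) set" where
  "L2 V \<rho> = {u \<in> borel_measurable V. integrable V (\<lambda>x. (u x)\<^sup>2 * \<rho> x)}"

definition ip :: "'a measure \<Rightarrow> ('a \<Rightarrow> real) \<Rightarrow> ('a \<Rightarrow> real) \<Rightarrow> ('a \<Rightarrow> real) \<Rightarrow> real" where
  "ip V \<rho> u v = (\<integral>x. u x * v x * \<rho> x \<partial>V)"

text \<open>
  The tangential vector field \<open>g\<close> is the distributional gradient of \<open>u\<close> on the open subset
  \<open>{\<rho> > 0}\<close> of \<open>M\<close>: in every local parametrization \<open>\<phi>\<close> of this subset, the weak derivative of
  \<open>u \<circ> \<phi>\<close> in direction \<open>v\<close> is \<open>g \<circ> \<phi>\<close> paired with the derivative of \<open>\<phi>\<close> in direction \<open>v\<close>.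
  Elements of \<open>L\<^sup>2(\<rho>)\<close> carry no information where \<open>\<rho>\<close> vanishes.
  Integrability is required because the Bochner integral of a non-integrable function is \<open>0\<close>.
\<close>
definition has_weak_gradient ::
  "'m::finite itself \<Rightarrow> 'a::euclidean_space set \<Rightarrow> 'a measure \<Rightarrow> ('a \<Rightarrow> real) \<Rightarrow>
   ('a \<Rightarrow> real) \<Rightarrow> ('a \<Rightarrow> 'a) \<Rightarrow> bool" where
  "has_weak_gradient T M V \<rho> u g \<longleftrightarrow>
     g \<in> borel_measurable V \<and>
     (\<forall>p\<in>M. \<rho> p > 0 \<longrightarrow> g p \<in> tangent_space M p) \<and>
     (\<forall>(U, \<phi>) \<in> (local_params M :: ((real^'m) set \<times> (real^'m \<Rightarrow> 'a)) set).
        (\<forall>x\<in>U. \<rho> (\<phi> x) > 0) \<longrightarrow>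
        (\<forall>\<psi>::real^'m \<Rightarrow> real. \<forall>v.
           smooth_on \<psi> UNIV \<and> (\<exists>K. compact K \<and> K \<subseteq> U \<and> (\<forall>x. x \<notin> K \<longrightarrow> \<psi> x = 0)) \<longrightarrow>
           set_integrable lborel U (\<lambda>x. u (\<phi> x) * frechet_derivative \<psi> (at x) v) \<and>
           set_integrable lborel U (\<lambda>x. (g (\<phi> x) \<bullet> frechet_derivative \<phi> (at x) v) * \<psi> x) \<and>
           (LINT x:U|lborel. u (\<phi> x) * frechet_derivative \<psi> (at x) v) =
             - (LINT x:U|lborel. (g (\<phi> x) \<bullet> frechet_derivative \<phi> (at x) v) * \<psi> x)))"

text \<open>The weak gradient is unique almost everywhere on \<open>{\<rho> > 0}\<close>.\<close>
definition weak_grad ::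
  "'m::finite itself \<Rightarrow> 'a::euclidean_space set \<Rightarrow> 'a measure \<Rightarrow> ('a \<Rightarrow> real) \<Rightarrow>
   ('a \<Rightarrow> real) \<Rightarrow> 'a \<Rightarrow> 'a" where
  "weak_grad T M V \<rho> u = (SOME g. has_weak_gradient T M V \<rho> u g)"

definition H1 ::
  "'m::finite itself \<Rightarrow> 'a::euclidean_space set \<Rightarrow> 'a measure \<Rightarrow> ('a \<Rightarrow> real) \<Rightarrow> ('a \<Rightarrow> real) set" where
  "H1 T M V \<rho> = {u \<in> L2 V \<rho>. (\<exists>g. has_weak_gradient T M V \<rho> u g) \<and>
     integrable V (\<lambda>x. (norm (weak_grad T M V \<rho> u x))\<^sup>2 * \<rho> x)}"

definition dirichlet_form ::
  "'m::finite itself \<Rightarrow> 'a::euclidean_space set \<Rightarrow> 'a measure \<Rightarrow> ('a \<Rightarrow> real) \<Rightarrow>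
   ('a \<Rightarrow> real) \<Rightarrow> ('a \<Rightarrow> real) \<Rightarrow> real" where
  "dirichlet_form T M V \<rho> u v =
     (\<integral>x. (weak_grad T M V \<rho> u x \<bullet> weak_grad T M V \<rho> v x) * \<rho> x \<partial>V)"

section \<open>The weighted Laplacian and its spectrum\<close>

text \<open>
  \<open>f = \<Delta>\<^sub>\<rho> u\<close>, for the self-adjoint operator \<open>\<Delta>\<^sub>\<rho> u = - (1/\<rho>) div (\<rho> \<nabla>u)\<close> on \<open>L\<^sup>2(\<rho>)\<close>, which
  is the operator associated with the Dirichlet form. The weak form is needed since for
  densities that are merely \<open>C\<^sup>1\<close>, and may vanish, eigenfunctions need not be twice differentiable.
\<close>
definition weighted_laplacian ::
  "'m::finite itself \<Rightarrow> 'a::euclidean_space set \<Rightarrow> 'a measure \<Rightarrow> ('a \<Rightarrow> real) \<Rightarrow>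
   ('a \<Rightarrow> real) \<Rightarrow> ('a \<Rightarrow> real) \<Rightarrow> bool" where
  "weighted_laplacian T M V \<rho> u f \<longleftrightarrow>
     u \<in> H1 T M V \<rho> \<and> f \<in> L2 V \<rho> \<and>
     (\<forall>v \<in> H1 T M V \<rho>. ip V \<rho> f v = dirichlet_form T M V \<rho> u v)"

text \<open>
  A listing of the spectrum of \<open>\<Delta>\<^sub>\<rho>\<close>, if it is discrete: eigenvalues in increasing order, with
  multiplicity and without finite accumulation point, and an orthonormal basis of \<open>L\<^sup>2(\<rho>)\<close>
  consisting of corresponding eigenfunctions.
\<close>
definition eigenbasis ::
  "'m::finite itself \<Rightarrow> 'a::euclidean_space set \<Rightarrow> 'a measure \<Rightarrow> ('a \<Rightarrow> real) \<Rightarrow>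
   (nat \<Rightarrow> real) \<Rightarrow> (nat \<Rightarrow> 'a \<Rightarrow> real) \<Rightarrow> bool" where
  "eigenbasis T M V \<rho> ev us \<longleftrightarrow>
     incseq ev \<and> filterlim ev at_top sequentially \<and>
     (\<forall>l. weighted_laplacian T M V \<rho> (us l) (\<lambda>x. ev l * us l x)) \<and>
     (\<forall>i j. ip V \<rho> (us i) (us j) = (if i = j then 1 else 0)) \<and>
     (\<forall>f \<in> L2 V \<rho>. (\<lambda>n. \<integral>x. (f x - (\<Sum>l<n. ip V \<rho> f (us l) * us l x))\<^sup>2 * \<rho> x \<partial>V)
        \<longlonglongrightarrow> 0)"

definition discrete_spectrum ::
  "'m::finite itself \<Rightarrow> 'a::euclidean_space set \<Rightarrow> 'a measure \<Rightarrow> ('a \<Rightarrow> real) \<Rightarrow> bool" where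
  "discrete_spectrum T M V \<rho> \<longleftrightarrow> (\<exists>ev us. eigenbasis T M V \<rho> ev us)"

text \<open>
  \<open>u\<close> lists the first \<open>N = CARD('n)\<close> eigenfunctions, the bijection \<open>idx\<close> numbering the elements of
  \<open>'n\<close> (and hence the coordinates of \<open>real^'n\<close>) from \<open>0\<close> to \<open>N - 1\<close>.
\<close>
definition first_eigenfunctions ::
  "'m::finite itself \<Rightarrow> 'a::euclidean_space set \<Rightarrow> 'a measure \<Rightarrow> ('a \<Rightarrow> real) \<Rightarrow>
   ('n::finite \<Rightarrow> 'a \<Rightarrow> real) \<Rightarrow> bool" where
  "first_eigenfunctions T M V \<rho> u \<longleftrightarrow>
     (\<exists>ev us idx. eigenbasis T M V \<rho> ev us \<and> bij_betw idx (UNIV :: 'n set) {..<CARD('n)} \<and>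
        (\<forall>i. u i = us (idx i)))"

section \<open>Mixture models\<close>

definition probability_density :: "'a set \<Rightarrow> 'a measure \<Rightarrow> ('a \<Rightarrow> real) \<Rightarrow> bool" where
  "probability_density M V \<rho> \<longleftrightarrow>
     (\<forall>x\<in>M. \<rho> x \<ge> 0) \<and> integrable V \<rho> \<and> (\<integral>x. \<rho> x \<partial>V) = 1"

definition mixture :: "('n::finite \<Rightarrow> real) \<Rightarrow> ('n \<Rightarrow> 'a \<Rightarrow> real) \<Rightarrow> 'a \<Rightarrow> real" where
  "mixture w \<rho>s x = (\<Sum>k\<in>UNIV. w k * \<rho>s k x)"

definition overlap :: "'a measure \<Rightarrow> ('n::finite \<Rightarrow> real) \<Rightarrow> ('n \<Rightarrow> 'a \<Rightarrow> real) \<Rightarrow> real" where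
  "overlap V w \<rho>s = Max {(\<integral>x. \<rho>s i x * \<rho>s j x / mixture w \<rho>s x \<partial>V) | i j. i \<noteq> j}"

text \<open>
  The integral defining the coupling parameter may be infinite, so it is taken in \<open>ennreal\<close>.
  Division of a real number by \<open>enn2real (coupling M V w \<rho>s)\<close> then has the correct value \<open>0\<close> for
  infinite coupling.
\<close>
definition coupling_k ::
  "'a::euclidean_space set \<Rightarrow> 'a measure \<Rightarrow> ('n::finite \<Rightarrow> real) \<Rightarrow> ('n \<Rightarrow> 'a \<Rightarrow> real) \<Rightarrow> 'n \<Rightarrow> ennreal" where
  "coupling_k M V w \<rho>s k =
     (\<integral>\<^sup>+x\<in>{x. \<rho>s k x > 0}.
        ennreal ((norm (grad M (\<rho>s k) x /\<^sub>R \<rho>s k x - grad M (mixture w \<rho>s) x /\<^sub>R mixture w \<rho>s x))\<^sup>2 * \<rho>s k x)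
      \<partial>V) / 4"

definition coupling ::
  "'a::euclidean_space set \<Rightarrow> 'a measure \<Rightarrow> ('n::finite \<Rightarrow> real) \<Rightarrow> ('n \<Rightarrow> 'a \<Rightarrow> real) \<Rightarrow> ennreal" where
  "coupling M V w \<rho>s = Max (range (coupling_k M V w \<rho>s))"

definition indivisibility_k ::
  "'m::finite itself \<Rightarrow> 'a::euclidean_space set \<Rightarrow> 'a measure \<Rightarrow> ('a \<Rightarrow> real) \<Rightarrow> real" where
  "indivisibility_k T M V \<rho> =
     Inf {dirichlet_form T M V \<rho> u u / ip V \<rho> u u | u.
            u \<in> H1 T M V \<rho> \<and> ip V \<rho> u u \<noteq> 0 \<and> ip V \<rho> u (\<lambda>_. 1) = 0}"

definition indivisibility ::
  "'m::finite itself \<Rightarrow> 'a::euclidean_space set \<Rightarrow> 'a measure \<Rightarrow> ('n::finite \<Rightarrow> 'a \<Rightarrow> real) \<Rightarrow> real" where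
  "indivisibility T M V \<rho>s = Min (range (\<lambda>k. indivisibility_k T M V (\<rho>s k)))"

definition embedding :: "('n::finite \<Rightarrow> 'a \<Rightarrow> real) \<Rightarrow> 'a \<Rightarrow> real^'n" where
  "embedding u x = (\<chi> i. u i x)"

section \<open>Orthogonal cone structures\<close>

definition cone_sector :: "'b::euclidean_space \<Rightarrow> real \<Rightarrow> real \<Rightarrow> 'b set" where
  "cone_sector e \<sigma> r = {z. z \<bullet> e / norm z > cos \<sigma> \<and> norm z > r}"

text \<open>For \<open>\<delta> \<ge> 1\<close> the inequality is vacuous, and the property reduces to the ranges of \<open>\<sigma>\<close> and \<open>r\<close>.\<close>
definition orthogonal_cone_structure :: "'b::euclidean_space measure \<Rightarrow> real \<Rightarrow> real \<Rightarrow> real \<Rightarrow> bool" where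
  "orthogonal_cone_structure \<mu> \<sigma> \<delta> r \<longleftrightarrow>
     0 < \<sigma> \<and> \<sigma> < pi / 4 \<and> 0 \<le> \<delta> \<and> 0 < r \<and>
     (\<exists>B. pairwise orthogonal B \<and> (\<forall>e\<in>B. norm e = 1) \<and> span B = UNIV \<and>
        measure \<mu> (\<Union>e\<in>B. cone_sector e \<sigma> r) \<ge> 1 - \<delta>)"

end

theory Submission
  imports Defs
begin

text \<open>
  The functions \<open>q\<^sub>k = sqrt (\<rho>\<^sub>k / \<rho>)\<close> are unit vectors of \<open>L\<^sup>2(\<rho>)\<close> whose mutual inner products are at
  most \<open>sqrt S\<close> and whose Dirichlet energies are the \<open>C\<^sub>k\<close>. The point \<open>(q\<^sub>k(x))\<^sub>k\<close> lies in one of the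
  cones around the coordinate axes unless two of the components are large at \<open>x\<close>, which the overlap
  controls.

  The eigenvalue \<open>\<lambda>\<close> of index \<open>N\<close> (counting from \<open>0\<close>) is at least \<open>\<Theta>\<close>: among the first \<open>N + 1\<close>
  eigenfunctions there is a nontrivial linear combination with vanishing mean against every \<open>\<rho>\<^sub>k\<close>, to
  which the Poincare inequality of each component applies. Hence the \<open>q\<^sub>k\<close> are within \<open>sqrt (C / \<Theta>)\<close>
  of the span of the first \<open>N\<close> eigenfunctions. Their projections are almost orthonormal, and
  Gram--Schmidt turns them into an orthonormal basis in which the embedding is close to \<open>(q\<^sub>k)\<^sub>k\<close> in
  mean square; Markov's inequality then transfers the cone structure.
\<close>

section \<open>Smooth functions\<close>

text \<open>The densities are only C1 and may vanish, so \<open>q k\<close> need not be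
  differentiable and eigenfunctions satisfy their equation only weakly. All gradients are therefore
  weak ones, determined up to null sets of {\<rho> > 0}; their uniqueness rests on the fundamental
  lemma, for which smooth bump functions are built from exp (-1/t). Eigenfunctions of \<rho> may be
  inserted into the Poincare inequality of every component because w k * \<rho>s k \<le> \<rho>:
  square integrability passes to \<rho>s k, and a weak gradient on M restricts to {\<rho>s k > 0}.
  The constant \<tau> enters through \<kappa> = C / \<Theta>. Positivity of the bracket in \<tau>,
  together with \<tau> < 1, gives \<kappa> \<le> \<tau> - sqrt S, so sqrt S + \<kappa> \<le> \<tau>
  bounds the entries of Gram matrix minus identity for the projected \<open>q k\<close>. Then N *
  \<tau> < 1 makes this Gram matrix coercive with constant 1 - N * \<tau>, which keeps Gram-Schmidt
  close to the vectors it starts from. The radius comes from the sum of the squares of the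
  \<open>q k\<close>, which is at least 1 / w_max.\<close>

lemma Ck_on_subset: "Ck_on k f U \<Longrightarrow> W \<subseteq> U \<Longrightarrow> Ck_on k f W"
  by (induction k arbitrary: f) (auto intro: continuous_on_subset)

lemma Ck_on_Suc_imp: "Ck_on (Suc k) f U \<Longrightarrow> Ck_on k f U"
proof (induction k arbitrary: f)
  case 0
  then show ?case
    by (auto intro!: continuous_at_imp_continuous_on dest: differentiable_imp_continuous_within)
qed simp

lemma Ck_on_const: "Ck_on k (\<lambda>_. c) UNIV"
  by (induction k arbitrary: c) (auto simp: frechet_derivative_const)

lemma Ck_on_add: "Ck_on k f UNIV \<Longrightarrow> Ck_on k g UNIV \<Longrightarrow> Ck_on k (\<lambda>x. f x + g x) UNIV"
proof (induction k arbitrary: f g)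
  case 0
  then show ?case by (auto intro: continuous_on_add)
next
  case (Suc k)
  have eq: "frechet_derivative (\<lambda>x. f x + g x) (at x) =
      (\<lambda>v. frechet_derivative f (at x) v + frechet_derivative g (at x) v)" for x
    using Suc.prems
    by (intro frechet_derivative_at[symmetric] has_derivative_add)
      (auto simp flip: frechet_derivative_works)
  show ?case
    using Suc unfolding Ck_on.simps eq by (auto intro: differentiable_add)
qed

lemma Ck_on_mult:
  fixes f g :: "'a::real_normed_vector \<Rightarrow> real"
  shows "Ck_on k f UNIV \<Longrightarrow> Ck_on k g UNIV \<Longrightarrow> Ck_on k (\<lambda>x. f x * g x) UNIV"
proof (induction k arbitrary: f g)
  case 0
  then show ?case by (auto intro: continuous_on_mult)
next
  case (Suc k)
  have eq: "frechet_derivative (\<lambda>x. f x * g x) (at x) =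
      (\<lambda>v. f x * frechet_derivative g (at x) v + frechet_derivative f (at x) v * g x)" for x
    using Suc.prems
    by (intro frechet_derivative_at[symmetric] has_derivative_mult)
      (auto simp flip: frechet_derivative_works)
  \<comment> \<open>The product rule leaves one factor undifferentiated, so the induction hypothesis
    also needs both functions themselves at the lower order.\<close>
  have "Ck_on k f UNIV" "Ck_on k g UNIV"
    using Suc.prems by (auto intro: Ck_on_Suc_imp simp del: Ck_on.simps)
  with Suc show ?case
    unfolding Ck_on.simps eq by (auto intro: differentiable_mult Ck_on_add)
qed

lemma Ck_on_prod:
  fixes f :: "'i \<Rightarrow> 'a::real_normed_vector \<Rightarrow> real"
  assumes "finite I" "\<And>i. i \<in> I \<Longrightarrow> Ck_on k (f i) UNIV"
  shows "Ck_on k (\<lambda>x. \<Prod>i\<in>I. f i x) UNIV"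
  using assms by (induction I rule: finite_induct) (auto intro: Ck_on_const Ck_on_mult)

section \<open>Smooth bump functions supported in boxes\<close>

definition flat :: "nat \<Rightarrow> real \<Rightarrow> real" where
  "flat n t = (if t > 0 then exp (- (1 / t)) / t ^ n else 0)"

text \<open>From the right, x = 1/t turns the function into x^n / exp x with x tending to infinity;
  from the left it vanishes identically.\<close>

lemma flat_tendsto_0: "(flat n \<longlongrightarrow> 0) (at 0)"
proof -
  have "((\<lambda>t::real. (1 / t) ^ n / exp (1 / t)) \<longlongrightarrow> 0) (at_right 0)"
    using tendsto_power_div_exp_0[of n] filterlim_inverse_at_top_right
    unfolding inverse_eq_divide[abs_def] by (rule filterlim_compose[where g = "\<lambda>x::real. x ^ n / exp x"])
  then have "(flat n \<longlongrightarrow> 0) (at_right 0)"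
    by (rule tendsto_cong[THEN iffD1, rotated])
      (auto simp: eventually_at_filter flat_def exp_minus field_simps)
  moreover have "(flat n \<longlongrightarrow> 0) (at_left 0)"
    by (rule tendsto_eventually) (auto simp: eventually_at_filter flat_def)
  ultimately show ?thesis
    by (simp add: filterlim_at_split)
qed

text \<open>Up to linear combinations the family \<open>flat n\<close> is closed under
  differentiation. The smoothness of \<open>flat 0\<close>, the classical function exp (-1/t)
  extended by zero, thus follows by induction without formulas for its higher derivatives.\<close>

lemma has_derivative_flat:
  "(flat n has_real_derivative (flat (n + 2) t - real n * flat (n + 1) t)) (at t)"
proof -
  consider "t > 0" | "t < 0" | "t = 0" by linarith
  then show ?thesis
  proof cases
    case 1
    have "((\<lambda>t. exp (- (1 / t)) / t ^ n) has_real_derivative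
        (flat (n + 2) t - real n * flat (n + 1) t)) (at t)"
    proof (cases n)
      case 0
      with 1 show ?thesis by (auto intro!: derivative_eq_intros simp: flat_def field_simps power2_eq_square)
    next
      case (Suc m)
      have "((\<lambda>t. exp (- (1 / t)) / t ^ n) has_real_derivative
          ((exp (- (1 / t)) * (1 / t\<^sup>2)) * t ^ n - exp (- (1 / t)) * (real n * t ^ (n - 1))) / (t ^ n * t ^ n)) (at t)"
        using 1 by (auto intro!: derivative_eq_intros simp: field_simps power2_eq_square)
      also have "((exp (- (1 / t)) * (1 / t\<^sup>2)) * t ^ n - exp (- (1 / t)) * (real n * t ^ (n - 1))) / (t ^ n * t ^ n)
          = flat (n + 2) t - real n * flat (n + 1) t"
        using 1 Suc by (simp add: flat_def field_simps power2_eq_square)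
      finally show ?thesis .
    qed
    then show ?thesis
      by (rule DERIV_cong_ev[THEN iffD1, OF refl _ refl, rotated])
        (use 1 in \<open>auto simp: flat_def eventually_nhds intro!: exI[of _ "{0<..}"]\<close>)
  next
    case 2
    have "((\<lambda>t. 0) has_real_derivative (flat (n + 2) t - real n * flat (n + 1) t)) (at t)"
      using 2 by (auto simp: flat_def)
    then show ?thesis
      by (rule DERIV_cong_ev[THEN iffD1, OF refl _ refl, rotated])
        (use 2 in \<open>auto simp: flat_def eventually_nhds intro!: exI[of _ "{..<0}"]\<close>)
  next
    case 3
    \<comment> \<open>At 0 the difference quotient of \<open>flat n\<close> is
      \<open>flat (Suc n)\<close>, so the previous limit applies; the claimed derivative is 0 there
      as well.\<close>
    have "((\<lambda>h. (flat n (0 + h) - flat n 0) / h) \<longlongrightarrow> 0) (at 0)"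
      by (rule tendsto_cong[THEN iffD2, OF _ flat_tendsto_0[of "Suc n"]])
        (auto simp: eventually_at_filter flat_def)
    then show ?thesis
      using 3 by (simp add: DERIV_def flat_def)
  qed
qed

text \<open>Differentiation raises n, hence the induction on k with n arbitrary. Affine inner
  functions cover the coordinate differences in \<open>bump\<close>, and their derivative L v does
  not depend on the point.\<close>

lemma Ck_on_flat_affine:
  assumes L: "bounded_linear L"
  shows "Ck_on k (\<lambda>x. flat n (L x + c)) UNIV"
proof (induction k arbitrary: n)
  case 0
  have "continuous_on UNIV (flat n)"
    using has_derivative_flat by (intro DERIV_continuous_on)
  then show ?case
    by (auto intro!: continuous_intros continuous_on_compose2[of UNIV "flat n"]
        bounded_linear.continuous_on[OF L])
next
  case (Suc k)
  have D: "((\<lambda>x. flat n (L x + c)) has_derivative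
      (\<lambda>v. (flat (n + 2) (L x + c) + (- real n) * flat (n + 1) (L x + c)) * L v)) (at x)" for x
  proof -
    have "((\<lambda>x. L x + c) has_derivative L) (at x)"
      using has_derivative_add[OF bounded_linear.has_derivative[OF L has_derivative_ident, of "at x"]
          has_derivative_const] by simp
    from DERIV_compose_FDERIV[OF has_derivative_flat this] show ?thesis
      by (simp add: mult.commute)
  qed
  have "(\<lambda>x. flat n (L x + c)) differentiable at x" for x
    using D by (auto simp: differentiable_def)
  then show ?case
    unfolding Ck_on.simps frechet_derivative_at[OF D, symmetric]
    by (intro conjI ballI allI Ck_on_add Ck_on_mult Suc Ck_on_const) auto
qed

text \<open>The parameter c controls the steepness: for each c > 0 the product is positive exactly
  on the open box, and it tends to the indicator of the box as c grows.\<close>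

definition bump :: "real \<Rightarrow> 'a::euclidean_space \<Rightarrow> 'a \<Rightarrow> 'a \<Rightarrow> real" where
  "bump c a b x = (\<Prod>i\<in>Basis. flat 0 (c * (x \<bullet> i - a \<bullet> i)) * flat 0 (c * (b \<bullet> i - x \<bullet> i)))"

lemma smooth_on_bump: "smooth_on (bump c a b) UNIV"
proof -
  have "Ck_on k (\<lambda>x. flat 0 (c * (x \<bullet> i - a \<bullet> i)) * flat 0 (c * (b \<bullet> i - x \<bullet> i))) UNIV" for k i
  proof (rule Ck_on_mult)
    show "Ck_on k (\<lambda>x. flat 0 (c * (x \<bullet> i - a \<bullet> i))) UNIV"
      using Ck_on_flat_affine[of "\<lambda>x. c * (x \<bullet> i)" k 0 "- c * (a \<bullet> i)"]
      by (simp add: algebra_simps bounded_linear_intros)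
    have "bounded_linear (\<lambda>x::'a. - (c * (x \<bullet> i)))"
      by (intro bounded_linear_minus bounded_linear_const_mult bounded_linear_inner_left)
    then show "Ck_on k (\<lambda>x. flat 0 (c * (b \<bullet> i - x \<bullet> i))) UNIV"
      using Ck_on_flat_affine[of "\<lambda>x. - (c * (x \<bullet> i))" k 0 "c * (b \<bullet> i)"]
      by (simp add: algebra_simps)
  qed
  then show ?thesis
    unfolding smooth_on_def bump_def[abs_def] by (auto intro: Ck_on_prod)
qed

lemma flat0_bounds: "0 \<le> flat 0 t" "flat 0 t \<le> 1"
  by (auto simp: flat_def)

lemma bump_bounds: "0 \<le> bump c a b x" "bump c a b x \<le> 1"
  unfolding bump_def by (auto intro!: prod_nonneg prod_le_1 mult_le_one mult_nonneg_nonneg flat0_bounds)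

lemma bump_pos_iff: "c > 0 \<Longrightarrow> bump c a b x > 0 \<longleftrightarrow> x \<in> box a b"
proof -
  assume c: "c > 0"
  have "bump c a b x \<noteq> 0 \<longleftrightarrow> x \<in> box a b"
    using c unfolding bump_def by (auto simp: mem_box flat_def zero_less_mult_iff split: if_splits)
  then show ?thesis
    using bump_bounds(1)[of c a b x] by linarith
qed

lemma bump_eq_0: "c > 0 \<Longrightarrow> x \<notin> box a b \<Longrightarrow> bump c a b x = 0"
  using bump_pos_iff[of c a b x] bump_bounds(1)[of c a b x] by linarith

lemma bump_tendsto_indicator: "(\<lambda>n. bump (real (Suc n)) a b x) \<longlonglongrightarrow> indicator (box a b) x"
proof (cases "x \<in> box a b")
  case True
  have lim: "(\<lambda>n. flat 0 (real (Suc n) * d)) \<longlonglongrightarrow> 1" if "d > 0" for d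
  proof -
    have "(\<lambda>n. exp (- (inverse (real (Suc n)) * (1 / d)))) \<longlonglongrightarrow> exp (- (0 * (1 / d)))"
      by (intro tendsto_intros LIMSEQ_inverse_real_of_nat)
    then show ?thesis
      using that by (simp add: flat_def zero_less_mult_iff divide_inverse mult_ac del: of_nat_Suc)
  qed
  have "(\<lambda>n. bump (real (Suc n)) a b x) \<longlonglongrightarrow> (\<Prod>i\<in>(Basis::'a set). 1 * 1)"
    unfolding bump_def using True
    by (intro tendsto_prod tendsto_mult lim) (auto simp: mem_box)
  then show ?thesis
    using True by simp
next
  case False
  then show ?thesis by (simp add: bump_eq_0 del: of_nat_Suc)
qed

lemma smooth_on_mult:
  fixes f g :: "'a::real_normed_vector \<Rightarrow> real"
  shows "smooth_on f UNIV \<Longrightarrow> smooth_on g UNIV \<Longrightarrow> smooth_on (\<lambda>x. f x * g x) UNIV"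
  by (simp add: smooth_on_def Ck_on_mult)

lemma smooth_onD:
  assumes "smooth_on f U"
  shows "x \<in> U \<Longrightarrow> (f has_derivative frechet_derivative f (at x)) (at x)"
    and "continuous_on U f"
    and "continuous_on U (\<lambda>x. frechet_derivative f (at x) v)"
proof -
  have "Ck_on 0 f U" "Ck_on (Suc 0) f U"
    using assms unfolding smooth_on_def by blast+
  then show "x \<in> U \<Longrightarrow> (f has_derivative frechet_derivative f (at x)) (at x)"
    and "continuous_on U f"
    and "continuous_on U (\<lambda>x. frechet_derivative f (at x) v)"
    by (auto simp flip: frechet_derivative_works)
qed

section \<open>The fundamental lemma of the calculus of variations\<close>

text \<open>Open boxes are an intersection-stable generator of the Borel sets, and the sets over
  which F integrates to 0 form a Dynkin system. So all Borel integrals of F vanish, and F is a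
  density of the zero measure.\<close>

lemma AE_eq_0_if_box_integrals_0:
  fixes F :: "'a::euclidean_space \<Rightarrow> real"
  assumes F: "integrable lborel F" and F0: "\<And>x. x \<notin> box c d \<Longrightarrow> F x = 0"
    and box: "\<And>a b. (LINT x:box a b|lborel. F x) = 0"
  shows "AE x in lborel. F x = 0"
proof -
  have int: "set_integrable lborel A F" if "A \<in> sets borel" for A
    unfolding set_integrable_def by (rule integrable_mult_indicator) (use that F in auto)
  have stable: "Int_stable (range (\<lambda>(a, b). box a b :: 'a set))"
    by (auto simp: Int_stable_def box_Int_box)
  have pow: "range (\<lambda>(a, b). box a b :: 'a set) \<subseteq> Pow UNIV"
    by simp
  have "(LINT x:A|lborel. F x) = 0" if A: "A \<in> sigma_sets UNIV (range (\<lambda>(a, b). box a b))" for A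
    using stable pow A
  proof (induction rule: sigma_sets_induct_disjoint)
    case (compl A)
    then have A: "A \<in> sets borel" unfolding borel_eq_box by (simp add: sets_measure_of)
    \<comment> \<open>Complements require the total integral to vanish; since F is 0 off
      \<open>box c d\<close>, it is one of the box integrals.\<close>
    have "(LINT x:box c d|lborel. F x) = (LINT x|lborel. F x)"
      unfolding set_lebesgue_integral_def
      by (intro Bochner_Integration.integral_cong) (auto simp: F0 indicator_def)
    then have "(LINT x|lborel. F x) = 0"
      using box by simp
    moreover have "(LINT x|lborel. F x) = (LINT x:A|lborel. F x) + (LINT x:UNIV - A|lborel. F x)"
      using set_integral_Un[of A "UNIV - A" lborel F] A int[of A] int[of "UNIV - A"]
      by (auto simp: set_lebesgue_integral_def[of _ UNIV])
    ultimately show ?case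
      using compl by simp
  next
    case (union A)
    then have A: "A i \<in> sets borel" for i
      unfolding borel_eq_box by (auto simp: sets_measure_of)
    have "(LINT x:(\<Union>i. A i)|lborel. F x) = (\<Sum>i. (LINT x:A i|lborel. F x))"
      using A union int[of "\<Union>i. A i"]
      by (intro lebesgue_integral_countable_add) (auto simp: disjoint_family_on_def)
    then show ?case
      using union by simp
  qed (use box in \<open>auto simp: set_lebesgue_integral_def\<close>)
  then have "(LINT x:A|lborel. F x) = 0" if "A \<in> sets borel" for A
    using that unfolding borel_eq_box by (simp add: sets_measure_of)
  then show ?thesis
    by (intro density_unique_real[of lborel F "\<lambda>_. 0"]) (auto simp: F)
qed

text \<open>Only products of f with test functions are known to be integrable. On a box with closure
  in U, f is replaced by its product F with a bump that is positive there; steeper and steeper bumps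
  then show that F integrates to 0 over every box. Countably many boxes cover U.\<close>

lemma fundamental_lemma:
  fixes f :: "'a::euclidean_space \<Rightarrow> real"
  assumes U: "open U"
    and zero: "\<And>\<psi>. smooth_on \<psi> UNIV \<Longrightarrow> \<exists>K. compact K \<and> K \<subseteq> U \<and> (\<forall>x. x \<notin> K \<longrightarrow> \<psi> x = 0) \<Longrightarrow>
      set_integrable lborel U (\<lambda>x. f x * \<psi> x) \<and> (LINT x:U|lborel. f x * \<psi> x) = 0"
  shows "AE x in lborel. x \<in> U \<longrightarrow> f x = 0"
proof -
  have loc: "AE x in lborel. x \<in> box c d \<longrightarrow> f x = 0" if cd: "cbox c d \<subseteq> U" for c d
  proof -
    define F where "F x = indicator U x * (f x * bump 1 c d x)" for x
    have supp: "\<exists>K. compact K \<and> K \<subseteq> U \<and> (\<forall>x. x \<notin> K \<longrightarrow> bump 1 c d x * g x = 0)" for g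
      using cd box_subset_cbox[of c d] by (intro exI[of _ "cbox c d"]) (auto intro!: bump_eq_0)
    have F: "integrable lborel F"
      using zero[of "bump 1 c d"] smooth_on_bump[of 1 c d] supp[of "\<lambda>_. 1"]
      unfolding F_def[abs_def] by (auto simp: set_integrable_def)
    have F0: "F x = 0" if "x \<notin> box c d" for x
      using that by (simp add: F_def bump_eq_0)
    have "(LINT x:box a b|lborel. F x) = 0" for a b
    proof -
      have "(\<lambda>n. LINT x|lborel. F x * bump (real (Suc n)) a b x) \<longlonglongrightarrow>
          (LINT x|lborel. F x * indicator (box a b) x)"
      proof (rule integral_dominated_convergence[where w = "\<lambda>x. \<bar>F x\<bar>"])
        have "bump (real (Suc n)) a b \<in> borel_measurable borel" for n
          by (intro borel_measurable_continuous_onI smooth_onD(2)[OF smooth_on_bump])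
        then show "(\<lambda>x. F x * bump (real (Suc n)) a b x) \<in> borel_measurable lborel" for n
          using F by (intro borel_measurable_times) (auto simp del: of_nat_Suc)
        show "AE x in lborel. (\<lambda>n. F x * bump (real (Suc n)) a b x) \<longlonglongrightarrow> F x * indicator (box a b) x"
          by (intro AE_I2 tendsto_mult tendsto_const bump_tendsto_indicator)
        show "AE x in lborel. norm (F x * bump (real (Suc n)) a b x) \<le> \<bar>F x\<bar>" for n
          using bump_bounds[of "real (Suc n)" a b]
          by (intro AE_I2) (auto simp: abs_mult intro!: mult_left_le simp del: of_nat_Suc)
      qed (use F in auto)
      \<comment> \<open>The product of the fixed and the steep bump is again a test function,
        supported in \<open>cbox c d\<close>.\<close>
      moreover have "(LINT x|lborel. F x * bump (real (Suc n)) a b x) = 0" for n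
        using zero[OF smooth_on_mult[OF smooth_on_bump smooth_on_bump] supp, of "real (Suc n)" a b]
        by (simp add: F_def set_lebesgue_integral_def mult_ac)
      ultimately have "(LINT x|lborel. F x * indicator (box a b) x) = 0"
        by (simp add: LIMSEQ_const_iff)
      then show ?thesis
        by (simp add: set_lebesgue_integral_def mult.commute)
    qed
    then have "AE x in lborel. F x = 0"
      using F F0 by (intro AE_eq_0_if_box_integrals_0)
    then show ?thesis
    proof (rule eventually_mono)
      fix x assume "F x = 0"
      then show "x \<in> box c d \<longrightarrow> f x = 0"
        using cd box_subset_cbox[of c d] bump_pos_iff[of 1 c d x] by (auto simp: F_def indicator_def)
    qed
  qed
  define D where "D = {box c d | c d. cbox c d \<subseteq> U}"
  obtain D' where D': "D' \<subseteq> D" "countable D'" "\<Union>D' = \<Union>D"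
    by (rule Lindelof[of D]) (auto simp: D_def)
  have "\<forall>B\<in>D'. AE x in lborel. x \<in> B \<longrightarrow> f x = 0"
    using D'(1) loc by (auto simp: D_def)
  then have "AE x in lborel. \<forall>B\<in>D'. x \<in> B \<longrightarrow> f x = 0"
    using D'(2) AE_ball_countable[of D' "\<lambda>x B. x \<in> B \<longrightarrow> f x = 0" lborel] by blast
  then show ?thesis
  proof (rule eventually_mono)
    fix x assume *: "\<forall>B\<in>D'. x \<in> B \<longrightarrow> f x = 0"
    have "x \<in> \<Union>D" if xU: "x \<in> U"
    proof -
      obtain a b where "cbox a b \<subseteq> U" "x \<in> box a b"
        by (rule open_contains_cbox[OF U xU])
      then show ?thesis by (auto simp: D_def)
    qed
    with * D'(3) show "x \<in> U \<longrightarrow> f x = 0"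
      by blast
  qed
qed

section \<open>Integration by parts\<close>

lemma set_integrable_compact_support:
  fixes h :: "'a::euclidean_space \<Rightarrow> real"
  assumes "continuous_on U h" "compact K" "K \<subseteq> U" "\<And>x. x \<in> U \<Longrightarrow> x \<notin> K \<Longrightarrow> h x = 0"
  shows "set_integrable lborel U h"
proof -
  have "integrable lborel (\<lambda>x. indicat_real K x *\<^sub>R h x)"
    by (rule borel_integrable_compact[OF assms(2) continuous_on_subset[OF assms(1,3)]])
  also have "(\<lambda>x. indicat_real K x *\<^sub>R h x) = (\<lambda>x. indicat_real U x *\<^sub>R h x)"
  proof
    fix x show "indicat_real K x *\<^sub>R h x = indicat_real U x *\<^sub>R h x"
      using assms(3) assms(4)[of x] by (cases "x \<in> K"; cases "x \<in> U") auto
  qed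
  finally show ?thesis by (simp add: set_integrable_def)
qed

lemma lborel_integral_translate:
  fixes G :: "'a::euclidean_space \<Rightarrow> real"
  assumes "G \<in> borel_measurable borel"
  shows "(LINT x|lborel. G (c + x)) = (LINT x|lborel. G x)"
  using integral_distr[of "(+) c" lborel borel G, unfolded lborel_distr_plus] assms by simp

lemma has_derivative_off_support:
  assumes "compact K" "\<And>x. x \<notin> K \<Longrightarrow> f x = 0" "x \<notin> K"
  shows "(f has_derivative (\<lambda>_. 0)) (at x)"
  by (rule has_derivative_transform_within_open[of "\<lambda>_. 0" _ _ _ "- K"])
    (use assms in \<open>auto intro: compact_imp_closed\<close>)

text \<open>By translation invariance every difference quotient of G in direction v integrates to 0.
  The quotients converge to the derivative, and the mean value theorem together with the compact
  support bounds them by a constant on a ball.\<close>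

lemma integral_directional_derivative_eq_0:
  fixes G :: "'a::euclidean_space \<Rightarrow> real"
  assumes G: "\<And>x. (G has_derivative G' x) (at x)"
    and cont: "continuous_on UNIV (\<lambda>x. G' x v)"
    and K: "compact K" "\<And>x. x \<notin> K \<Longrightarrow> G x = 0"
  shows "(LINT x|lborel. G' x v) = 0"
proof -
  have contG: "continuous_on UNIV G"
    by (intro continuous_at_imp_continuous_on ballI has_derivative_continuous[OF G])
  have G'0: "G' x v = 0" if "x \<notin> K" for x
    using has_derivative_unique[OF G has_derivative_off_support[OF K that]] by simp
  obtain B where B: "\<And>x. \<bar>G' x v\<bar> \<le> B"
  proof -
    have "bounded ((\<lambda>x. G' x v) ` K)"
      using K cont by (intro compact_imp_bounded compact_continuous_image) (auto intro: continuous_on_subset)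
    then obtain B where "\<And>x. x \<in> K \<Longrightarrow> \<bar>G' x v\<bar> \<le> B"
      by (auto simp: bounded_iff)
    then have "\<bar>G' x v\<bar> \<le> max B 0" for x
      using G'0[of x] by (cases "x \<in> K") (auto intro: max.coboundedI1)
    then show ?thesis using that by blast
  qed
  obtain R where R: "\<And>x. x \<in> K \<Longrightarrow> norm x \<le> R"
    using compact_imp_bounded[OF K(1)] by (auto simp: bounded_iff)
  have lip: "\<bar>G (x + t *\<^sub>R v) - G x\<bar> \<le> t * B" if t: "t > 0" for x t
  proof -
    have "\<exists>y\<in>{0<..<t}. G (x + t *\<^sub>R v) - G (x + 0 *\<^sub>R v) = (\<lambda>h. G' (x + y *\<^sub>R v) (h *\<^sub>R v)) (t - 0)"
    proof (rule mvt_simple[OF t])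
      fix y assume "0 \<le> y" "y \<le> t"
      show "((\<lambda>t. G (x + t *\<^sub>R v)) has_derivative (\<lambda>h. G' (x + y *\<^sub>R v) (h *\<^sub>R v))) (at y within {0..t})"
        by (rule has_derivative_compose[OF _ G]) (auto intro!: derivative_eq_intros)
    qed
    then obtain y where y: "G (x + t *\<^sub>R v) - G x = G' (x + y *\<^sub>R v) (t *\<^sub>R v)" by auto
    have "G' (x + y *\<^sub>R v) (t *\<^sub>R v) = t * G' (x + y *\<^sub>R v) v"
      using linear_cmul[OF has_derivative_linear[OF G]] by simp
    with y t B[of "x + y *\<^sub>R v"] show ?thesis by (simp add: abs_mult)
  qed
  define e where "e n = inverse (real (Suc n))" for n
  have e: "e n > 0" "e n \<le> 1" for n
    by (auto simp: e_def field_simps)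
  \<comment> \<open>The step sizes are at most 1, so all difference quotients vanish outside the
    ball whose radius exceeds that of the support by \<open>norm v\<close>.\<close>
  define R' where "R' = R + norm v"
  have "(\<lambda>n. LINT x|lborel. (G (x + e n *\<^sub>R v) - G x) / e n) \<longlonglongrightarrow> (LINT x|lborel. G' x v)"
  proof (rule integral_dominated_convergence[where w = "\<lambda>x. indicator (cball (0::'a) R') x * B"])
    show "(\<lambda>x. G' x v) \<in> borel_measurable lborel"
      using cont by (simp add: borel_measurable_continuous_onI)
    have "G \<in> borel_measurable borel" "(\<lambda>x. G (x + e n *\<^sub>R v)) \<in> borel_measurable borel" for n
      by (auto intro!: borel_measurable_continuous_onI contG continuous_on_compose2[OF contG] continuous_intros)
    then show "(\<lambda>x. (G (x + e n *\<^sub>R v) - G x) / e n) \<in> borel_measurable lborel" for n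
      by simp
    show "integrable lborel (\<lambda>x. indicator (cball (0::'a) R') x * B)"
      using borel_integrable_compact[of "cball 0 R'" "\<lambda>_. B"] by simp
    show "AE x in lborel. (\<lambda>n. (G (x + e n *\<^sub>R v) - G x) / e n) \<longlonglongrightarrow> G' x v"
    proof (rule AE_I2)
      fix x
      have "((\<lambda>t. G (x + t *\<^sub>R v)) has_derivative (\<lambda>h. G' (x + 0 *\<^sub>R v) (h *\<^sub>R v))) (at 0)"
        by (rule has_derivative_compose[OF _ G]) (auto intro!: derivative_eq_intros)
      moreover have "(\<lambda>h. G' x (h *\<^sub>R v)) = (\<lambda>h. G' x v * h)"
        using linear_cmul[OF has_derivative_linear[OF G]] by (auto simp: mult.commute)
      ultimately have "((\<lambda>t. G (x + t *\<^sub>R v)) has_real_derivative G' x v) (at 0)"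
        by (simp add: has_field_derivative_def)
      then have "(\<lambda>n. (G (x + (0 + e n) *\<^sub>R v) - G (x + 0 *\<^sub>R v)) / e n) \<longlonglongrightarrow> G' x v"
        unfolding DERIV_def
        by (rule filterlim_compose)
          (auto simp: filterlim_at e_def LIMSEQ_inverse_real_of_nat simp del: of_nat_Suc)
      then show "(\<lambda>n. (G (x + e n *\<^sub>R v) - G x) / e n) \<longlonglongrightarrow> G' x v" by simp
    qed
    show "AE x in lborel. norm ((G (x + e n *\<^sub>R v) - G x) / e n) \<le> indicator (cball (0::'a) R') x * B" for n
    proof (rule AE_I2)
      fix x
      show "norm ((G (x + e n *\<^sub>R v) - G x) / e n) \<le> indicator (cball (0::'a) R') x * B"
      proof (cases "x \<in> cball (0::'a) R'")
        case True
        then show ?thesis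
          using lip[OF e(1), of x n] e(1)[of n] by (simp add: field_simps)
      next
        case False
        then have "norm x > R + norm v" by (simp add: R'_def)
        moreover have "norm x \<le> norm (x + e n *\<^sub>R v) + norm v"
        proof -
          have "norm x \<le> norm (x + e n *\<^sub>R v) + norm (e n *\<^sub>R v)"
            using norm_triangle_ineq4[of "x + e n *\<^sub>R v" "e n *\<^sub>R v"] by simp
          also have "norm (e n *\<^sub>R v) \<le> norm v"
            using e[of n] by (simp add: mult_left_le_one_le)
          finally show ?thesis by simp
        qed
        moreover have "norm v \<ge> 0" by simp
        ultimately have "norm x > R" "norm (x + e n *\<^sub>R v) > R" by linarith+
        then have "x \<notin> K" "x + e n *\<^sub>R v \<notin> K"
          using R[of x] R[of "x + e n *\<^sub>R v"] by auto
        then show ?thesis using False K by simp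
      qed
    qed
  qed
  moreover have "(LINT x|lborel. (G (x + e n *\<^sub>R v) - G x) / e n) = 0" for n
  proof -
    have G_int: "integrable lborel G"
      using set_integrable_compact_support[OF contG K(1)] K(2) by (simp add: set_integrable_def)
    have "integrable lborel (\<lambda>x. G (e n *\<^sub>R v + x))"
      using integrable_distr[of "(+) (e n *\<^sub>R v)" lborel borel G, unfolded lborel_distr_plus] G_int
      by simp
    then show ?thesis
      using G_int lborel_integral_translate[of G "e n *\<^sub>R v"]
      by (simp add: add.commute borel_measurable_continuous_onI contG)
  qed
  ultimately have "(\<lambda>n. 0) \<longlonglongrightarrow> (LINT x|lborel. G' x v)"
    by (simp only:)
  then show ?thesis
    by (metis LIMSEQ_const_iff)
qed

text \<open>The product F * \<psi>, extended by zero outside U, is differentiable everywhere,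
  because the open sets U and - K cover the space. Its directional derivative integrates to 0, and
  the product rule splits that integral.\<close>

lemma integration_by_parts:
  fixes F \<psi> :: "'a::euclidean_space \<Rightarrow> real"
  assumes U: "open U" and F: "\<And>x. x \<in> U \<Longrightarrow> (F has_derivative F' x) (at x)"
    and cont: "continuous_on U (\<lambda>x. F' x v)"
    and \<psi>: "smooth_on \<psi> UNIV" and K: "compact K" "K \<subseteq> U" "\<And>x. x \<notin> K \<Longrightarrow> \<psi> x = 0"
  shows "set_integrable lborel U (\<lambda>x. F x * frechet_derivative \<psi> (at x) v)"
    and "set_integrable lborel U (\<lambda>x. F' x v * \<psi> x)"
    and "(LINT x:U|lborel. F x * frechet_derivative \<psi> (at x) v) = - (LINT x:U|lborel. F' x v * \<psi> x)"
proof -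
  let ?\<psi>' = "\<lambda>x. frechet_derivative \<psi> (at x)"
  have contF: "continuous_on U F"
    by (intro continuous_at_imp_continuous_on ballI has_derivative_continuous[OF F])
  have der\<psi>: "(\<psi> has_derivative ?\<psi>' x) (at x)" for x
    using smooth_onD(1)[OF \<psi>] by simp
  have c\<psi>: "continuous_on U \<psi>" "continuous_on U (\<lambda>x. ?\<psi>' x v)"
    using smooth_onD(2,3)[OF \<psi>] by (auto intro: continuous_on_subset)
  have open': "open (- K)" using K by (auto intro: compact_imp_closed)
  have \<psi>'0: "?\<psi>' x = (\<lambda>_. 0)" if "x \<notin> K" for x
    by (rule has_derivative_unique[OF der\<psi> has_derivative_off_support[OF K(1,3) that]])
  show i1: "set_integrable lborel U (\<lambda>x. F x * ?\<psi>' x v)"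
    using K by (intro set_integrable_compact_support[of U _ K] continuous_intros contF c\<psi>) (auto simp: \<psi>'0)
  show i2: "set_integrable lborel U (\<lambda>x. F' x v * \<psi> x)"
    using K by (intro set_integrable_compact_support[of U _ K] continuous_intros cont c\<psi>) auto
  define G where "G x = (if x \<in> U then F x * \<psi> x else 0)" for x
  define G' where "G' x = (if x \<in> U then (\<lambda>v. F x * ?\<psi>' x v + F' x v * \<psi> x) else (\<lambda>_. 0))" for x
  have "(G has_derivative G' x) (at x)" for x
  proof (cases "x \<in> U")
    case True
    have "((\<lambda>x. F x * \<psi> x) has_derivative G' x) (at x)"
      using True by (auto simp: G'_def intro!: has_derivative_mult F der\<psi>)
    then show ?thesis
      by (rule has_derivative_transform_within_open[OF _ U True]) (simp add: G_def)
  next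
    case False
    then have "G' x = (\<lambda>_. 0)" "x \<notin> K" using K by (auto simp: G'_def)
    moreover have "(G has_derivative (\<lambda>_. 0)) (at x)" if "x \<notin> K"
      by (rule has_derivative_off_support[OF K(1) _ that]) (simp add: G_def K(3))
    ultimately show ?thesis by simp
  qed
  moreover have "continuous_on UNIV (\<lambda>x. G' x v)"
  proof -
    have "continuous_on U (\<lambda>x. G' x v)"
      using contF c\<psi> cont by (auto simp: G'_def intro!: continuous_intros cong: continuous_on_cong)
    moreover have "continuous_on (- K) (\<lambda>x. G' x v)"
      by (rule continuous_on_eq[of _ "\<lambda>_. 0"]) (auto simp: G'_def \<psi>'0 K)
    moreover have "U \<union> - K = UNIV" using K by auto
    ultimately show ?thesis
      using continuous_on_open_Un[OF U open'] by metis
  qed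
  ultimately have "(LINT x|lborel. G' x v) = 0"
    by (rule integral_directional_derivative_eq_0[OF _ _ K(1)]) (use K in \<open>auto simp: G_def\<close>)
  moreover have "(LINT x|lborel. G' x v) = (LINT x:U|lborel. F x * ?\<psi>' x v + F' x v * \<psi> x)"
    unfolding set_lebesgue_integral_def
    by (intro Bochner_Integration.integral_cong) (auto simp: G'_def indicator_def)
  ultimately show "(LINT x:U|lborel. F x * ?\<psi>' x v) = - (LINT x:U|lborel. F' x v * \<psi> x)"
    using i1 i2 by (simp add: set_integral_add)
qed

section \<open>Local parametrizations\<close>

locale chart =
  fixes M :: "'a::euclidean_space set" and U :: "(real^'m::finite) set" and \<phi> :: "real^'m \<Rightarrow> 'a"
  assumes chart: "(U, \<phi>) \<in> local_params M"
begin

abbreviation "D x \<equiv> frechet_derivative \<phi> (at x)"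

lemma open_U: "open U"
  and smooth: "smooth_on \<phi> U"
  and inj_D: "x \<in> U \<Longrightarrow> inj (D x)"
  and openin_image: "openin (top_of_set M) (\<phi> ` U)"
  using chart by (auto simp: local_params_def)

lemma image_subset: "\<phi> ` U \<subseteq> M"
  using openin_imp_subset[OF openin_image] .

lemma obtain_inverse:
  obtains \<psi> where "homeomorphism U (\<phi> ` U) \<phi> \<psi>"
  using chart by (auto simp: local_params_def)

lemma has_derivative_D: "x \<in> U \<Longrightarrow> (\<phi> has_derivative D x) (at x)"
  using smooth_onD(1)[OF smooth] .

lemma linear_D: "x \<in> U \<Longrightarrow> linear (D x)"
  using has_derivative_D has_derivative_linear by blast

lemma continuous_on_\<phi>: "continuous_on U \<phi>"
  using smooth_onD(2)[OF smooth] .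

lemma continuous_on_D: "continuous_on U (\<lambda>x. D x v)"
  using smooth_onD(3)[OF smooth] .

text \<open>Weak gradients are tested only in parametrizations whose image lies in {\<rho> > 0};
  shrinking a chart provides such parametrizations near every point of that set.\<close>

lemma restrict:
  assumes "open W" "W \<subseteq> U"
  shows "chart M W \<phi>"
proof -
  obtain \<psi> where \<psi>: "homeomorphism U (\<phi> ` U) \<phi> \<psi>" by (rule obtain_inverse)
  have "openin (top_of_set U) W"
    using assms by (simp add: openin_open_eq[OF open_U])
  then have "openin (top_of_set (\<phi> ` U)) (\<phi> ` W)"
    by (rule homeomorphism_imp_open_map[OF \<psi>])
  then have "openin (top_of_set M) (\<phi> ` W)"
    using openin_image openin_trans by blast
  moreover have "homeomorphism W (\<phi> ` W) \<phi> \<psi>"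
    using homeomorphism_of_subsets[OF \<psi>] assms(2) by blast
  moreover have "smooth_on \<phi> W"
    using smooth assms(2) by (auto simp: smooth_on_def intro: Ck_on_subset)
  ultimately show ?thesis
    using assms inj_D by unfold_locales (auto simp: local_params_def)
qed

text \<open>Secants of M at \<open>\<phi> x\<close> approach \<open>range (D x)\<close> in
  direction. The inverse of the chart is only known to be continuous; the lower bound c for the
  injective \<open>D x\<close> serves instead of its differentiability and makes y - x comparable to
  q - \<phi> x.\<close>

lemma tangent_approx:
  assumes x: "x \<in> U" and e: "e > 0"
  shows "\<exists>d>0. \<forall>q\<in>M. dist q (\<phi> x) < d \<longrightarrow> (\<exists>h. norm (q - \<phi> x - D x h) \<le> e * norm (q - \<phi> x))"
proof -
  obtain \<psi> where \<psi>: "homeomorphism U (\<phi> ` U) \<phi> \<psi>" by (rule obtain_inverse)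
  obtain c where c: "c > 0" "\<And>h. c * norm h \<le> norm (D x h)"
    using linear_inj_bounded_below_pos[OF linear_D[OF x] inj_D[OF x]] by metis
  \<comment> \<open>The bound c / 2 absorbs the remainder into the lower bound for
    \<open>D x\<close>; the bound e * c / 2 yields the relative error e at the end.\<close>
  define \<eta> where "\<eta> = min (c / 2) (e * c / 2)"
  have \<eta>: "\<eta> > 0" "\<eta> \<le> c / 2" "\<eta> \<le> e * c / 2" using c e by (auto simp: \<eta>_def)
  obtain d1 where d1: "d1 > 0" "\<And>y. norm (y - x) < d1 \<Longrightarrow> norm (\<phi> y - \<phi> x - D x (y - x)) \<le> \<eta> * norm (y - x)"
    using has_derivative_D[OF x] \<eta>(1) unfolding has_derivative_at_alt by blast
  have "continuous_on (\<phi> ` U) \<psi>"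
    using \<psi> by (simp add: homeomorphism_def)
  then obtain d2 where d2: "d2 > 0" "\<And>q. q \<in> \<phi> ` U \<Longrightarrow> dist q (\<phi> x) < d2 \<Longrightarrow> dist (\<psi> q) (\<psi> (\<phi> x)) < d1"
    using x d1(1) unfolding continuous_on_iff by blast
  obtain d3 where d3: "d3 > 0" "\<And>q. q \<in> M \<Longrightarrow> dist q (\<phi> x) < d3 \<Longrightarrow> q \<in> \<phi> ` U"
    using openin_image x unfolding openin_euclidean_subtopology_iff by blast
  show ?thesis
  proof (intro exI[of _ "min d2 d3"] conjI ballI impI)
    show "min d2 d3 > 0" using d2 d3 by simp
    fix q assume q: "q \<in> M" "dist q (\<phi> x) < min d2 d3"
    then have "q \<in> \<phi> ` U" using d3 by simp
    define y where "y = \<psi> q"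
    have y: "\<phi> y = q" using \<psi> \<open>q \<in> \<phi> ` U\<close> by (auto simp: y_def homeomorphism_def)
    have "norm (y - x) < d1"
      using d2(2)[OF \<open>q \<in> \<phi> ` U\<close>] q(2) \<psi> x by (simp add: y_def dist_norm homeomorphism_def)
    then have *: "norm (q - \<phi> x - D x (y - x)) \<le> \<eta> * norm (y - x)"
      using d1(2) y by blast
    have "c * norm (y - x) \<le> norm (D x (y - x))" using c by blast
    also have "\<dots> \<le> norm (q - \<phi> x) + norm (q - \<phi> x - D x (y - x))"
      using norm_triangle_ineq4[of "q - \<phi> x" "q - \<phi> x - D x (y - x)"] by simp
    also have "\<dots> \<le> norm (q - \<phi> x) + c / 2 * norm (y - x)"
      using * mult_right_mono[OF \<eta>(2), of "norm (y - x)"] by simp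
    finally have "c / 2 * norm (y - x) \<le> norm (q - \<phi> x)" by (simp add: field_simps)
    then have "e * (c / 2 * norm (y - x)) \<le> e * norm (q - \<phi> x)"
      using e by simp
    moreover have "\<eta> * norm (y - x) \<le> e * c / 2 * norm (y - x)"
      using mult_right_mono[OF \<eta>(3), of "norm (y - x)"] by simp
    ultimately have "norm (q - \<phi> x - D x (y - x)) \<le> e * norm (q - \<phi> x)"
      using * by (simp add: mult_ac)
    then show "\<exists>h. norm (q - \<phi> x - D x h) \<le> e * norm (q - \<phi> x)" by blast
  qed
qed

lemma subspace_range_D: "x \<in> U \<Longrightarrow> subspace (range (D x))"
  using linear_subspace_image[OF linear_D subspace_UNIV] .

text \<open>Velocities of curves are limits of secants, which approach \<open>range (D x)\<close>;
  as a finite-dimensional subspace this range is closed. Conversely, every vector of the range is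
  the velocity of the image of a curve moving along a line in U.\<close>

lemma tangent_space_eq:
  assumes x: "x \<in> U"
  shows "tangent_space M (\<phi> x) = range (D x)"
proof (intro equalityI subsetI)
  fix v assume "v \<in> range (D x)"
  then obtain a where a: "v = D x a" by blast
  obtain e where e: "e > 0" "ball x e \<subseteq> U"
    using open_U x open_contains_ball by blast
  define c where "c = e / (norm a + 1)"
  have c: "c > 0" "c * norm a < e"
  proof -
    have "norm a + 1 > 0" by (simp add: add_nonneg_pos)
    then show "c > 0" "c * norm a < e"
      using e by (auto simp: c_def divide_simps mult.commute)
  qed
  \<comment> \<open>The curve has to stay in M for all real t. The reparametrization c * sin (t / c)
    has derivative 1 at 0 but is bounded by c, so its argument never leaves the ball inside
    U.\<close>
  define \<gamma> where "\<gamma> t = \<phi> (x + (c * sin (t / c)) *\<^sub>R a)" for t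
  have "\<gamma> t \<in> M" for t
  proof -
    have "norm ((c * sin (t / c)) *\<^sub>R a) \<le> c * norm a"
      using c abs_sin_le_one[of "t / c"] by (auto simp: abs_mult mult_left_le_one_le)
    then have "x + (c * sin (t / c)) *\<^sub>R a \<in> ball x e"
      using c by (simp add: dist_norm)
    then show ?thesis
      using e(2) image_subset unfolding \<gamma>_def by blast
  qed
  moreover have "\<gamma> 0 = \<phi> x" by (simp add: \<gamma>_def)
  moreover have "(\<gamma> has_vector_derivative v) (at 0)"
  proof -
    have "((\<lambda>t. c * sin (t / c)) has_real_derivative 1) (at 0)"
      using c by (auto intro!: derivative_eq_intros)
    then have "((\<lambda>t. c * sin (t / c)) has_derivative (\<lambda>t. t)) (at 0)"
      unfolding has_field_derivative_def by (rule has_derivative_eq_rhs) auto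
    from has_derivative_add[OF has_derivative_const has_derivative_scaleR_left[OF this]]
    have "((\<lambda>t. x + (c * sin (t / c)) *\<^sub>R a) has_derivative (\<lambda>t. t *\<^sub>R a)) (at 0)"
      by simp
    moreover have "(\<phi> has_derivative D x) (at (x + (c * sin (0 / c)) *\<^sub>R a))"
      using has_derivative_D[OF x] by simp
    ultimately have "(\<gamma> has_derivative (\<lambda>t. D x (t *\<^sub>R a))) (at 0)"
      unfolding \<gamma>_def[abs_def] by (rule has_derivative_compose)
    then show ?thesis
      using linear_cmul[OF linear_D[OF x]] by (simp add: has_vector_derivative_def a)
  qed
  ultimately show "v \<in> tangent_space M (\<phi> x)"
    unfolding tangent_space_def by blast
next
  fix v assume "v \<in> tangent_space M (\<phi> x)"
  then obtain \<gamma> :: "real \<Rightarrow> 'a" where \<gamma>: "\<And>t. \<gamma> t \<in> M" "\<gamma> 0 = \<phi> x" "(\<gamma> has_vector_derivative v) (at 0)"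
    unfolding tangent_space_def by blast
  have lim: "((\<lambda>t. (\<gamma> t - \<gamma> 0) /\<^sub>R t) \<longlongrightarrow> v) (at 0)"
  proof -
    have "((\<lambda>h. norm (\<gamma> h - \<gamma> 0 - h *\<^sub>R v) / \<bar>h\<bar>) \<longlongrightarrow> 0) (at 0)"
      using \<gamma>(3) by (simp add: has_vector_derivative_def has_derivative_at)
    moreover have "\<forall>\<^sub>F h in at 0. norm (\<gamma> h - \<gamma> 0 - h *\<^sub>R v) / \<bar>h\<bar> = norm ((\<gamma> h - \<gamma> 0) /\<^sub>R h - v)"
    proof -
      have "norm (\<gamma> h - \<gamma> 0 - h *\<^sub>R v) / \<bar>h\<bar> = norm ((\<gamma> h - \<gamma> 0) /\<^sub>R h - v)" if "h \<noteq> 0" for h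
      proof -
        have "(\<gamma> h - \<gamma> 0) /\<^sub>R h - v = (\<gamma> h - \<gamma> 0 - h *\<^sub>R v) /\<^sub>R h"
          using that by (simp add: scaleR_right_diff_distrib)
        then show ?thesis by (simp add: divide_inverse mult.commute)
      qed
      then show ?thesis by (auto simp: eventually_at_filter)
    qed
    ultimately have "((\<lambda>h. norm ((\<gamma> h - \<gamma> 0) /\<^sub>R h - v)) \<longlongrightarrow> 0) (at 0)"
      using tendsto_cong by fast
    then show ?thesis
      by (rule LIM_zero_cancel[OF tendsto_norm_zero_cancel])
  qed
  have "v \<in> closure (range (D x))"
    unfolding closure_approachable
  proof (intro allI impI)
    fix e :: real assume e: "e > 0"
    define e' where "e' = e / (2 * (norm v + 1))"
    have e': "e' > 0" "e' * (norm v + 1) = e / 2"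
    proof -
      have "norm v + 1 > 0" by (simp add: add_nonneg_pos)
      then show "e' > 0" "e' * (norm v + 1) = e / 2"
        using e by (auto simp: e'_def divide_simps mult.commute)
    qed
    obtain d where d: "d > 0" "\<And>q. q \<in> M \<Longrightarrow> dist q (\<phi> x) < d \<Longrightarrow> \<exists>h. norm (q - \<phi> x - D x h) \<le> e' * norm (q - \<phi> x)"
      using tangent_approx[OF x e'(1)] by blast
    have "(\<gamma> \<longlongrightarrow> \<gamma> 0) (at 0)"
      using has_vector_derivative_continuous[OF \<gamma>(3)] by (simp add: continuous_at)
    then have "eventually (\<lambda>t. dist (\<gamma> t) (\<phi> x) < d) (at 0)"
      using d(1) \<gamma>(2) by (simp add: tendsto_iff)
    moreover have "eventually (\<lambda>t. dist ((\<gamma> t - \<gamma> 0) /\<^sub>R t) v < min 1 (e / 2)) (at 0)"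
      using tendstoD[OF lim, of "min 1 (e / 2)"] e by simp
    moreover have "eventually (\<lambda>t::real. t \<noteq> 0) (at 0)"
      by (simp add: eventually_at_filter)
    ultimately have "eventually (\<lambda>t. dist (\<gamma> t) (\<phi> x) < d \<and> dist ((\<gamma> t - \<gamma> 0) /\<^sub>R t) v < min 1 (e / 2) \<and> t \<noteq> 0) (at 0)"
      by (intro eventually_conj)
    then obtain t where t: "dist (\<gamma> t) (\<phi> x) < d" "dist ((\<gamma> t - \<gamma> 0) /\<^sub>R t) v < min 1 (e / 2)" "t \<noteq> 0"
      using eventually_happens'[OF at_neq_bot] by blast
    obtain h where h: "norm (\<gamma> t - \<phi> x - D x h) \<le> e' * norm (\<gamma> t - \<phi> x)"
      using d(2)[OF \<gamma>(1) t(1)] by blast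
    define w where "w = (\<gamma> t - \<gamma> 0) /\<^sub>R t"
    have "w - D x (h /\<^sub>R t) = (\<gamma> t - \<phi> x - D x h) /\<^sub>R t"
      by (simp add: w_def \<gamma>(2) linear_cmul[OF linear_D[OF x]] scaleR_right_diff_distrib)
    then have "norm (w - D x (h /\<^sub>R t)) \<le> (e' * norm (\<gamma> t - \<phi> x)) / \<bar>t\<bar>"
      using h t(3) by (simp add: divide_inverse mult.commute mult_left_mono)
    also have "\<dots> = e' * norm w"
      by (simp add: w_def \<gamma>(2) divide_inverse)
    also have "\<dots> \<le> e' * (norm v + 1)"
      using t(2) e'(1) norm_triangle_ineq2[of w v] by (intro mult_left_mono) (auto simp: w_def[symmetric] dist_norm)
    finally have "norm (w - D x (h /\<^sub>R t)) \<le> e / 2" using e'(2) by simp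
    moreover have "norm (w - v) < e / 2" using t(2) by (simp add: w_def dist_norm)
    ultimately have "dist (D x (h /\<^sub>R t)) v < e"
      using dist_triangle[of "D x (h /\<^sub>R t)" v w] by (simp add: dist_norm norm_minus_commute)
    then show "\<exists>y\<in>range (D x). dist y v < e" by blast
  qed
  then show "v \<in> range (D x)"
    using closed_subspace[OF subspace_range_D[OF x]] by (simp add: closure_closed)
qed

lemma has_derivative_chart:
  assumes x: "x \<in> U" and f: "(f has_derivative f') (at (\<phi> x) within M)"
  shows "((\<lambda>x. f (\<phi> x)) has_derivative (\<lambda>h. f' (D x h))) (at x)"
proof -
  have "(f has_derivative f') (at (\<phi> x) within \<phi> ` U)"
    using f image_subset by (rule has_derivative_subset)
  moreover have "(\<phi> has_derivative D x) (at x within U)"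
    using has_derivative_D[OF x] by (rule has_derivative_at_withinI)
  ultimately have "((\<lambda>x. f (\<phi> x)) has_derivative (\<lambda>h. f' (D x h))) (at x within U)"
    using has_derivative_in_compose by blast
  then show ?thesis
    using at_within_open[OF x open_U] by simp
qed

lemma ex1_grad:
  fixes f :: "'a \<Rightarrow> real"
  assumes x: "x \<in> U" and f: "f differentiable (at (\<phi> x) within M)"
  shows "\<exists>!g. g \<in> tangent_space M (\<phi> x) \<and> (f has_derivative (\<lambda>v. g \<bullet> v)) (at (\<phi> x) within M)"
proof (rule ex_ex1I)
  obtain f' where f': "(f has_derivative f') (at (\<phi> x) within M)"
    using f by (auto simp: differentiable_def)
  define a where "a = adjoint f' 1"
  have a: "f' v = a \<bullet> v" for v
    using adjoint_works[OF has_derivative_linear[OF f'], of v 1] by (simp add: a_def inner_commute)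
  \<comment> \<open>The ambient derivative is not determined in normal directions, so its
    representing vector is split into the tangential candidate g and a normal remainder h.\<close>
  obtain g h where gh: "g \<in> span (range (D x))" "\<And>w. w \<in> span (range (D x)) \<Longrightarrow> orthogonal h w" "a = g + h"
    by (rule orthogonal_subspace_decomp_exists[of "range (D x)" a]) blast
  have span: "span (range (D x)) = range (D x)"
    using subspace_range_D[OF x] by (simp add: span_eq_iff)
  have "(f has_derivative (\<lambda>v. g \<bullet> v)) (at (\<phi> x) within M)"
    unfolding has_derivative_within_alt
  proof (intro conjI allI impI)
    show "bounded_linear ((\<bullet>) g)" by (rule bounded_linear_inner_right)
    fix e :: real assume e: "e > 0"
    define e' where "e' = e / 2 / (norm h + 1)"
    have e': "e' > 0" "norm h * e' \<le> e / 2"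
    proof -
      have "norm h + 1 > 0" by (simp add: add_nonneg_pos)
      then show "e' > 0" "norm h * e' \<le> e / 2"
        using e by (auto simp: e'_def divide_simps mult.commute)
    qed
    obtain d1 where d1: "d1 > 0" "\<And>q. q \<in> M \<Longrightarrow> norm (q - \<phi> x) < d1 \<Longrightarrow>
        norm (f q - f (\<phi> x) - f' (q - \<phi> x)) \<le> e / 2 * norm (q - \<phi> x)"
      using f' e half_gt_zero unfolding has_derivative_within_alt by meson
    obtain d2 where d2: "d2 > 0" "\<And>q. q \<in> M \<Longrightarrow> dist q (\<phi> x) < d2 \<Longrightarrow>
        \<exists>h. norm (q - \<phi> x - D x h) \<le> e' * norm (q - \<phi> x)"
      using tangent_approx[OF x e'(1)] by blast
    show "\<exists>d>0. \<forall>q\<in>M. norm (q - \<phi> x) < d \<longrightarrow>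
        norm (f q - f (\<phi> x) - g \<bullet> (q - \<phi> x)) \<le> e * norm (q - \<phi> x)"
    proof (intro exI[of _ "min d1 d2"] conjI ballI impI)
      show "min d1 d2 > 0" using d1 d2 by simp
      fix q assume q: "q \<in> M" "norm (q - \<phi> x) < min d1 d2"
      obtain k where k: "norm (q - \<phi> x - D x k) \<le> e' * norm (q - \<phi> x)"
        using d2(2)[OF q(1)] q(2) by (auto simp: dist_norm)
      have "h \<bullet> D x k = 0"
        using gh(2) span by (auto simp: orthogonal_def)
      then have "\<bar>h \<bullet> (q - \<phi> x)\<bar> = \<bar>h \<bullet> (q - \<phi> x - D x k)\<bar>"
        by (simp add: inner_diff_right)
      also have "\<dots> \<le> norm h * (e' * norm (q - \<phi> x))"
        using Cauchy_Schwarz_ineq2[of h "q - \<phi> x - D x k"] k mult_left_mono[OF k, of "norm h"] by simp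
      also have "\<dots> \<le> e / 2 * norm (q - \<phi> x)"
        using mult_right_mono[OF e'(2), of "norm (q - \<phi> x)"] by (simp add: mult_ac)
      finally have "\<bar>h \<bullet> (q - \<phi> x)\<bar> \<le> e / 2 * norm (q - \<phi> x)" .
      moreover have "\<bar>f q - f (\<phi> x) - (g \<bullet> (q - \<phi> x) + h \<bullet> (q - \<phi> x))\<bar> \<le> e / 2 * norm (q - \<phi> x)"
        using d1(2)[OF q(1)] q(2) by (simp add: a gh(3) inner_add_left)
      ultimately show "norm (f q - f (\<phi> x) - g \<bullet> (q - \<phi> x)) \<le> e * norm (q - \<phi> x)"
        unfolding real_norm_def by linarith
    qed
  qed
  then show "\<exists>g. g \<in> tangent_space M (\<phi> x) \<and> (f has_derivative (\<lambda>v. g \<bullet> v)) (at (\<phi> x) within M)"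
    using gh(1) span tangent_space_eq[OF x] by blast
next
  fix g g' assume g: "g \<in> tangent_space M (\<phi> x) \<and> (f has_derivative (\<lambda>v. g \<bullet> v)) (at (\<phi> x) within M)"
    and g': "g' \<in> tangent_space M (\<phi> x) \<and> (f has_derivative (\<lambda>v. g' \<bullet> v)) (at (\<phi> x) within M)"
  have eq: "(\<lambda>h. g \<bullet> D x h) = (\<lambda>h. g' \<bullet> D x h)"
    using has_derivative_chart[OF x] g g' has_derivative_unique by blast
  have "g - g' \<in> range (D x)"
    using g g' subspace_diff[OF subspace_range_D[OF x]] unfolding tangent_space_eq[OF x] by blast
  then obtain h where "g - g' = D x h" by blast
  moreover have "(g - g') \<bullet> D x h = 0"
    using fun_cong[OF eq, of h] by (simp add: inner_diff_left)
  ultimately have "(g - g') \<bullet> (g - g') = 0"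
    by simp
  then show "g = g'" by simp
qed

lemma
  fixes f :: "'a \<Rightarrow> real"
  assumes x: "x \<in> U" and f: "f differentiable (at (\<phi> x) within M)"
  shows grad_in_tangent_space: "grad M f (\<phi> x) \<in> tangent_space M (\<phi> x)"
    and has_derivative_grad: "(f has_derivative (\<lambda>v. grad M f (\<phi> x) \<bullet> v)) (at (\<phi> x) within M)"
    and has_derivative_grad_chart: "((\<lambda>x. f (\<phi> x)) has_derivative (\<lambda>h. grad M f (\<phi> x) \<bullet> D x h)) (at x)"
proof -
  show "grad M f (\<phi> x) \<in> tangent_space M (\<phi> x)"
    and 2: "(f has_derivative (\<lambda>v. grad M f (\<phi> x) \<bullet> v)) (at (\<phi> x) within M)"
    using theI'[OF ex1_grad[OF assms]] unfolding grad_def by auto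
  show "((\<lambda>x. f (\<phi> x)) has_derivative (\<lambda>h. grad M f (\<phi> x) \<bullet> D x h)) (at x)"
    using has_derivative_chart[OF x 2] .
qed

lemma grad_eqI:
  fixes f :: "'a \<Rightarrow> real"
  assumes x: "x \<in> U" and g: "g \<in> tangent_space M (\<phi> x)"
    and f: "(f has_derivative (\<lambda>v. g \<bullet> v)) (at (\<phi> x) within M)"
  shows "grad M f (\<phi> x) = g"
  unfolding grad_def
  by (rule the1_equality[OF ex1_grad[OF x] conjI[OF g f]]) (use f in \<open>auto simp: differentiable_def\<close>)

end

text \<open>Along the segment from the identity to A every matrix is positive definite, hence
  invertible, so the determinant cannot pass from 1 to a nonpositive value.\<close>

lemma det_pos_if_positive_definite:
  fixes A :: "real^'m^'m::finite"
  assumes "\<And>y. y \<noteq> 0 \<Longrightarrow> y \<bullet> (A *v y) > 0"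
  shows "det A > 0"
proof (rule ccontr)
  assume neg: "\<not> det A > 0"
  define B where "B t = (1 - t) *\<^sub>R mat 1 + t *\<^sub>R A" for t :: real
  have "continuous_on {0..1} (\<lambda>t. det (B t))"
    unfolding det_def B_def by (auto intro!: continuous_intros)
  moreover have "det (B 0) = 1" "det (B 1) \<le> 0"
    using neg by (auto simp: B_def det_I)
  ultimately obtain t where t: "0 \<le> t" "t \<le> 1" "det (B t) = 0"
    using IVT2'[of "\<lambda>t. det (B t)" 1 0 0] by auto
  then have "\<not> invertible (B t)"
    by (simp add: invertible_det_nz)
  then obtain y where y: "y \<noteq> 0" "B t *v y = 0"
    unfolding invertible_left_inverse matrix_left_invertible_ker by blast
  have "0 = y \<bullet> (B t *v y)" using y by simp
  also have "\<dots> = (1 - t) * (y \<bullet> y) + t * (y \<bullet> (A *v y))"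
    by (simp add: B_def matrix_vector_mult_add_rdistrib inner_add_right scaleR_matrix_vector_assoc[symmetric])
  finally have "(1 - t) * (y \<bullet> y) + t * (y \<bullet> (A *v y)) = 0" by simp
  moreover have "y \<bullet> y > 0" "y \<bullet> (A *v y) > 0" using y assms by auto
  ultimately show False
    using t by (cases "t = 0") (auto simp: add_nonneg_eq_0_iff add_nonneg_pos add_nonneg_eq_0_iff)
qed

text \<open>The quadratic form of the Gram matrix at y is the squared norm of \<open>D x y\<close>,
  and \<open>D x\<close> is injective.\<close>

lemma (in chart) det_gram_pos:
  assumes x: "x \<in> U"
  shows "det (gram \<phi> x) > 0"
proof (rule det_pos_if_positive_definite)
  fix y :: "real^'m" assume y: "y \<noteq> 0"
  have "D x y = D x (\<Sum>i\<in>UNIV. y $ i *\<^sub>R axis i 1)"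
    using basis_expansion[of y] by (simp add: scalar_mult_eq_scaleR)
  also have "\<dots> = (\<Sum>i\<in>UNIV. y $ i *\<^sub>R D x (axis i 1))"
    by (simp add: linear_sum[OF linear_D[OF x]] linear_cmul[OF linear_D[OF x]])
  finally have D: "D x y = (\<Sum>i\<in>UNIV. y $ i *\<^sub>R D x (axis i 1))" .
  have "y \<bullet> (gram \<phi> x *v y) =
      (\<Sum>i\<in>UNIV. \<Sum>j\<in>UNIV. y $ i * (y $ j * (D x (axis i 1) \<bullet> D x (axis j 1))))"
    by (simp add: inner_vec_def gram_def matrix_vector_mult_def sum_distrib_left mult_ac)
  also have "\<dots> = D x y \<bullet> D x y"
    unfolding D inner_sum_left inner_sum_right by (simp add: inner_commute mult.left_commute)
  finally have "y \<bullet> (gram \<phi> x *v y) = D x y \<bullet> D x y" .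
  moreover have "D x y \<noteq> 0"
    using linear_injective_0[OF linear_D[OF x]] inj_D[OF x] y by blast
  ultimately show "y \<bullet> (gram \<phi> x *v y) > 0" by simp
qed

lemma (in chart) continuous_on_sqrt_det_gram: "continuous_on U (\<lambda>x. sqrt (det (gram \<phi> x)))"
  unfolding det_def gram_def by (auto intro!: continuous_intros continuous_on_D)

section \<open>The volume measure\<close>

locale chart_with_volume = chart M U \<phi>
  for M :: "'a::euclidean_space set" and U :: "(real^'m::finite) set" and \<phi> +
  fixes V :: "'a measure"
  assumes volume: "is_volume_measure TYPE('m) M V"
begin

lemma sets_V: "sets V = sets (restrict_space borel M)"
  using volume by (simp add: is_volume_measure_def)

lemma space_V: "space V = M"
  using sets_eq_imp_space_eq[OF sets_V] by (simp add: space_restrict_space)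

lemma image_in_sets: "\<phi> ` U \<in> sets V"
proof -
  obtain T where "open T" "\<phi> ` U = M \<inter> T"
    using openin_image by (auto simp: openin_open)
  then show ?thesis
    by (auto simp: sets_V sets_restrict_space)
qed

lemma measurable_chart: "\<phi> \<in> measurable (restrict_space lborel U) V"
proof -
  have "\<phi> \<in> borel_measurable (restrict_space borel U)"
    using continuous_on_\<phi> by (rule borel_measurable_continuous_on_restrict)
  then have "\<phi> \<in> measurable (restrict_space borel U) (restrict_space borel M)"
    using image_subset by (intro measurable_restrict_space2) (auto simp: space_restrict_space)
  then show ?thesis
    using measurable_cong_sets[OF sets_restrict_space_cong[OF sets_lborel] sets_V, of U] by simp
qed

lemma emeasure_chart:
  "A \<in> sets V \<Longrightarrow> A \<subseteq> \<phi> ` U \<Longrightarrow>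
    emeasure V A = (\<integral>\<^sup>+x\<in>U. ennreal (indicator A (\<phi> x) * sqrt (det (gram \<phi> x))) \<partial>lborel)"
  using volume chart unfolding is_volume_measure_def by fast

text \<open>The formula that defines V on sets says that V, restricted to the chart image, is the
  push-forward of sqrt (det g) times Lebesgue measure on U. As an equality of measures this gives
  the change of variables for all nonnegative integrands at once.\<close>

lemma nn_integral_chart:
  assumes f: "f \<in> borel_measurable V"
  shows "(\<integral>\<^sup>+p\<in>\<phi> ` U. f p \<partial>V) = (\<integral>\<^sup>+x\<in>U. ennreal (sqrt (det (gram \<phi> x))) * f (\<phi> x) \<partial>lborel)"
proof -
  define J where "J x = ennreal (sqrt (det (gram \<phi> x)))" for x
  have U: "U \<in> sets lborel" "U \<in> sets borel" using open_U by auto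
  have J: "J \<in> borel_measurable (restrict_space lborel U)"
    unfolding J_def
    using borel_measurable_continuous_on_restrict[OF continuous_on_sqrt_det_gram]
    by (intro measurable_compose[OF _ measurable_ennreal])
      (simp add: measurable_cong_sets[OF sets_restrict_space_cong[OF sets_lborel]])
  have eq: "density V (indicator (\<phi> ` U)) = distr (density (restrict_space lborel U) J) V \<phi>"
  proof (rule measure_eqI)
    fix A assume "A \<in> sets (density V (indicator (\<phi> ` U)))"
    then have A: "A \<in> sets V" by simp
    have "emeasure (density V (indicator (\<phi> ` U))) A = emeasure V (\<phi> ` U \<inter> A)"
      using A image_in_sets by (simp add: emeasure_density nn_integral_indicator flip: indicator_inter_arith)
    also have "\<dots> = (\<integral>\<^sup>+x\<in>U. ennreal (indicator (\<phi> ` U \<inter> A) (\<phi> x) * sqrt (det (gram \<phi> x))) \<partial>lborel)"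
      using A image_in_sets by (intro emeasure_chart) auto
    also have "\<dots> = (\<integral>\<^sup>+x\<in>U. J x * indicator (\<phi> -` A \<inter> U) x \<partial>lborel)"
      by (intro nn_integral_cong) (auto simp: indicator_def J_def)
    also have "\<dots> = (\<integral>\<^sup>+x. J x * indicator (\<phi> -` A \<inter> U) x \<partial>restrict_space lborel U)"
      using U by (subst nn_integral_restrict_space) auto
    also have "\<dots> = emeasure (density (restrict_space lborel U) J) (\<phi> -` A \<inter> U)"
      using J measurable_sets[OF measurable_chart A] by (subst emeasure_density) (auto simp: space_restrict_space)
    also have "\<dots> = emeasure (distr (density (restrict_space lborel U) J) V \<phi>) A"
      using A measurable_chart by (subst emeasure_distr) (auto simp: space_restrict_space)
    finally show "emeasure (density V (indicator (\<phi> ` U))) A = emeasure (distr (density (restrict_space lborel U) J) V \<phi>) A" .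
  qed simp
  have "(\<integral>\<^sup>+p\<in>\<phi> ` U. f p \<partial>V) = (\<integral>\<^sup>+p. f p \<partial>density V (indicator (\<phi> ` U)))"
    using f image_in_sets by (subst nn_integral_density) (auto simp: mult.commute)
  also have "\<dots> = (\<integral>\<^sup>+x. f (\<phi> x) \<partial>density (restrict_space lborel U) J)"
    unfolding eq using f measurable_chart by (subst nn_integral_distr) auto
  also have "\<dots> = (\<integral>\<^sup>+x. J x * f (\<phi> x) \<partial>restrict_space lborel U)"
    using J measurable_compose[OF measurable_chart f] by (subst nn_integral_density) auto
  also have "\<dots> = (\<integral>\<^sup>+x\<in>U. J x * f (\<phi> x) \<partial>lborel)"
    using U by (subst nn_integral_restrict_space) auto
  finally show ?thesis by (simp add: J_def)
qed

lemma null_if_chart_null: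
  assumes A: "A \<in> sets V" "A \<subseteq> \<phi> ` U" and AE: "AE x in lborel. x \<in> U \<longrightarrow> \<phi> x \<notin> A"
  shows "A \<in> null_sets V"
proof -
  have "emeasure V A = (\<integral>\<^sup>+x. 0 \<partial>(lborel :: (real^'m) measure))"
    unfolding emeasure_chart[OF A] using AE
    by (intro nn_integral_cong_AE) (auto elim!: eventually_mono simp: indicator_def)
  then show ?thesis using A by auto
qed

end

section \<open>From single charts to the whole manifold\<close>

locale manifold_with_volume =
  fixes T :: "'m::finite itself" and M :: "'a::euclidean_space set" and V :: "'a measure"
  assumes manifold: "smooth_submanifold T M" and volume: "is_volume_measure T M V"
begin

lemma sets_V: "sets V = sets (restrict_space borel M)"
  using volume by (simp add: is_volume_measure_def)

lemma space_V: "space V = M"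
  using sets_eq_imp_space_eq[OF sets_V] by (simp add: space_restrict_space)

lemma measurable_V_if_continuous_on:
  fixes f :: "'a \<Rightarrow> 'b::topological_space"
  shows "continuous_on M f \<Longrightarrow> f \<in> borel_measurable V"
  using borel_measurable_continuous_on_restrict[of M f] by (simp add: measurable_cong_sets[OF sets_V])

lemma obtain_chart:
  assumes "p \<in> M"
  obtains U and \<phi> :: "real^'m \<Rightarrow> 'a" and x where "chart_with_volume M U \<phi> V" "x \<in> U" "p = \<phi> x"
proof -
  obtain U and \<phi> :: "real^'m \<Rightarrow> 'a" where c: "(U, \<phi>) \<in> local_params M" "p \<in> \<phi> ` U"
    using manifold assms unfolding smooth_submanifold_def by blast
  then have "chart_with_volume M U \<phi> V"
    using volume
    unfolding chart_with_volume_def chart_def chart_with_volume_axioms_def is_volume_measure_def by blast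
  then show thesis
    using that c(2) by blast
qed

text \<open>The images of charts contained in {\<rho> > 0} cover that set, and by Lindelof countably
  many of them suffice, so the exceptional set is a countable union of null sets. Its measurability
  is assumed because \<open>V\<close> is described in charts for measurable sets only.\<close>

lemma AE_if_charts:
  assumes \<rho>: "continuous_on M \<rho>"
    and B: "{p \<in> M. \<rho> p > 0 \<and> \<not> P p} \<in> sets V"
    and charts: "\<And>U \<phi>. chart_with_volume M (U :: (real^'m) set) \<phi> V \<Longrightarrow> (\<And>x. x \<in> U \<Longrightarrow> \<rho> (\<phi> x) > 0) \<Longrightarrow>
      AE x in lborel. x \<in> U \<longrightarrow> P (\<phi> x)"
  shows "AE p in V. \<rho> p > (0::real) \<longrightarrow> P p"
proof -
  define B where "B = {p \<in> M. \<rho> p > 0 \<and> \<not> P p}"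
  define F where "F = {\<phi> ` U | (U :: (real^'m) set) \<phi>. chart_with_volume M U \<phi> V \<and> (\<forall>x\<in>U. \<rho> (\<phi> x) > 0)}"
  obtain F' where F': "F' \<subseteq> F" "countable F'" "\<Union>F' = \<Union>F"
  proof (rule Lindelof_openin[of F M])
    fix S assume "S \<in> F"
    then show "openin (top_of_set M) S"
      by (auto simp: F_def chart_with_volume_def chart.openin_image)
  qed
  have null: "B \<inter> S \<in> null_sets V" if "S \<in> F" for S
  proof -
    from that obtain U and \<phi> :: "real^'m \<Rightarrow> 'a" where S: "S = \<phi> ` U" "chart_with_volume M U \<phi> V" "\<And>x. x \<in> U \<Longrightarrow> \<rho> (\<phi> x) > 0"
      by (auto simp: F_def)
    interpret chart_with_volume M U \<phi> V by fact
    show ?thesis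
      unfolding S(1)
    proof (rule null_if_chart_null)
      show "B \<inter> \<phi> ` U \<in> sets V" using B image_in_sets by (auto simp: B_def)
      show "AE x in lborel. x \<in> U \<longrightarrow> \<phi> x \<notin> B \<inter> \<phi> ` U"
        using charts[OF S(2,3)] by (auto elim!: eventually_mono simp: B_def)
    qed simp
  qed
  have "B \<subseteq> \<Union>F"
  proof
    fix p assume "p \<in> B"
    then have p: "p \<in> M" "\<rho> p > 0" by (auto simp: B_def)
    obtain U and \<phi> :: "real^'m \<Rightarrow> 'a" and x where c: "chart_with_volume M U \<phi> V" "x \<in> U" "p = \<phi> x"
      using obtain_chart[OF p(1)] by blast
    interpret chart_with_volume M U \<phi> V by fact
    \<comment> \<open>By continuity of \<rho> this is an open part of the chart domain, and its
      image contains p and lies in {\<rho> > 0}.\<close>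
    define W where "W = {x \<in> U. \<rho> (\<phi> x) > 0}"
    have "continuous_on U (\<lambda>x. \<rho> (\<phi> x))"
      by (rule continuous_on_compose2[OF \<rho> continuous_on_\<phi> image_subset])
    then have "open (U \<inter> (\<lambda>x. \<rho> (\<phi> x)) -` {0<..})"
      using open_U by (rule continuous_open_preimage) simp
    moreover have "U \<inter> (\<lambda>x. \<rho> (\<phi> x)) -` {0<..} = W"
      by (auto simp: W_def)
    ultimately have "open W" by simp
    then have "chart M W \<phi>"
      by (rule restrict) (auto simp: W_def)
    then have "chart_with_volume M W \<phi> V"
      using volume by (simp add: chart_with_volume_def chart_with_volume_axioms_def)
    then have "\<phi> ` W \<in> F"
      by (auto simp: F_def W_def)
    moreover have "p \<in> \<phi> ` W"
      using c p by (auto simp: W_def)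
    ultimately show "p \<in> \<Union>F" by blast
  qed
  then have "B = (\<Union>S\<in>F'. B \<inter> S)"
    using F'(3) by blast
  moreover have "(\<Union>S\<in>F'. B \<inter> S) \<in> null_sets V"
    using F' null by (intro null_sets_UN') auto
  ultimately have "B \<in> null_sets V" by simp
  then show ?thesis
    by (rule AE_I') (auto simp: B_def space_V)
qed

lemma
  fixes f :: "'a \<Rightarrow> real"
  assumes p: "p \<in> M" and f: "f differentiable (at p within M)"
  shows grad_in_tangent_space: "grad M f p \<in> tangent_space M p"
    and has_derivative_grad: "(f has_derivative (\<lambda>v. grad M f p \<bullet> v)) (at p within M)"
proof -
  obtain U and \<phi> :: "real^'m \<Rightarrow> 'a" and x where c: "chart_with_volume M U \<phi> V" "x \<in> U" "p = \<phi> x"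
    using obtain_chart[OF p] by blast
  interpret chart_with_volume M U \<phi> V by fact
  show "grad M f p \<in> tangent_space M p" "(f has_derivative (\<lambda>v. grad M f p \<bullet> v)) (at p within M)"
    using grad_in_tangent_space[OF c(2)] has_derivative_grad[OF c(2)] f c(3) by auto
qed

lemma grad_eqI:
  fixes f :: "'a \<Rightarrow> real"
  assumes p: "p \<in> M" and "g \<in> tangent_space M p" "(f has_derivative (\<lambda>v. g \<bullet> v)) (at p within M)"
  shows "grad M f p = g"
proof -
  obtain U and \<phi> :: "real^'m \<Rightarrow> 'a" and x where c: "chart_with_volume M U \<phi> V" "x \<in> U" "p = \<phi> x"
    using obtain_chart[OF p] by blast
  interpret chart_with_volume M U \<phi> V by fact
  show ?thesis
    using grad_eqI[OF c(2)] assms c(3) by auto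
qed

lemma subspace_tangent_space: "p \<in> M \<Longrightarrow> subspace (tangent_space M p)"
proof -
  assume p: "p \<in> M"
  obtain U and \<phi> :: "real^'m \<Rightarrow> 'a" and x where c: "chart_with_volume M U \<phi> V" "x \<in> U" "p = \<phi> x"
    using obtain_chart[OF p] by blast
  interpret chart_with_volume M U \<phi> V by fact
  show ?thesis
    using subspace_range_D[OF c(2)] tangent_space_eq[OF c(2)] c(3) by simp
qed

end

section \<open>Weak gradients\<close>

abbreviation weakly_differentiates ::
  "(real^'m::finite) set \<Rightarrow> (real^'m \<Rightarrow> 'a::euclidean_space) \<Rightarrow> ('a \<Rightarrow> real) \<Rightarrow> ('a \<Rightarrow> 'a) \<Rightarrow>
    (real^'m \<Rightarrow> real) \<Rightarrow> real^'m \<Rightarrow> bool" where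
  "weakly_differentiates U \<phi> u g \<psi> v \<equiv>
      set_integrable lborel U (\<lambda>x. u (\<phi> x) * frechet_derivative \<psi> (at x) v) \<and>
      set_integrable lborel U (\<lambda>x. (g (\<phi> x) \<bullet> frechet_derivative \<phi> (at x) v) * \<psi> x) \<and>
      (LINT x:U|lborel. u (\<phi> x) * frechet_derivative \<psi> (at x) v) =
        - (LINT x:U|lborel. (g (\<phi> x) \<bullet> frechet_derivative \<phi> (at x) v) * \<psi> x)"

lemma (in chart) measurable_continuous_on_U:
  "continuous_on U f \<Longrightarrow> f \<in> borel_measurable (restrict_space lborel U)"
  using borel_measurable_continuous_on_restrict[of U f]
  by (simp add: measurable_cong_sets[OF sets_restrict_space_cong[OF sets_lborel] refl])

context manifold_with_volume
begin

lemma chart_with_volumeI: "(U, \<phi>) \<in> (local_params M :: ((real^'m) set \<times> (real^'m \<Rightarrow> 'a)) set) \<Longrightarrow> chart_with_volume M U \<phi> V"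
  using volume
  unfolding chart_with_volume_def chart_def chart_with_volume_axioms_def is_volume_measure_def by blast

lemma has_weak_gradientI:
  assumes "g \<in> borel_measurable V"
    and "\<And>p. p \<in> M \<Longrightarrow> \<rho> p > 0 \<Longrightarrow> g p \<in> tangent_space M p"
    and "\<And>(U :: (real^'m) set) \<phi> (\<psi> :: real^'m \<Rightarrow> real) v K. chart_with_volume M U \<phi> V \<Longrightarrow> (\<And>x. x \<in> U \<Longrightarrow> \<rho> (\<phi> x) > 0) \<Longrightarrow>
      smooth_on \<psi> UNIV \<Longrightarrow> compact K \<Longrightarrow> K \<subseteq> U \<Longrightarrow> (\<And>x. x \<notin> K \<Longrightarrow> \<psi> x = 0) \<Longrightarrow>
      weakly_differentiates U \<phi> u g \<psi> v"
  shows "has_weak_gradient T M V \<rho> u g"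
  unfolding has_weak_gradient_def
proof (intro conjI ballI impI, safe)
  show "g \<in> borel_measurable V" by fact
  show "g p \<in> tangent_space M p" if "p \<in> M" "\<rho> p > 0" for p
    using that assms(2) by blast
  fix U :: "(real^'m) set" and \<phi> and \<psi> :: "real^'m \<Rightarrow> real" and v K
  assume c: "(U, \<phi>) \<in> local_params M" and *: "\<forall>x\<in>U. 0 < \<rho> (\<phi> x)" "smooth_on \<psi> UNIV"
    "compact K" "K \<subseteq> U" "\<forall>x. x \<notin> K \<longrightarrow> \<psi> x = 0"
  note ** = assms(3)[OF chart_with_volumeI[OF c], of \<psi> K v]
  show "set_integrable lborel U (\<lambda>x. u (\<phi> x) * frechet_derivative \<psi> (at x) v)"
    "set_integrable lborel U (\<lambda>x. (g (\<phi> x) \<bullet> frechet_derivative \<phi> (at x) v) * \<psi> x)"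
    "(LINT x:U|lborel. u (\<phi> x) * frechet_derivative \<psi> (at x) v) =
        - (LINT x:U|lborel. (g (\<phi> x) \<bullet> frechet_derivative \<phi> (at x) v) * \<psi> x)"
    using ** * by auto
qed

lemma has_weak_gradientD:
  assumes "has_weak_gradient T M V \<rho> u g"
  shows "g \<in> borel_measurable V"
    and "p \<in> M \<Longrightarrow> \<rho> p > 0 \<Longrightarrow> g p \<in> tangent_space M p"
    and "chart_with_volume M U \<phi> V \<Longrightarrow> (\<And>x. x \<in> U \<Longrightarrow> \<rho> (\<phi> x) > 0) \<Longrightarrow>
      smooth_on \<psi> UNIV \<Longrightarrow> compact K \<Longrightarrow> K \<subseteq> U \<Longrightarrow> (\<And>x. x \<notin> K \<Longrightarrow> \<psi> x = 0) \<Longrightarrow>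
      weakly_differentiates (U :: (real^'m) set) \<phi> u g \<psi> v"
proof -
  show "g \<in> borel_measurable V" and "p \<in> M \<Longrightarrow> \<rho> p > 0 \<Longrightarrow> g p \<in> tangent_space M p"
    using assms unfolding has_weak_gradient_def by blast+
  assume "chart_with_volume M U \<phi> V" and *: "\<And>x. x \<in> U \<Longrightarrow> \<rho> (\<phi> x) > 0"
      "smooth_on \<psi> UNIV" "compact K" "K \<subseteq> U" "\<And>x. x \<notin> K \<Longrightarrow> \<psi> x = 0"
  then have c: "(U, \<phi>) \<in> local_params M"
    by (simp add: chart_with_volume_def chart_def)
  have \<psi>: "smooth_on \<psi> UNIV \<and> (\<exists>K. compact K \<and> K \<subseteq> U \<and> (\<forall>x. x \<notin> K \<longrightarrow> \<psi> x = 0))"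
    using * by blast
  have pos: "\<forall>x\<in>U. \<rho> (\<phi> x) > 0" using * by blast
  show "weakly_differentiates U \<phi> u g \<psi> v"
    by (rule assms[unfolded has_weak_gradient_def, THEN conjunct2, THEN conjunct2, THEN bspec, OF c,
          unfolded prod.case, THEN mp, OF pos, THEN spec, THEN spec, THEN mp, OF \<psi>])
qed

text \<open>In a chart the fundamental lemma makes g1 - g2 almost everywhere orthogonal to
  \<open>D x b\<close> for the finitely many basis vectors b, hence to the tangent space. Both
  fields are tangential, so the difference is orthogonal to itself.\<close>

lemma weak_gradient_unique:
  assumes \<rho>: "continuous_on M \<rho>"
    and g1: "has_weak_gradient T M V \<rho> u g1" and g2: "has_weak_gradient T M V \<rho> u g2"
  shows "AE p in V. \<rho> p > 0 \<longrightarrow> g1 p = g2 p"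
proof (rule AE_if_charts[OF \<rho>])
  have [measurable]: "g1 \<in> borel_measurable V" "g2 \<in> borel_measurable V" "\<rho> \<in> borel_measurable V"
    using has_weak_gradientD(1)[OF g1] has_weak_gradientD(1)[OF g2] measurable_V_if_continuous_on[OF \<rho>]
    by auto
  have "{p \<in> space V. \<rho> p > 0 \<and> norm (g1 p - g2 p) > 0} \<in> sets V"
    by measurable
  then show "{p \<in> M. \<rho> p > 0 \<and> \<not> g1 p = g2 p} \<in> sets V"
    by (simp add: space_V)
next
  fix U :: "(real^'m) set" and \<phi>
  assume c: "chart_with_volume M U \<phi> V" and pos: "\<And>x. x \<in> U \<Longrightarrow> \<rho> (\<phi> x) > 0"
  interpret chart_with_volume M U \<phi> V by fact
  have "AE x in lborel. x \<in> U \<longrightarrow> (g1 (\<phi> x) - g2 (\<phi> x)) \<bullet> D x v = 0" for v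
  proof (rule fundamental_lemma[OF open_U])
    fix \<psi> :: "real^'m \<Rightarrow> real"
    assume \<psi>: "smooth_on \<psi> UNIV" "\<exists>K. compact K \<and> K \<subseteq> U \<and> (\<forall>x. x \<notin> K \<longrightarrow> \<psi> x = 0)"
    then obtain K where K: "compact K" "K \<subseteq> U" "\<And>x. x \<notin> K \<Longrightarrow> \<psi> x = 0" by blast
    have *: "set_integrable lborel U (\<lambda>x. (g1 (\<phi> x) \<bullet> D x v) * \<psi> x)"
      "set_integrable lborel U (\<lambda>x. (g2 (\<phi> x) \<bullet> D x v) * \<psi> x)"
      "(LINT x:U|lborel. (g1 (\<phi> x) \<bullet> D x v) * \<psi> x) = (LINT x:U|lborel. (g2 (\<phi> x) \<bullet> D x v) * \<psi> x)"
      using has_weak_gradientD(3)[OF g1 c pos \<psi>(1) K, of v] has_weak_gradientD(3)[OF g2 c pos \<psi>(1) K, of v]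
      by simp_all
    then show "set_integrable lborel U (\<lambda>x. (g1 (\<phi> x) - g2 (\<phi> x)) \<bullet> D x v * \<psi> x) \<and>
        (LINT x:U|lborel. (g1 (\<phi> x) - g2 (\<phi> x)) \<bullet> D x v * \<psi> x) = 0"
      by (simp add: inner_diff_left left_diff_distrib)
  qed
  then have "AE x in lborel. \<forall>b\<in>Basis. x \<in> U \<longrightarrow> (g1 (\<phi> x) - g2 (\<phi> x)) \<bullet> D x b = 0"
    by (intro AE_finite_allI) auto
  then show "AE x in lborel. x \<in> U \<longrightarrow> g1 (\<phi> x) = g2 (\<phi> x)"
  proof (rule eventually_mono, intro impI)
    fix x assume *: "\<forall>b\<in>Basis. x \<in> U \<longrightarrow> (g1 (\<phi> x) - g2 (\<phi> x)) \<bullet> D x b = 0" and x: "x \<in> U"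
    let ?d = "g1 (\<phi> x) - g2 (\<phi> x)"
    have "linear (\<lambda>v. ?d \<bullet> D x v)"
      using linear_compose[OF linear_D[OF x] bounded_linear.linear[OF bounded_linear_inner_right[of ?d]]]
      by (simp add: o_def)
    then have 0: "(\<lambda>v. ?d \<bullet> D x v) = (\<lambda>v. 0)"
      using * x by (intro linear_eq_stdbasis) (auto simp: module_hom_zero)
    have "\<phi> x \<in> M" using image_subset x by blast
    then have "g1 (\<phi> x) \<in> range (D x)" "g2 (\<phi> x) \<in> range (D x)"
      using has_weak_gradientD(2)[OF g1] has_weak_gradientD(2)[OF g2] pos[OF x]
      unfolding tangent_space_eq[OF x, symmetric] by blast+
    then have "?d \<in> range (D x)"
      using subspace_diff[OF subspace_range_D[OF x]] by blast
    then obtain v where v: "?d = D x v" by blast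
    have "?d \<bullet> ?d = 0"
      using fun_cong[OF 0, of v] v by simp
    then show "g1 (\<phi> x) = g2 (\<phi> x)" by simp
  qed
qed

text \<open>A smaller positivity set leaves fewer points and parametrizations to test. In this way
  weak gradients pass from the mixture to its components.\<close>

lemma has_weak_gradient_mono:
  assumes "has_weak_gradient T M V \<rho> u g" "\<And>p. p \<in> M \<Longrightarrow> \<rho>' p > 0 \<Longrightarrow> \<rho> p > 0"
  shows "has_weak_gradient T M V \<rho>' u g"
proof (rule has_weak_gradientI)
  show "g \<in> borel_measurable V" "\<And>p. p \<in> M \<Longrightarrow> 0 < \<rho>' p \<Longrightarrow> g p \<in> tangent_space M p"
    using has_weak_gradientD(1,2)[OF assms(1)] assms(2) by blast+
  fix U :: "(real^'m) set" and \<phi> and \<psi> :: "real^'m \<Rightarrow> real" and v K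
  assume *: "chart_with_volume M U \<phi> V" "\<And>x. x \<in> U \<Longrightarrow> 0 < \<rho>' (\<phi> x)"
    "smooth_on \<psi> UNIV" "compact K" "K \<subseteq> U" "\<And>x. x \<notin> K \<Longrightarrow> \<psi> x = 0"
  interpret chart_with_volume M U \<phi> V by fact
  have "\<And>x. x \<in> U \<Longrightarrow> 0 < \<rho> (\<phi> x)"
    using *(2) assms(2) image_subset by blast
  then show "weakly_differentiates U \<phi> u g \<psi> v"
    using has_weak_gradientD(3)[OF assms(1) *(1) _ *(3-6)] by blast
qed

lemma has_weak_gradient_add_scaled:
  assumes ug: "has_weak_gradient T M V \<rho> u g" and ug': "has_weak_gradient T M V \<rho> u' g'"
  shows "has_weak_gradient T M V \<rho> (\<lambda>x. c * u x + u' x) (\<lambda>x. c *\<^sub>R g x + g' x)"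
proof (rule has_weak_gradientI)
  show "(\<lambda>x. c *\<^sub>R g x + g' x) \<in> borel_measurable V"
    using has_weak_gradientD(1)[OF ug] has_weak_gradientD(1)[OF ug'] by measurable
  show "c *\<^sub>R g p + g' p \<in> tangent_space M p" if "p \<in> M" "\<rho> p > 0" for p
    using that has_weak_gradientD(2)[OF ug] has_weak_gradientD(2)[OF ug'] subspace_tangent_space[of p]
    by (intro subspace_add subspace_scale) auto
  fix U :: "(real^'m) set" and \<phi> and \<psi> :: "real^'m \<Rightarrow> real" and v K
  assume *: "chart_with_volume M U \<phi> V" "\<And>x. x \<in> U \<Longrightarrow> 0 < \<rho> (\<phi> x)"
    "smooth_on \<psi> UNIV" "compact K" "K \<subseteq> U" "\<And>x. x \<notin> K \<Longrightarrow> \<psi> x = 0"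
  note 1 = has_weak_gradientD(3)[OF ug *, of v] and 2 = has_weak_gradientD(3)[OF ug' *, of v]
  show "weakly_differentiates U \<phi> (\<lambda>x. c * u x + u' x) (\<lambda>x. c *\<^sub>R g x + g' x) \<psi> v"
    using 1 2 by (simp add: inner_add_left distrib_right mult.assoc)
qed

lemma has_weak_gradient_zero: "has_weak_gradient T M V \<rho> (\<lambda>x. 0) (\<lambda>x. 0)"
  by (rule has_weak_gradientI)
    (auto simp: subspace_0 subspace_tangent_space set_integrable_def set_lebesgue_integral_def)

lemma has_weak_gradient_sum:
  assumes "finite I" "\<And>i. i \<in> I \<Longrightarrow> has_weak_gradient T M V \<rho> (u i) (g i)"
  shows "has_weak_gradient T M V \<rho> (\<lambda>x. \<Sum>i\<in>I. c i * u i x) (\<lambda>x. \<Sum>i\<in>I. c i *\<^sub>R g i x)"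
  using assms
  by (induction I rule: finite_induct) (auto intro: has_weak_gradient_zero has_weak_gradient_add_scaled)

text \<open>\<open>weak_grad\<close> is an arbitrary choice, so concrete energies need independence
  of that choice. Uniqueness holds where \<rho> is positive, and elsewhere the factor \<rho> makes
  the integrands 0.\<close>

lemma
  assumes \<rho>: "continuous_on M \<rho>" "\<And>p. p \<in> M \<Longrightarrow> \<rho> p \<ge> 0"
    and g: "has_weak_gradient T M V \<rho> u g"
  shows dirichlet_form_eq: "dirichlet_form T M V \<rho> u u = (\<integral>x. (norm (g x))\<^sup>2 * \<rho> x \<partial>V)"
    and H1I: "u \<in> L2 V \<rho> \<Longrightarrow> integrable V (\<lambda>x. (norm (g x))\<^sup>2 * \<rho> x) \<Longrightarrow> u \<in> H1 T M V \<rho>"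
proof -
  have w: "has_weak_gradient T M V \<rho> u (weak_grad T M V \<rho> u)"
    unfolding weak_grad_def using someI[of "has_weak_gradient T M V \<rho> u" g] g by simp
  have [measurable]: "g \<in> borel_measurable V" "weak_grad T M V \<rho> u \<in> borel_measurable V" "\<rho> \<in> borel_measurable V"
    using has_weak_gradientD(1)[OF g] has_weak_gradientD(1)[OF w] measurable_V_if_continuous_on[OF \<rho>(1)] by auto
  have AE: "AE x in V. (norm (weak_grad T M V \<rho> u x))\<^sup>2 * \<rho> x = (norm (g x))\<^sup>2 * \<rho> x"
    using weak_gradient_unique[OF \<rho>(1) w g] AE_space
  proof eventually_elim
    case (elim x)
    then show ?case
      using \<rho>(2)[of x] space_V by (cases "\<rho> x = 0") auto
  qed
  show "dirichlet_form T M V \<rho> u u = (\<integral>x. (norm (g x))\<^sup>2 * \<rho> x \<partial>V)"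
    unfolding dirichlet_form_def power2_norm_eq_inner[symmetric]
    by (rule integral_cong_AE[OF _ _ AE]) measurable
  assume "u \<in> L2 V \<rho>" "integrable V (\<lambda>x. (norm (g x))\<^sup>2 * \<rho> x)"
  moreover have "integrable V (\<lambda>x. (norm (weak_grad T M V \<rho> u x))\<^sup>2 * \<rho> x)"
    by (rule integrable_cong_AE_imp[OF calculation(2)]) (use AE in \<open>auto elim: eventually_mono\<close>)
  ultimately show "u \<in> H1 T M V \<rho>"
    using w by (auto simp: H1_def)
qed

text \<open>
  Where \<open>h\<close> vanishes, \<open>sqrt h\<close> may fail to be differentiable; it is the limit of the \<open>C\<^sup>1\<close>
  functions \<open>sqrt (h + \<epsilon>)\<close>, and the finite energy provides the integrable majorant.
\<close>
lemma has_weak_gradient_sqrt: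
  assumes h: "\<And>p. p \<in> M \<Longrightarrow> h differentiable (at p within M)" "continuous_on M (grad M h)"
      "\<And>p. p \<in> M \<Longrightarrow> h p \<ge> 0"
    and \<rho>: "continuous_on M \<rho>" "\<And>p. p \<in> M \<Longrightarrow> \<rho> p > 0"
    and g: "\<And>p. p \<in> M \<Longrightarrow> g p = (if h p > 0 then grad M h p /\<^sub>R (2 * sqrt (h p)) else 0)"
    and int: "integrable V (\<lambda>p. (norm (g p))\<^sup>2 * \<rho> p)"
  shows "has_weak_gradient T M V \<rho> (\<lambda>p. sqrt (h p)) g"
proof (rule has_weak_gradientI)
  have cont_h: "continuous_on M h"
    unfolding continuous_on_eq_continuous_within
    using differentiable_imp_continuous_within[OF h(1)] by blast
  have [measurable]: "h \<in> borel_measurable V" "grad M h \<in> borel_measurable V" "\<rho> \<in> borel_measurable V"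
    using measurable_V_if_continuous_on cont_h h(2) \<rho>(1) by auto
  have "(\<lambda>p. if h p > 0 then grad M h p /\<^sub>R (2 * sqrt (h p)) else 0) \<in> borel_measurable V"
    by measurable
  then show meas_g[measurable]: "g \<in> borel_measurable V"
    by (rule measurable_cong[THEN iffD1, rotated]) (simp add: g space_V)
  show "g p \<in> tangent_space M p" if "p \<in> M" for p
    using that g h(1) grad_in_tangent_space subspace_tangent_space
    by (auto intro: subspace_scale subspace_0)
  fix U :: "(real^'m) set" and \<phi> and \<psi> :: "real^'m \<Rightarrow> real" and v K
  assume c: "chart_with_volume M U \<phi> V"
    and \<psi>: "smooth_on \<psi> UNIV" and K: "compact K" "K \<subseteq> U" "\<And>x. x \<notin> K \<Longrightarrow> \<psi> x = 0"
  interpret chart_with_volume M U \<phi> V by fact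
  let ?\<psi>' = "\<lambda>x. frechet_derivative \<psi> (at x)"
  define H where "H x = h (\<phi> x)" for x
  define H' where "H' x v = grad M h (\<phi> x) \<bullet> D x v" for x v
  define e where "e n = inverse (real (Suc n))" for n
  have e: "e n > 0" "e n \<le> 1" for n
    by (auto simp: e_def field_simps)
  have \<phi>M: "\<phi> x \<in> M" if "x \<in> U" for x using that image_subset by blast
  have H_nonneg: "H x \<ge> 0" if "x \<in> U" for x using that h(3) \<phi>M by (simp add: H_def)
  have H': "(H has_derivative H' x) (at x)" if "x \<in> U" for x
    using has_derivative_grad_chart[OF that h(1)[OF \<phi>M[OF that]]] by (simp add: H_def[abs_def] H'_def[abs_def])
  have cont_H': "continuous_on U (\<lambda>x. H' x v)"
    unfolding H'_def
    by (intro continuous_on_inner continuous_on_D continuous_on_compose2[OF h(2) continuous_on_\<phi> image_subset])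
  have cont_H: "continuous_on U H"
    unfolding H_def by (rule continuous_on_compose2[OF cont_h continuous_on_\<phi> image_subset])
  \<comment> \<open>Zeros of the nonnegative function H are minima, so its derivative vanishes
    there. This matches the value 0 that g has at zeros of h.\<close>
  have H'0: "H' x v = 0" if "x \<in> U" "H x = 0" for x v
  proof -
    have "H' x = (\<lambda>v. 0)"
      using that H_nonneg by (intro differential_zero_maxmin[OF that(1) open_U H'[OF that(1)]]) auto
    then show ?thesis by simp
  qed
  have gH: "g (\<phi> x) \<bullet> D x v = (if H x > 0 then H' x v / (2 * sqrt (H x)) else 0)" if "x \<in> U" for x
    unfolding g[OF \<phi>M[OF that]] H_def H'_def by (cases "h (\<phi> x) > 0") (simp_all add: divide_simps)
  have q': "((\<lambda>x. sqrt (H x + e n)) has_derivative (\<lambda>v. H' x v / (2 * sqrt (H x + e n)))) (at x)"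
    if "x \<in> U" for n x
  proof -
    have pos: "H x + e n > 0" using H_nonneg[OF that] e(1)[of n] by linarith
    have "((\<lambda>x. H x + e n) has_derivative H' x) (at x)"
      using has_derivative_add[OF H'[OF that] has_derivative_const] by simp
    from has_derivative_real_sqrt[OF pos this] show ?thesis
      by (simp add: field_simps)
  qed
  have cont_q': "continuous_on U (\<lambda>x. H' x v / (2 * sqrt (H x + e n)))" for n
  proof -
    have "H x + e n \<noteq> 0" if "x \<in> U" for x using H_nonneg[OF that] e(1)[of n] by linarith
    then show ?thesis
      by (intro continuous_on_divide continuous_on_mult continuous_on_real_sqrt continuous_on_add
          continuous_on_const cont_H' cont_H) auto
  qed
  note parts = integration_by_parts[OF open_U q' cont_q' \<psi> K]
  have i1: "set_integrable lborel U (\<lambda>x. sqrt (H x) * ?\<psi>' x v)"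
  proof (rule set_integrable_compact_support[OF _ K(1,2)])
    show "continuous_on U (\<lambda>x. sqrt (H x) * ?\<psi>' x v)"
      by (intro continuous_on_mult continuous_on_real_sqrt cont_H continuous_on_subset[OF smooth_onD(3)[OF \<psi>]]) simp
    fix x assume "x \<notin> K"
    have "(\<lambda>_. 0) = ?\<psi>' x"
      by (rule frechet_derivative_at[OF has_derivative_off_support[OF K(1,3) \<open>x \<notin> K\<close>]])
    then show "sqrt (H x) * ?\<psi>' x v = 0"
      by (metis mult_zero_right)
  qed
  \<comment> \<open>The measure \<rho> dx has density J in the chart. J is continuous and positive,
    hence bounded below on the compact set K; finite energy with respect to \<rho> therefore implies
    Lebesgue square integrability on K.\<close>
  define J where "J x = sqrt (det (gram \<phi> x)) * \<rho> (\<phi> x)" for x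
  have cont_J: "continuous_on U J"
    unfolding J_def
    by (intro continuous_on_mult continuous_on_sqrt_det_gram continuous_on_compose2[OF \<rho>(1) continuous_on_\<phi> image_subset])
  have J_pos: "J x > 0" if "x \<in> U" for x
    using that det_gram_pos \<rho>(2) \<phi>M by (simp add: J_def)
  have U: "U \<in> sets lborel" "U \<in> sets borel" using open_U by auto
  have meas_ind: "(\<lambda>x. indicator U x * f x) \<in> borel_measurable lborel"
    if "f \<in> borel_measurable (restrict_space lborel U)" for f :: "real^'m \<Rightarrow> real"
    using that U borel_measurable_restrict_space_iff[of U lborel f] by (simp add: mult.commute)

  have [measurable]: "(\<lambda>x. g (\<phi> x)) \<in> borel_measurable (restrict_space lborel U)"
    by (rule measurable_compose[OF measurable_chart meas_g])
  have [measurable]: "J \<in> borel_measurable (restrict_space lborel U)"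
      "(\<lambda>x. D x v) \<in> borel_measurable (restrict_space lborel U)"
      "\<psi> \<in> borel_measurable (restrict_space lborel U)"
    by (intro measurable_continuous_on_U cont_J continuous_on_D continuous_on_subset[OF smooth_onD(2)[OF \<psi>]]; simp)+
  have energy: "integrable lborel (\<lambda>x. indicator U x * ((norm (g (\<phi> x)))\<^sup>2 * J x))"
  proof (rule integrableI_nonneg)
    show "(\<lambda>x. indicator U x * ((norm (g (\<phi> x)))\<^sup>2 * J x)) \<in> borel_measurable lborel"
      by (rule meas_ind) measurable
    show "AE x in lborel. 0 \<le> indicator U x * ((norm (g (\<phi> x)))\<^sup>2 * J x)"
      using J_pos by (auto simp: indicator_def less_imp_le)
    have "(\<integral>\<^sup>+x. ennreal (indicator U x * ((norm (g (\<phi> x)))\<^sup>2 * J x)) \<partial>lborel) =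
        (\<integral>\<^sup>+x\<in>U. ennreal (sqrt (det (gram \<phi> x))) * ennreal ((norm (g (\<phi> x)))\<^sup>2 * \<rho> (\<phi> x)) \<partial>lborel)"
      using \<rho>(2) \<phi>M det_gram_pos
      by (intro nn_integral_cong) (auto simp: indicator_def J_def mult_ac less_imp_le simp flip: ennreal_mult)
    also have "\<dots> = (\<integral>\<^sup>+p\<in>\<phi> ` U. ennreal ((norm (g p))\<^sup>2 * \<rho> p) \<partial>V)"
      by (rule nn_integral_chart[symmetric]) measurable
    also have "\<dots> \<le> (\<integral>\<^sup>+p. ennreal ((norm (g p))\<^sup>2 * \<rho> p) \<partial>V)"
      by (intro nn_integral_mono) (auto simp: indicator_def)
    also have "\<dots> < \<infinity>"
      using int \<rho>(2) by (subst nn_integral_eq_integral) (auto simp: space_V less_imp_le)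
    finally show "(\<integral>\<^sup>+x. ennreal (indicator U x * ((norm (g (\<phi> x)))\<^sup>2 * J x)) \<partial>lborel) < \<infinity>" .
  qed
  obtain m where m: "m > 0" "\<And>x. x \<in> K \<Longrightarrow> m \<le> J x"
  proof (cases "K = {}")
    case False
    obtain x where "x \<in> K" "\<forall>y\<in>K. J x \<le> J y"
      using continuous_attains_inf[OF K(1) False continuous_on_subset[OF cont_J K(2)]] by blast
    then show ?thesis using that[of "J x"] J_pos K(2) by auto
  qed (use that[of 1] in auto)
  obtain B where B: "\<And>x. x \<in> K \<Longrightarrow> norm (D x v) * \<bar>\<psi> x\<bar> \<le> B"
  proof -
    have "continuous_on K (\<lambda>x. norm (D x v) * \<bar>\<psi> x\<bar>)"
      using K(2) by (intro continuous_intros continuous_on_subset[OF continuous_on_D] continuous_on_subset[OF smooth_onD(2)[OF \<psi>]]) auto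
    then have "bounded ((\<lambda>x. norm (D x v) * \<bar>\<psi> x\<bar>) ` K)"
      using K(1) by (intro compact_imp_bounded compact_continuous_image)
    then show ?thesis
      using that by (auto simp: bounded_iff)
  qed
  have i2: "set_integrable lborel U (\<lambda>x. (g (\<phi> x) \<bullet> D x v) * \<psi> x)"
    unfolding set_integrable_def
  proof (rule Bochner_Integration.integrable_bound)
    show "integrable lborel (\<lambda>x. \<bar>B\<bar> * (indicator K x + inverse m * (indicator U x * ((norm (g (\<phi> x)))\<^sup>2 * J x))))"
      using borel_integrable_compact[OF K(1), of "\<lambda>_. 1::real"]
      by (intro integrable_mult_right Bochner_Integration.integrable_add energy) auto
    have "(\<lambda>x. indicator U x * ((g (\<phi> x) \<bullet> D x v) * \<psi> x)) \<in> borel_measurable lborel"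
      by (rule meas_ind) measurable
    then show "(\<lambda>x. indicator U x *\<^sub>R ((g (\<phi> x) \<bullet> D x v) * \<psi> x)) \<in> borel_measurable lborel" by simp
    show "AE x in lborel. norm (indicator U x *\<^sub>R ((g (\<phi> x) \<bullet> D x v) * \<psi> x)) \<le>
        norm (\<bar>B\<bar> * (indicator K x + inverse m * (indicator U x * ((norm (g (\<phi> x)))\<^sup>2 * J x))))"
    proof (rule AE_I2)
      fix x
      show "norm (indicator U x *\<^sub>R ((g (\<phi> x) \<bullet> D x v) * \<psi> x)) \<le>
        norm (\<bar>B\<bar> * (indicator K x + inverse m * (indicator U x * ((norm (g (\<phi> x)))\<^sup>2 * J x))))"
      proof (cases "x \<in> K")
        case False
        then show ?thesis using K by simp
      next
        case True
        then have xU: "x \<in> U" using K by blast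
        let ?n = "norm (g (\<phi> x))"
        have "\<bar>g (\<phi> x) \<bullet> D x v\<bar> * \<bar>\<psi> x\<bar> \<le> (?n * norm (D x v)) * \<bar>\<psi> x\<bar>"
          by (intro mult_right_mono Cauchy_Schwarz_ineq2) simp
        also have "\<dots> = ?n * (norm (D x v) * \<bar>\<psi> x\<bar>)" by simp
        also have "\<dots> \<le> ?n * \<bar>B\<bar>"
          using B[OF True] by (intro mult_left_mono) auto
        \<comment> \<open>The norm is at most 1 plus its square, and the square is controlled by the
          energy density through the lower bound m for J.\<close>
        also have "\<dots> \<le> (1 + inverse m * (?n\<^sup>2 * J x)) * \<bar>B\<bar>"
        proof (rule mult_right_mono)
          have "0 \<le> (?n - 1)\<^sup>2" by simp
          then have "2 * ?n \<le> ?n\<^sup>2 + 1" unfolding power2_diff by simp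
          then have "?n \<le> 1 + ?n\<^sup>2" using norm_ge_zero[of "g (\<phi> x)"] by linarith
          moreover
          have "?n\<^sup>2 * m \<le> ?n\<^sup>2 * J x"
            using m(2)[OF True] by (intro mult_left_mono) auto
          then have "?n\<^sup>2 \<le> inverse m * (?n\<^sup>2 * J x)" using m(1) by (simp add: field_simps)
          ultimately show "?n \<le> 1 + inverse m * (?n\<^sup>2 * J x)" by linarith
        qed simp
        finally have "\<bar>g (\<phi> x) \<bullet> D x v\<bar> * \<bar>\<psi> x\<bar> \<le> (1 + inverse m * (?n\<^sup>2 * J x)) * \<bar>B\<bar>" .
        moreover have "0 \<le> 1 + inverse m * (?n\<^sup>2 * J x)"
          using m(1) J_pos[OF xU] by (intro add_nonneg_nonneg mult_nonneg_nonneg) auto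
        ultimately show ?thesis
          using True xU by (simp add: abs_mult mult.commute)
      qed
    qed
  qed
  have elim: "e \<longlonglongrightarrow> 0" unfolding e_def by (rule LIMSEQ_inverse_real_of_nat)
  \<comment> \<open>The numbers \<open>e n\<close> are at most \<open>e 0\<close>, so the integrand
    for n = 0 is a majorant.\<close>
  have lim1: "(\<lambda>n. LINT x:U|lborel. sqrt (H x + e n) * ?\<psi>' x v) \<longlonglongrightarrow> (LINT x:U|lborel. sqrt (H x) * ?\<psi>' x v)"
    unfolding set_lebesgue_integral_def
  proof (rule integral_dominated_convergence[where w = "\<lambda>x. \<bar>indicator U x *\<^sub>R (sqrt (H x + e 0) * ?\<psi>' x v)\<bar>"])
    show "(\<lambda>x. indicator U x *\<^sub>R (sqrt (H x) * ?\<psi>' x v)) \<in> borel_measurable lborel"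
      "(\<lambda>x. indicator U x *\<^sub>R (sqrt (H x + e n) * ?\<psi>' x v)) \<in> borel_measurable lborel" for n
      using i1 parts(1)[of n] unfolding set_integrable_def by auto
    show "integrable lborel (\<lambda>x. \<bar>indicator U x *\<^sub>R (sqrt (H x + e 0) * ?\<psi>' x v)\<bar>)"
      using parts(1)[of 0] unfolding set_integrable_def by auto
    show "AE x in lborel. (\<lambda>n. indicator U x *\<^sub>R (sqrt (H x + e n) * ?\<psi>' x v)) \<longlonglongrightarrow> indicator U x *\<^sub>R (sqrt (H x) * ?\<psi>' x v)"
    proof (rule AE_I2)
      fix x
      have "(\<lambda>n. indicator U x *\<^sub>R (sqrt (H x + e n) * ?\<psi>' x v)) \<longlonglongrightarrow> indicator U x *\<^sub>R (sqrt (H x + 0) * ?\<psi>' x v)"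
        by (intro tendsto_intros elim)
      then show "(\<lambda>n. indicator U x *\<^sub>R (sqrt (H x + e n) * ?\<psi>' x v)) \<longlonglongrightarrow> indicator U x *\<^sub>R (sqrt (H x) * ?\<psi>' x v)"
        by simp
    qed
    have "e n \<le> e 0" for n using e(2)[of n] by (simp add: e_def)
    then show "AE x in lborel. norm (indicator U x *\<^sub>R (sqrt (H x + e n) * ?\<psi>' x v)) \<le> \<bar>indicator U x *\<^sub>R (sqrt (H x + e 0) * ?\<psi>' x v)\<bar>" for n
      using H_nonneg e(1) by (intro AE_I2) (auto simp: abs_mult indicator_def less_imp_le intro!: mult_right_mono)
  qed
  \<comment> \<open>Adding \<open>e n\<close> under the root only enlarges the denominator, so the
    limit integrand, integrable by \<open>i2\<close>, is itself the majorant; at zeros of H both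
    sides are 0.\<close>
  have lim2: "(\<lambda>n. LINT x:U|lborel. (H' x v / (2 * sqrt (H x + e n))) * \<psi> x) \<longlonglongrightarrow> (LINT x:U|lborel. (g (\<phi> x) \<bullet> D x v) * \<psi> x)"
    unfolding set_lebesgue_integral_def
  proof (rule integral_dominated_convergence[where w = "\<lambda>x. \<bar>indicator U x *\<^sub>R ((g (\<phi> x) \<bullet> D x v) * \<psi> x)\<bar>"])
    show "(\<lambda>x. indicator U x *\<^sub>R ((g (\<phi> x) \<bullet> D x v) * \<psi> x)) \<in> borel_measurable lborel"
      "(\<lambda>x. indicator U x *\<^sub>R ((H' x v / (2 * sqrt (H x + e n))) * \<psi> x)) \<in> borel_measurable lborel" for n
      using i2 parts(2)[of n] unfolding set_integrable_def by auto
    show "integrable lborel (\<lambda>x. \<bar>indicator U x *\<^sub>R ((g (\<phi> x) \<bullet> D x v) * \<psi> x)\<bar>)"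
      using i2 unfolding set_integrable_def by auto
    show "AE x in lborel. (\<lambda>n. indicator U x *\<^sub>R ((H' x v / (2 * sqrt (H x + e n))) * \<psi> x)) \<longlonglongrightarrow>
        indicator U x *\<^sub>R ((g (\<phi> x) \<bullet> D x v) * \<psi> x)"
    proof (rule AE_I2)
      fix x
      consider "x \<notin> U" | "x \<in> U" "H x = 0" | "x \<in> U" "H x > 0"
        using H_nonneg[of x] by fastforce
      then show "(\<lambda>n. indicator U x *\<^sub>R ((H' x v / (2 * sqrt (H x + e n))) * \<psi> x)) \<longlonglongrightarrow>
        indicator U x *\<^sub>R ((g (\<phi> x) \<bullet> D x v) * \<psi> x)"
      proof cases
        case 1 then show ?thesis by simp
      next
        case 2 then show ?thesis using gH[OF 2(1)] H'0[OF 2] by simp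
      next
        case 3
        have "(\<lambda>n. indicator U x *\<^sub>R ((H' x v / (2 * sqrt (H x + e n))) * \<psi> x)) \<longlonglongrightarrow>
            indicator U x *\<^sub>R ((H' x v / (2 * sqrt (H x + 0))) * \<psi> x)"
          using 3 by (intro tendsto_intros elim) auto
        then show ?thesis using gH[OF 3(1)] 3 by simp
      qed
    qed
    show "AE x in lborel. norm (indicator U x *\<^sub>R ((H' x v / (2 * sqrt (H x + e n))) * \<psi> x)) \<le>
        \<bar>indicator U x *\<^sub>R ((g (\<phi> x) \<bullet> D x v) * \<psi> x)\<bar>" for n
    proof (rule AE_I2)
      fix x
      consider "x \<notin> U" | "x \<in> U" "H x = 0" | "x \<in> U" "H x > 0"
        using H_nonneg[of x] by fastforce
      then show "norm (indicator U x *\<^sub>R ((H' x v / (2 * sqrt (H x + e n))) * \<psi> x)) \<le>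
        \<bar>indicator U x *\<^sub>R ((g (\<phi> x) \<bullet> D x v) * \<psi> x)\<bar>"
      proof cases
        case 1 then show ?thesis by simp
      next
        case 2 then show ?thesis using H'0[OF 2] by simp
      next
        case 3
        have "\<bar>H' x v\<bar> / (2 * sqrt (H x + e n)) \<le> \<bar>H' x v\<bar> / (2 * sqrt (H x))"
          using 3 e(1)[of n] by (intro divide_left_mono mult_pos_pos) auto
        then have "\<bar>H' x v\<bar> / (2 * sqrt (H x + e n)) * \<bar>\<psi> x\<bar> \<le> \<bar>H' x v\<bar> / (2 * sqrt (H x)) * \<bar>\<psi> x\<bar>"
          by (rule mult_right_mono) simp
        then show ?thesis
          using gH[OF 3(1)] 3 e(1)[of n] by (simp add: abs_mult)
      qed
    qed
  qed
  have "(\<lambda>n. LINT x:U|lborel. sqrt (H x + e n) * ?\<psi>' x v) \<longlonglongrightarrow> - (LINT x:U|lborel. (g (\<phi> x) \<bullet> D x v) * \<psi> x)"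
  proof -
    have "(LINT x:U|lborel. sqrt (H x + e n) * ?\<psi>' x v) =
        - (LINT x:U|lborel. (H' x v / (2 * sqrt (H x + e n))) * \<psi> x)" for n
      by (rule parts(3))
    then show ?thesis
      using tendsto_minus[OF lim2] by presburger
  qed
  then have "(LINT x:U|lborel. sqrt (H x) * ?\<psi>' x v) = - (LINT x:U|lborel. (g (\<phi> x) \<bullet> D x v) * \<psi> x)"
    by (rule LIMSEQ_unique[OF lim1])
  with i1 i2 show "weakly_differentiates U \<phi> (\<lambda>p. sqrt (h p)) g \<psi> v"
    by (simp add: H_def)
qed

end

section \<open>Weighted inner products\<close>

text \<open>Values in a Euclidean space allow the same lemmas to serve for functions and for their
  gradients.\<close>

definition wip :: "'a measure \<Rightarrow> ('a \<Rightarrow> real) \<Rightarrow> ('a \<Rightarrow> 'b::euclidean_space) \<Rightarrow> ('a \<Rightarrow> 'b) \<Rightarrow> real" where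
  "wip V \<rho> f g = (\<integral>x. (f x \<bullet> g x) * \<rho> x \<partial>V)"

definition sq_integrable :: "'a measure \<Rightarrow> ('a \<Rightarrow> real) \<Rightarrow> ('a \<Rightarrow> 'b::euclidean_space) \<Rightarrow> bool" where
  "sq_integrable V \<rho> f \<longleftrightarrow> f \<in> borel_measurable V \<and> integrable V (\<lambda>x. (norm (f x))\<^sup>2 * \<rho> x)"

lemma ip_eq_wip: "ip V \<rho> u v = wip V \<rho> u v"
  by (simp add: ip_def wip_def)

lemma L2_eq: "u \<in> L2 V \<rho> \<longleftrightarrow> sq_integrable V \<rho> u"
  by (simp add: L2_def sq_integrable_def)

lemma wip_commute: "wip V \<rho> f g = wip V \<rho> g f"
  by (simp add: wip_def inner_commute)

locale weight =
  fixes V :: "'a measure" and \<rho> :: "'a \<Rightarrow> real"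
  assumes measurable_weight [measurable]: "\<rho> \<in> borel_measurable V"
    and weight_nonneg: "x \<in> space V \<Longrightarrow> \<rho> x \<ge> 0"
begin

lemma integrable_inner:
  fixes f g :: "'a \<Rightarrow> 'b::euclidean_space"
  assumes "sq_integrable V \<rho> f" "sq_integrable V \<rho> g"
  shows "integrable V (\<lambda>x. (f x \<bullet> g x) * \<rho> x)"
proof (rule Bochner_Integration.integrable_bound)
  have [measurable]: "f \<in> borel_measurable V" "g \<in> borel_measurable V"
    using assms by (auto simp: sq_integrable_def)
  show "integrable V (\<lambda>x. (norm (f x))\<^sup>2 * \<rho> x + (norm (g x))\<^sup>2 * \<rho> x)"
    using assms by (auto simp: sq_integrable_def)
  show "(\<lambda>x. (f x \<bullet> g x) * \<rho> x) \<in> borel_measurable V" by measurable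
  show "AE x in V. norm ((f x \<bullet> g x) * \<rho> x) \<le> norm ((norm (f x))\<^sup>2 * \<rho> x + (norm (g x))\<^sup>2 * \<rho> x)"
  proof (rule AE_I2)
    fix x assume x: "x \<in> space V"
    have "0 \<le> (norm (f x) - norm (g x))\<^sup>2" by simp
    then have "2 * (norm (f x) * norm (g x)) \<le> (norm (f x))\<^sup>2 + (norm (g x))\<^sup>2"
      unfolding power2_diff by simp
    moreover have "\<bar>f x \<bullet> g x\<bar> \<le> norm (f x) * norm (g x)" by (rule Cauchy_Schwarz_ineq2)
    moreover have "0 \<le> norm (f x) * norm (g x)" by simp
    ultimately have "\<bar>f x \<bullet> g x\<bar> \<le> (norm (f x))\<^sup>2 + (norm (g x))\<^sup>2" by linarith
    then have "\<bar>f x \<bullet> g x\<bar> * \<rho> x \<le> ((norm (f x))\<^sup>2 + (norm (g x))\<^sup>2) * \<rho> x"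
      using weight_nonneg[OF x] by (rule mult_right_mono)
    then show "norm ((f x \<bullet> g x) * \<rho> x) \<le> norm ((norm (f x))\<^sup>2 * \<rho> x + (norm (g x))\<^sup>2 * \<rho> x)"
      using weight_nonneg[OF x] by (simp add: abs_mult distrib_right)
  qed
qed

lemma sq_integrable_add:
  fixes f g :: "'a \<Rightarrow> 'b::euclidean_space"
  assumes "sq_integrable V \<rho> f" "sq_integrable V \<rho> g"
  shows "sq_integrable V \<rho> (\<lambda>x. f x + g x)"
proof -
  have "integrable V (\<lambda>x. (norm (f x))\<^sup>2 * \<rho> x + (2 * ((f x \<bullet> g x) * \<rho> x) + (norm (g x))\<^sup>2 * \<rho> x))"
    using assms integrable_inner[OF assms] by (auto simp: sq_integrable_def)
  also have "(\<lambda>x. (norm (f x))\<^sup>2 * \<rho> x + (2 * ((f x \<bullet> g x) * \<rho> x) + (norm (g x))\<^sup>2 * \<rho> x))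
      = (\<lambda>x. (norm (f x + g x))\<^sup>2 * \<rho> x)"
    by (auto simp: power2_norm_eq_inner inner_add_left inner_add_right inner_commute algebra_simps)
  finally show ?thesis
    using assms by (auto simp: sq_integrable_def)
qed

lemma sq_integrable_scaleR:
  fixes f :: "'a \<Rightarrow> 'b::euclidean_space"
  shows "sq_integrable V \<rho> f \<Longrightarrow> sq_integrable V \<rho> (\<lambda>x. c *\<^sub>R f x)"
  by (auto simp: sq_integrable_def power_mult_distrib mult.assoc)

lemma sq_integrable_sum:
  fixes f :: "'i \<Rightarrow> 'a \<Rightarrow> 'b::euclidean_space"
  assumes "finite I" "\<And>i. i \<in> I \<Longrightarrow> sq_integrable V \<rho> (f i)"
  shows "sq_integrable V \<rho> (\<lambda>x. \<Sum>i\<in>I. c i *\<^sub>R f i x)"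
  using assms
proof (induction I rule: finite_induct)
  case empty
  then show ?case by (simp add: sq_integrable_def)
next
  case (insert i I)
  then show ?case by (simp add: sq_integrable_add sq_integrable_scaleR)
qed

lemma sq_integrable_diff:
  fixes f g :: "'a \<Rightarrow> 'b::euclidean_space"
  assumes "sq_integrable V \<rho> f" "sq_integrable V \<rho> g"
  shows "sq_integrable V \<rho> (\<lambda>x. f x - g x)"
  using sq_integrable_add[OF assms(1) sq_integrable_scaleR[OF assms(2), of "-1"]] by simp

lemma wip_sum_right:
  fixes f :: "'a \<Rightarrow> 'b::euclidean_space"
  assumes "sq_integrable V \<rho> f" "\<And>i. i \<in> I \<Longrightarrow> sq_integrable V \<rho> (g i)"
  shows "wip V \<rho> f (\<lambda>x. \<Sum>i\<in>I. c i *\<^sub>R g i x) = (\<Sum>i\<in>I. c i * wip V \<rho> f (g i))"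
proof -
  have "wip V \<rho> f (\<lambda>x. \<Sum>i\<in>I. c i *\<^sub>R g i x) = (\<integral>x. (\<Sum>i\<in>I. c i * ((f x \<bullet> g i x) * \<rho> x)) \<partial>V)"
    unfolding wip_def by (simp add: inner_sum_right sum_distrib_right mult.assoc)
  also have "\<dots> = (\<Sum>i\<in>I. c i * wip V \<rho> f (g i))"
    unfolding wip_def using assms
    by (subst Bochner_Integration.integral_sum) (auto intro!: integrable_inner)
  finally show ?thesis .
qed

lemma wip_sum_left:
  fixes f :: "'a \<Rightarrow> 'b::euclidean_space"
  assumes "sq_integrable V \<rho> f" "\<And>i. i \<in> I \<Longrightarrow> sq_integrable V \<rho> (g i)"
  shows "wip V \<rho> (\<lambda>x. \<Sum>i\<in>I. c i *\<^sub>R g i x) f = (\<Sum>i\<in>I. c i * wip V \<rho> (g i) f)"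
  using wip_sum_right[OF assms] by (simp add: wip_commute)

lemma wip_diff_diff:
  fixes f g f' g' :: "'a \<Rightarrow> 'b::euclidean_space"
  assumes "sq_integrable V \<rho> f" "sq_integrable V \<rho> g" "sq_integrable V \<rho> f'" "sq_integrable V \<rho> g'"
  shows "wip V \<rho> (\<lambda>x. f x - g x) (\<lambda>x. f' x - g' x) =
    wip V \<rho> f f' - wip V \<rho> f g' - wip V \<rho> g f' + wip V \<rho> g g'"
proof -
  have "wip V \<rho> (\<lambda>x. f x - g x) (\<lambda>x. f' x - g' x) =
      (\<integral>x. (f x \<bullet> f' x) * \<rho> x - (f x \<bullet> g' x) * \<rho> x - (g x \<bullet> f' x) * \<rho> x + (g x \<bullet> g' x) * \<rho> x \<partial>V)"
    unfolding wip_def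
    by (intro Bochner_Integration.integral_cong) (auto simp: inner_diff_left inner_diff_right algebra_simps)
  also have "\<dots> = wip V \<rho> f f' - wip V \<rho> f g' - wip V \<rho> g f' + wip V \<rho> g g'"
    unfolding wip_def using assms by (simp add: integrable_inner)
  finally show ?thesis .
qed

lemma wip_nonneg: "wip V \<rho> f f \<ge> 0"
  unfolding wip_def by (intro Bochner_Integration.integral_nonneg) (auto simp: weight_nonneg)

lemma wip_sum_sum:
  fixes e :: "'i \<Rightarrow> 'a \<Rightarrow> 'b::euclidean_space"
  assumes "finite I" "\<And>i. i \<in> I \<Longrightarrow> sq_integrable V \<rho> (e i)"
    and "\<And>i j. i \<in> I \<Longrightarrow> j \<in> I \<Longrightarrow> wip V \<rho> (e i) (e j) = (if i = j then m i else 0)"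
  shows "wip V \<rho> (\<lambda>x. \<Sum>i\<in>I. c i *\<^sub>R e i x) (\<lambda>x. \<Sum>i\<in>I. d i *\<^sub>R e i x) = (\<Sum>i\<in>I. c i * d i * m i)"
proof -
  have "wip V \<rho> (\<lambda>x. \<Sum>i\<in>I. c i *\<^sub>R e i x) (\<lambda>x. \<Sum>i\<in>I. d i *\<^sub>R e i x)
      = (\<Sum>i\<in>I. c i * (\<Sum>j\<in>I. d j * wip V \<rho> (e i) (e j)))"
    using assms by (simp add: wip_sum_left wip_sum_right sq_integrable_sum)
  also have "\<dots> = (\<Sum>i\<in>I. c i * (\<Sum>j\<in>I. if i = j then d j * m i else 0))"
    using assms(3) by (intro sum.cong refl arg_cong2[where f = "(*)"]) auto
  also have "\<dots> = (\<Sum>i\<in>I. c i * d i * m i)"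
    using assms(1) by (intro sum.cong refl) auto
  finally show ?thesis .
qed

text \<open>This is Pythagoras for residuals of expansions. The squared norms m i cover
  eigenfunctions (m = 1) and their gradients (m = eigenvalue) together; since an eigenvalue may be
  0, the coefficients are given by c i * m i and not by a quotient.\<close>

lemma wip_diff_sum_diff_sum:
  fixes e :: "'i \<Rightarrow> 'a \<Rightarrow> 'b::euclidean_space"
  assumes I: "finite I" and f: "sq_integrable V \<rho> f" "sq_integrable V \<rho> g"
    and e: "\<And>i. i \<in> I \<Longrightarrow> sq_integrable V \<rho> (e i)"
    and orth: "\<And>i j. i \<in> I \<Longrightarrow> j \<in> I \<Longrightarrow> wip V \<rho> (e i) (e j) = (if i = j then m i else 0)"
    and c: "\<And>i. i \<in> I \<Longrightarrow> wip V \<rho> f (e i) = c i * m i"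
    and d: "\<And>i. i \<in> I \<Longrightarrow> wip V \<rho> g (e i) = d i * m i"
  shows "wip V \<rho> (\<lambda>x. f x - (\<Sum>i\<in>I. c i *\<^sub>R e i x)) (\<lambda>x. g x - (\<Sum>i\<in>I. d i *\<^sub>R e i x))
    = wip V \<rho> f g - (\<Sum>i\<in>I. c i * d i * m i)"
proof -
  have "wip V \<rho> f (\<lambda>x. \<Sum>i\<in>I. d i *\<^sub>R e i x) = (\<Sum>i\<in>I. c i * d i * m i)"
    using c f e by (simp add: wip_sum_right mult_ac)
  moreover have "wip V \<rho> (\<lambda>x. \<Sum>i\<in>I. c i *\<^sub>R e i x) g = (\<Sum>i\<in>I. c i * d i * m i)"
    using d f e by (simp add: wip_commute[of _ _ "\<lambda>x. \<Sum>i\<in>I. c i *\<^sub>R e i x"] wip_sum_right mult_ac)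
  ultimately show ?thesis
    using wip_sum_sum[OF I e orth, where c = c and d = d]
    by (subst wip_diff_diff) (auto intro!: sq_integrable_sum I f e)
qed

end

section \<open>Almost orthonormal families\<close>

text \<open>The index range up to \<open>CARD('n)\<close> has one element more than the dimension.
  Repeated vectors are treated separately because \<open>dependent\<close> speaks about sets and
  does not see repetitions.\<close>

lemma linear_dependence:
  fixes b :: "nat \<Rightarrow> real^'n::finite"
  shows "\<exists>c :: nat \<Rightarrow> real. (\<exists>l\<le>CARD('n). c l \<noteq> 0) \<and> (\<Sum>l\<le>CARD('n). c l *\<^sub>R b l) = 0"
proof (cases "inj_on b {..CARD('n)}")
  case False
  then obtain i j where ij: "i \<le> CARD('n)" "j \<le> CARD('n)" "i \<noteq> j" "b i = b j"
    by (auto simp: inj_on_def)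
  define c :: "nat \<Rightarrow> real" where "c l = (if l = i then 1 else 0) - (if l = j then 1 else 0)" for l
  have "(\<Sum>l\<le>CARD('n). c l *\<^sub>R b l) =
      (\<Sum>l\<le>CARD('n). if l = i then b l else 0) - (\<Sum>l\<le>CARD('n). if l = j then b l else 0)"
    unfolding sum_subtractf[symmetric] by (intro sum.cong) (auto simp: c_def)
  also have "\<dots> = 0"
    using ij by (simp add: sum.delta)
  finally show ?thesis
    using ij by (intro exI[of _ c]) (auto simp: c_def)
next
  case True
  have "dependent (b ` {..CARD('n)})"
    using True by (intro dependent_biggerset) (auto simp: card_image)
  then obtain u where u: "\<exists>v\<in>b ` {..CARD('n)}. u v \<noteq> 0" "(\<Sum>v\<in>b ` {..CARD('n)}. u v *\<^sub>R v) = 0"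
    by (auto simp: dependent_finite)
  then show ?thesis
    using True by (intro exI[of _ "\<lambda>l. u (b l)"]) (auto simp: sum.reindex)
qed

text \<open>In one Gram-Schmidt step the residual r of \<open>a k\<close> is a combination of the
  a's in which \<open>a k\<close> has coefficient 1, so coercivity gives norm r \<ge> sqrt c. As r
  is orthogonal to the projection, the inner product of \<open>a k\<close> with the new unit vector
  equals norm r. The third conclusion is carried along in order to write the projection in terms of
  the a's.\<close>

lemma Gram_Schmidt_coercive:
  fixes a :: "'i \<Rightarrow> 'v::euclidean_space"
  assumes "finite A" and c: "c > 0"
    and coercive: "\<And>x. c * (\<Sum>k\<in>A. (x k)\<^sup>2) \<le> (norm (\<Sum>k\<in>A. x k *\<^sub>R a k))\<^sup>2"
  shows "\<exists>v. (\<forall>i\<in>A. \<forall>j\<in>A. v i \<bullet> v j = (if i = j then 1 else 0)) \<and>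
    (\<forall>k\<in>A. sqrt c \<le> a k \<bullet> v k) \<and> (\<forall>k\<in>A. \<exists>y. v k = (\<Sum>j\<in>A. y j *\<^sub>R a j))"
  using assms(1) coercive
proof (induction A rule: finite_induct)
  case empty
  then show ?case by simp
next
  case (insert k A)
  have "c * (\<Sum>k\<in>A. (x k)\<^sup>2) \<le> (norm (\<Sum>k\<in>A. x k *\<^sub>R a k))\<^sup>2" for x
  proof -
    have "(\<Sum>j\<in>A. (if j = k then 0 else x j)\<^sup>2) = (\<Sum>k\<in>A. (x k)\<^sup>2)"
      "(\<Sum>j\<in>A. (if j = k then 0 else x j) *\<^sub>R a j) = (\<Sum>k\<in>A. x k *\<^sub>R a k)"
      using insert.hyps by (auto intro!: sum.cong)
    then show ?thesis
      using insert.prems[of "\<lambda>j. if j = k then 0 else x j"] insert.hyps by simp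
  qed
  then obtain v where v: "\<forall>i\<in>A. \<forall>j\<in>A. v i \<bullet> v j = (if i = j then 1 else 0)"
    "\<forall>k\<in>A. sqrt c \<le> a k \<bullet> v k" "\<forall>k\<in>A. \<exists>y. v k = (\<Sum>j\<in>A. y j *\<^sub>R a j)"
    using insert.IH by blast
  then obtain y where y: "\<And>i. i \<in> A \<Longrightarrow> v i = (\<Sum>j\<in>A. y i j *\<^sub>R a j)" by metis
  define p where "p = (\<Sum>i\<in>A. (a k \<bullet> v i) *\<^sub>R v i)"
  \<comment> \<open>These are the coefficients of the projection p with respect to the original
    vectors a, obtained by inserting the expansions of the earlier v's.\<close>
  define z where "z j = (\<Sum>i\<in>A. (a k \<bullet> v i) * y i j)" for j
  have p_z: "p = (\<Sum>j\<in>A. z j *\<^sub>R a j)"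
  proof -
    have "p = (\<Sum>i\<in>A. \<Sum>j\<in>A. ((a k \<bullet> v i) * y i j) *\<^sub>R a j)"
      unfolding p_def by (intro sum.cong refl, subst (2) y) (auto simp: scaleR_sum_right)
    then show ?thesis
      by (subst (asm) sum.swap) (simp add: z_def scaleR_sum_left)
  qed
  define r where "r = a k - p"
  have r: "r = (\<Sum>j\<in>insert k A. (if j = k then 1 else - z j) *\<^sub>R a j)"
  proof -
    have "(\<Sum>j\<in>A. (if j = k then 1 else - z j) *\<^sub>R a j) = (\<Sum>j\<in>A. - (z j *\<^sub>R a j))"
      using insert.hyps by (intro sum.cong) auto
    then show ?thesis
      using insert.hyps by (simp add: r_def p_z sum_negf)
  qed
  \<comment> \<open>The coefficient 1 at index k alone makes the sum of squares at least 1.\<close>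
  have "c * 1 \<le> c * (\<Sum>j\<in>insert k A. (if j = k then 1 else - z j)\<^sup>2)"
    using insert.hyps c by (intro mult_left_mono) (auto intro!: sum_nonneg)
  also have "\<dots> \<le> (norm r)\<^sup>2"
    unfolding r by (rule insert.prems)
  finally have norm_r: "sqrt c \<le> norm r" "norm r > 0"
    using c by (auto intro: real_le_lsqrt real_sqrt_le_iff[THEN iffD1] simp: real_sqrt_le_iff)
  have orth: "r \<bullet> v i = 0" if "i \<in> A" for i
  proof -
    have "p \<bullet> v i = (\<Sum>j\<in>A. if j = i then a k \<bullet> v j else 0)"
      unfolding p_def inner_sum_left using v(1) that by (intro sum.cong) auto
    then show ?thesis
      using that insert.hyps by (simp add: r_def inner_diff_left)
  qed
  have "r \<bullet> p = 0"
    unfolding p_def by (simp add: inner_sum_right orth)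
  then have "a k \<bullet> r = r \<bullet> r"
    by (simp add: r_def inner_diff_left inner_diff_right inner_commute)
  then have akr: "a k \<bullet> (r /\<^sub>R norm r) = norm r"
    using norm_r(2) by (simp add: power2_norm_eq_inner[symmetric] power2_eq_square)
  define v' where "v' = v(k := r /\<^sub>R norm r)"
  have v'A: "v' i = v i" if "i \<in> A" for i using that insert.hyps by (auto simp: v'_def)
  have v'k: "v' k = r /\<^sub>R norm r" by (simp add: v'_def)
  show ?case
  proof (intro exI[of _ v'] conjI ballI)
    fix i j assume ij: "i \<in> insert k A" "j \<in> insert k A"
    have "v' k \<bullet> v' k = 1"
      using norm_r(2) by (simp add: v'k power2_norm_eq_inner[symmetric] power2_eq_square)
    moreover have "v' k \<bullet> v' i = 0" "v' i \<bullet> v' k = 0" if "i \<in> A" for i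
      using orth[OF that] v'A[OF that] by (simp_all add: v'k inner_commute)
    ultimately show "v' i \<bullet> v' j = (if i = j then 1 else 0)"
      using ij v(1) v'A insert.hyps by auto
  next
    fix i assume i: "i \<in> insert k A"
    then show "sqrt c \<le> a i \<bullet> v' i"
      using v(2) v'A norm_r(1) akr v'k by auto
    show "\<exists>y. v' i = (\<Sum>j\<in>insert k A. y j *\<^sub>R a j)"
    proof (cases "i = k")
      case True
      then show ?thesis
        by (intro exI[of _ "\<lambda>j. inverse (norm r) * (if j = k then 1 else - z j)"])
          (subst r, simp add: v'k scaleR_sum_right[symmetric] flip: scaleR_scaleR,
            simp add: scaleR_sum_right r)
    next
      case False
      then have iA: "i \<in> A" using i by simp
      have "v' i = (\<Sum>j\<in>A. (if j = k then 0 else y i j) *\<^sub>R a j)"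
        unfolding v'A[OF iA] y[OF iA] using insert.hyps by (intro sum.cong) auto
      then show ?thesis
        using insert.hyps by (intro exI[of _ "\<lambda>j. if j = k then 0 else y i j"]) simp
    qed
  qed
qed

text \<open>The difference of the two quadratic forms has coefficients of absolute value at most
  \<tau>, so it is at most \<tau> times the square of the l1 norm of x; Cauchy-Schwarz turns the l1
  norm into the factor N.\<close>

lemma coercive_if_almost_orthonormal:
  fixes a :: "'n::finite \<Rightarrow> 'v::real_inner"
  assumes "\<And>i j. \<bar>a i \<bullet> a j - (if i = j then 1 else 0)\<bar> \<le> \<tau>"
  shows "(1 - real CARD('n) * \<tau>) * (\<Sum>k\<in>UNIV. (x k)\<^sup>2) \<le> (norm (\<Sum>k\<in>UNIV. x k *\<^sub>R a k))\<^sup>2"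
proof -
  have \<tau>: "\<tau> \<ge> 0" using assms order_trans[OF abs_ge_zero] by blast
  have "(\<Sum>k\<in>UNIV. (x k)\<^sup>2) - (norm (\<Sum>k\<in>UNIV. x k *\<^sub>R a k))\<^sup>2
      = (\<Sum>i\<in>UNIV. \<Sum>j\<in>UNIV. x i * x j * ((if i = j then 1 else 0) - a i \<bullet> a j))"
  proof -
    have "(norm (\<Sum>k\<in>UNIV. x k *\<^sub>R a k))\<^sup>2 = (\<Sum>i\<in>UNIV. \<Sum>j\<in>UNIV. x i * x j * (a i \<bullet> a j))"
      unfolding power2_norm_eq_inner inner_sum_left inner_sum_right
      by (simp add: inner_commute mult_ac)
    moreover have "(\<Sum>k\<in>UNIV. (x k)\<^sup>2) = (\<Sum>i\<in>UNIV. \<Sum>j\<in>UNIV. x i * x j * (if i = j then 1 else 0))"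
      by (simp add: power2_eq_square if_distrib[of "\<lambda>y. _ * y"] cong: if_cong)
    ultimately show ?thesis
      by (simp add: right_diff_distrib sum_subtractf)
  qed
  also have "\<dots> \<le> (\<Sum>i\<in>UNIV. \<Sum>j\<in>UNIV. \<bar>x i\<bar> * \<bar>x j\<bar> * \<tau>)"
  proof (intro sum_mono)
    fix i j
    have "x i * x j * ((if i = j then 1 else 0) - a i \<bullet> a j) \<le> \<bar>x i * x j * ((if i = j then 1 else 0) - a i \<bullet> a j)\<bar>"
      by (rule abs_ge_self)
    also have "\<dots> = \<bar>x i\<bar> * \<bar>x j\<bar> * \<bar>a i \<bullet> a j - (if i = j then 1 else 0)\<bar>"
      by (simp add: abs_mult abs_minus_commute)
    also have "\<dots> \<le> \<bar>x i\<bar> * \<bar>x j\<bar> * \<tau>"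
      using assms by (intro mult_left_mono) auto
    finally show "x i * x j * ((if i = j then 1 else 0) - a i \<bullet> a j) \<le> \<bar>x i\<bar> * \<bar>x j\<bar> * \<tau>" .
  qed
  also have "\<dots> = (\<Sum>i\<in>UNIV. \<bar>x i\<bar>)\<^sup>2 * \<tau>"
    unfolding power2_eq_square sum_product by (simp add: sum_distrib_right)
  also have "\<dots> \<le> (real CARD('n) * (\<Sum>k\<in>UNIV. (x k)\<^sup>2)) * \<tau>"
    using sum_squared_le_sum_of_squares[of "\<lambda>i. \<bar>x i\<bar>" "UNIV::'n set"] \<tau>
    by (intro mult_right_mono) (auto simp: mult.commute)
  finally show ?thesis by (simp add: algebra_simps)
qed

section \<open>Cones\<close>

text \<open>Angles satisfy the triangle inequality: e is within \<sigma> of p, and a point in the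
  ball of radius sin s * norm p around p is within s of p, as tangents to that ball show. The
  argument uses cosines only and ends in the addition theorem for cos (\<sigma> + s).\<close>

lemma inner_perturbed_gt:
  fixes p q e :: "'v::real_inner"
  assumes \<sigma>: "0 < \<sigma>" "0 < s" "s + \<sigma> < pi / 2" and e: "norm e = 1"
    and p: "p \<bullet> e > cos \<sigma> * norm p" and pq: "norm (p - q) \<le> sin s * norm p"
  shows "q \<bullet> e > cos (\<sigma> + s) * norm q"
proof -
  have cs: "cos \<sigma> > 0" "cos s > 0" "sin \<sigma> > 0" "sin s > 0" "cos (\<sigma> + s) > 0"
    using \<sigma> by (auto intro!: cos_gt_zero_pi sin_gt_zero)
  have "p \<noteq> 0" using p by auto
  then have np: "norm p > 0" by simp
  have "sin s < sin (pi / 2)"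
    using \<sigma> by (intro sin_monotone_2pi) auto
  then have "sin s * norm p < norm p" using np by simp
  then have nq: "norm q > 0"
    using pq norm_triangle_ineq2[of p q] by linarith
  define P where "P = p /\<^sub>R norm p"
  define R where "R = q /\<^sub>R norm q"
  have P: "P \<bullet> P = 1" and R: "R \<bullet> R = 1"
    using np nq by (simp_all add: P_def R_def power2_norm_eq_inner[symmetric] power2_eq_square)
  define a where "a = P \<bullet> e"
  define b where "b = P \<bullet> R"
  have ee: "e \<bullet> e = 1" using e by (simp add: norm_eq_sqrt_inner)
  have a: "a > cos \<sigma>"
    using p np by (simp add: a_def P_def field_simps)
  have "(norm (p - q))\<^sup>2 \<le> (sin s * norm p)\<^sup>2"
    using pq by (rule power_mono) simp
  also have "(norm (p - q))\<^sup>2 = (norm p)\<^sup>2 - 2 * (p \<bullet> q) + (norm q)\<^sup>2"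
    by (simp add: power2_norm_eq_inner inner_diff_left inner_diff_right inner_commute)
  also have "(sin s * norm p)\<^sup>2 = (norm p)\<^sup>2 - (cos s * norm p)\<^sup>2"
    by (simp add: sin_squared_eq power_mult_distrib algebra_simps)
  \<comment> \<open>Together with the arithmetic-geometric mean inequality for cos s * norm p and
    norm q this bounds the cosine of the angle between p and q below by cos s.\<close>
  finally have "(cos s * norm p)\<^sup>2 + (norm q)\<^sup>2 \<le> 2 * (p \<bullet> q)" by simp
  moreover have "0 \<le> (cos s * norm p - norm q)\<^sup>2" by simp
  ultimately have "cos s * norm p * norm q \<le> p \<bullet> q"
    unfolding power2_diff by simp
  then have b: "b \<ge> cos s"
    using np nq by (simp add: b_def P_def R_def field_simps)
  have a1: "a\<^sup>2 \<le> 1" "b\<^sup>2 \<le> 1"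
    using Cauchy_Schwarz_ineq[of P e] Cauchy_Schwarz_ineq[of P R] P R ee by (simp_all add: a_def b_def)
  \<comment> \<open>Cauchy-Schwarz is applied to the components of R and e orthogonal to P; their
    norms are the sines of the two angles.\<close>
  have "\<bar>(R - b *\<^sub>R P) \<bullet> (e - a *\<^sub>R P)\<bar> \<le> norm (R - b *\<^sub>R P) * norm (e - a *\<^sub>R P)"
    by (rule Cauchy_Schwarz_ineq2)
  moreover have "(R - b *\<^sub>R P) \<bullet> (e - a *\<^sub>R P) = R \<bullet> e - a * b"
    using P by (simp add: inner_diff_left inner_diff_right a_def b_def inner_commute)
  moreover have "norm (R - b *\<^sub>R P) = sqrt (1 - b\<^sup>2)"
    using P R by (simp add: norm_eq_sqrt_inner inner_diff_left inner_diff_right b_def inner_commute power2_eq_square)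
  moreover have "norm (e - a *\<^sub>R P) = sqrt (1 - a\<^sup>2)"
    using P ee by (simp add: norm_eq_sqrt_inner inner_diff_left inner_diff_right a_def inner_commute power2_eq_square)
  ultimately have "\<bar>R \<bullet> e - a * b\<bar> \<le> sqrt (1 - b\<^sup>2) * sqrt (1 - a\<^sup>2)"
    by simp
  then have Re: "R \<bullet> e \<ge> a * b - sqrt (1 - b\<^sup>2) * sqrt (1 - a\<^sup>2)"
    by linarith
  have "(cos \<sigma>)\<^sup>2 \<le> a\<^sup>2" "(cos s)\<^sup>2 \<le> b\<^sup>2"
    using a b cs by (auto intro!: power_mono)
  then have "1 - a\<^sup>2 \<le> (sin \<sigma>)\<^sup>2" "1 - b\<^sup>2 \<le> (sin s)\<^sup>2"
    by (simp_all add: sin_squared_eq)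
  then have "sqrt (1 - a\<^sup>2) \<le> sin \<sigma>" "sqrt (1 - b\<^sup>2) \<le> sin s"
    using cs by (auto intro!: real_le_lsqrt)
  then have "sqrt (1 - b\<^sup>2) * sqrt (1 - a\<^sup>2) \<le> sin s * sin \<sigma>"
    using cs a1 by (intro mult_mono) auto
  moreover have "cos \<sigma> * cos s < a * b"
    using a b cs by (intro mult_less_le_imp_less) auto
  ultimately have "R \<bullet> e > cos (\<sigma> + s)"
    using Re by (simp add: cos_add mult.commute)
  then show ?thesis
    using nq by (simp add: R_def field_simps)
qed

lemma
  fixes v :: "'n::finite \<Rightarrow> real^'n"
  assumes v: "\<And>i j. v i \<bullet> v j = (if i = j then 1 else 0)"
  shows norm_orthonormal_coordinates: "norm (\<chi> k. z \<bullet> v k) = norm z"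
    and pairwise_orthogonal_range: "pairwise orthogonal (range v)"
    and span_orthonormal: "span (range v) = UNIV"
proof -
  define A :: "real^'n^'n" where "A = (\<chi> i. v i)"
  have "orthogonal_matrix A"
    using v by (simp add: orthogonal_matrix_orthonormal_rows A_def row_def orthogonal_def norm_eq_sqrt_inner)
  then have "orthogonal_transformation ((*v) A)"
    by (simp add: orthogonal_transformation_matrix matrix_vector_mul_linear)
  then have "norm (A *v z) = norm z"
    by (rule orthogonal_transformation_norm)
  moreover have "A *v z = (\<chi> k. z \<bullet> v k)"
    by (simp add: A_def matrix_vector_mult_def inner_vec_def vec_eq_iff mult.commute)
  ultimately show "norm (\<chi> k. z \<bullet> v k) = norm z" by simp
  show orth: "pairwise orthogonal (range v)"
    using v by (auto simp: pairwise_def orthogonal_def)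
  have "inj v"
    using v by (metis injI zero_neq_one)
  moreover have "0 \<notin> range v"
    using v by (metis imageE inner_zero_left zero_neq_one)
  ultimately have "independent (range v)" "card (range v) = DIM(real^'n)"
    using pairwise_orthogonal_independent[OF orth] by (auto simp: card_image)
  then show "span (range v) = UNIV"
    using card_eq_dim[of "range v" UNIV] by (auto simp: dim_UNIV)
qed

text \<open>In the coordinates of the orthonormal basis v the cone around \<open>v k\<close> becomes
  a cone around an axis, and z becomes a perturbation of W. The perturbation turns W by at most s
  and shortens it to no less than (1 - sin s) * c.\<close>

lemma mem_cone_sector:
  fixes v :: "'n::finite \<Rightarrow> real^'n" and W :: "real^'n"
  assumes v: "\<And>i j. v i \<bullet> v j = (if i = j then 1 else 0)"
    and \<sigma>: "0 < \<sigma>" "0 < s" "s + \<sigma> < pi / 2" and c: "c > 0"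
    and W: "W $ k > cos \<sigma> * norm W" "norm W \<ge> c" "norm (W - (\<chi> k. z \<bullet> v k)) < sin s * c"
  shows "z \<in> cone_sector (v k) (\<sigma> + s) ((1 - sin s) * c)"
proof -
  let ?p = "\<chi> k. z \<bullet> v k"
  have norm_p: "norm ?p = norm z"
    by (rule norm_orthonormal_coordinates[OF v])
  have sin: "sin s > 0" using \<sigma> by (intro sin_gt_zero) auto
  then have "sin s * c \<le> sin s * norm W" using W(2) by simp
  then have "?p \<bullet> axis k 1 > cos (\<sigma> + s) * norm ?p"
    using W \<sigma> by (intro inner_perturbed_gt[where p = W]) (auto simp: inner_axis)
  then have 1: "z \<bullet> v k > cos (\<sigma> + s) * norm z"
    unfolding norm_p by (simp add: inner_axis)
  have "norm W \<le> norm (W - ?p) + norm ?p"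
    using norm_triangle_ineq[of "W - ?p" ?p] by simp
  then have 2: "norm z > (1 - sin s) * c"
    using W(2,3) norm_p by (simp add: left_diff_distrib)
  moreover have "(1 - sin s) * c \<ge> 0"
    using c sin_le_one[of s] by simp
  ultimately have "norm z > 0" by linarith
  with 1 2 show ?thesis
    by (simp add: cone_sector_def field_simps)
qed

text \<open>For the largest component r k, lying off its cone means (1 - cos^2) * r k \<le> cos^2
  times the sum of the other components. Multiplying by r k produces overlap products, while \<rho>,
  a convex combination of the r j, is at most r k. The result is a pointwise bound that is ready for
  integration.\<close>

lemma off_cone_bound:
  fixes r w :: "'n::finite \<Rightarrow> real"
  assumes r: "\<And>k. r k \<ge> 0" and w: "\<And>k. w k > 0" "(\<Sum>k\<in>UNIV. w k) = 1"
    and \<rho>: "\<rho> = (\<Sum>k\<in>UNIV. w k * r k)" "\<rho> > 0" and \<sigma>: "0 < \<sigma>" "\<sigma> < pi / 2"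
    and off: "\<And>k. sqrt (r k / \<rho>) \<le> cos \<sigma> * norm (\<chi> k. sqrt (r k / \<rho>))"
  shows "1 \<le> (cos \<sigma>)\<^sup>2 / (1 - (cos \<sigma>)\<^sup>2) * (\<Sum>i\<in>UNIV. \<Sum>j\<in>UNIV. if i = j then 0 else r i * r j / \<rho>\<^sup>2)"
proof -
  have "sin \<sigma> > 0" "cos \<sigma> > 0"
    using \<sigma> by (auto intro!: sin_gt_zero cos_gt_zero_pi)
  then have c: "1 - (cos \<sigma>)\<^sup>2 > 0" "(cos \<sigma>)\<^sup>2 > 0"
    by (auto simp flip: sin_squared_eq)
  have "Max (range r) \<in> range r" by (intro Max_in) auto
  then obtain k where k: "r k = Max (range r)" by (metis imageE)
  have max: "r j \<le> r k" for j unfolding k by (intro Max_ge) auto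
  have "\<rho> \<le> (\<Sum>j\<in>UNIV. w j * r k)"
    unfolding \<rho> using w max by (intro sum_mono mult_left_mono) (auto simp: less_imp_le)
  then have "\<rho> \<le> r k"
    using w(2) by (simp flip: sum_distrib_right)
  then have "\<rho>\<^sup>2 \<le> r k * r k"
    using \<rho>(2) by (auto simp: power2_eq_square intro!: mult_mono)
  have "(sqrt (r k / \<rho>))\<^sup>2 \<le> (cos \<sigma> * norm (\<chi> k. sqrt (r k / \<rho>)))\<^sup>2"
    using off r \<rho>(2) by (intro power_mono) auto
  then have "r k / \<rho> \<le> (cos \<sigma>)\<^sup>2 * (\<Sum>j\<in>UNIV. r j / \<rho>)"
    using r \<rho>(2) by (simp add: power_mult_distrib power2_norm_eq_inner inner_vec_def flip: power2_eq_square)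
  then have "r k \<le> (cos \<sigma>)\<^sup>2 * (\<Sum>j\<in>UNIV. r j)"
    using \<rho>(2) by (simp add: field_simps flip: sum_divide_distrib)
  also have "(\<Sum>j\<in>UNIV. r j) = r k + (\<Sum>j\<in>UNIV - {k}. r j)"
    by (simp add: sum.remove)
  finally have "(1 - (cos \<sigma>)\<^sup>2) * r k \<le> (cos \<sigma>)\<^sup>2 * (\<Sum>j\<in>UNIV - {k}. r j)"
    by (simp add: algebra_simps)
  then have "(1 - (cos \<sigma>)\<^sup>2) * r k * r k \<le> (cos \<sigma>)\<^sup>2 * (\<Sum>j\<in>UNIV - {k}. r j) * r k"
    using r by (rule mult_right_mono)
  moreover have "(1 - (cos \<sigma>)\<^sup>2) * \<rho>\<^sup>2 \<le> (1 - (cos \<sigma>)\<^sup>2) * (r k * r k)"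
    using c \<open>\<rho>\<^sup>2 \<le> r k * r k\<close> by (intro mult_left_mono) auto
  ultimately have "(1 - (cos \<sigma>)\<^sup>2) * \<rho>\<^sup>2 \<le> (cos \<sigma>)\<^sup>2 * (\<Sum>j\<in>UNIV - {k}. r k * r j)"
    by (simp add: sum_distrib_left sum_distrib_right mult_ac)
  then have "1 \<le> (cos \<sigma>)\<^sup>2 / (1 - (cos \<sigma>)\<^sup>2) * (\<Sum>j\<in>UNIV - {k}. r k * r j / \<rho>\<^sup>2)"
    using c \<rho>(2) by (simp add: field_simps flip: sum_divide_distrib)
  also have "(\<Sum>j\<in>UNIV - {k}. r k * r j / \<rho>\<^sup>2) = (\<Sum>j\<in>UNIV. if k = j then 0 else r k * r j / \<rho>\<^sup>2)"
    by (rule sum.mono_neutral_cong_left) auto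
  also have "(cos \<sigma>)\<^sup>2 / (1 - (cos \<sigma>)\<^sup>2) * \<dots> \<le>
      (cos \<sigma>)\<^sup>2 / (1 - (cos \<sigma>)\<^sup>2) * (\<Sum>i\<in>UNIV. \<Sum>j\<in>UNIV. if i = j then 0 else r i * r j / \<rho>\<^sup>2)"
    using c r
    by (intro mult_left_mono member_le_sum[where f = "\<lambda>i. \<Sum>j\<in>UNIV. if i = j then 0 else r i * r j / \<rho>\<^sup>2"])
      (auto intro!: sum_nonneg)
  finally show ?thesis .
qed

section \<open>Mixture models\<close>

locale mixture_model = manifold_with_volume T M V
  for T :: "'m::finite itself" and M :: "'a::euclidean_space set" and V +
  fixes \<rho>s :: "'n::finite \<Rightarrow> 'a \<Rightarrow> real" and w :: "'n \<Rightarrow> real"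
  assumes C1: "C1_on_manifold M (\<rho>s k)"
    and density: "probability_density M V (\<rho>s k)"
    and w_pos: "w k > 0" and w_sum: "(\<Sum>k\<in>UNIV. w k) = 1"
    and mixture_pos: "p \<in> M \<Longrightarrow> mixture w \<rho>s p > 0"
begin

abbreviation "\<rho> \<equiv> mixture w \<rho>s"
abbreviation "\<nu> \<equiv> density V (\<lambda>x. ennreal (\<rho> x))"
text \<open>Without the weight w k under the root, each \<open>q k\<close> has norm 1 in
  L2(\<rho>).\<close>

abbreviation "q k p \<equiv> sqrt (\<rho>s k p / \<rho> p)"

lemma \<rho>s_nonneg: "p \<in> M \<Longrightarrow> \<rho>s k p \<ge> 0"
  and integrable_\<rho>s: "integrable V (\<rho>s k)"
  and integral_\<rho>s: "(\<integral>x. \<rho>s k x \<partial>V) = 1"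
  using density[of k] by (auto simp: probability_density_def)

lemma differentiable_\<rho>s: "p \<in> M \<Longrightarrow> \<rho>s k differentiable (at p within M)"
  and continuous_on_grad_\<rho>s: "continuous_on M (grad M (\<rho>s k))"
  using C1[of k] by (auto simp: C1_on_manifold_def)

lemma continuous_on_\<rho>s: "continuous_on M (\<rho>s k)"
  unfolding continuous_on_eq_continuous_within
  using differentiable_imp_continuous_within[OF differentiable_\<rho>s] by blast

lemma has_derivative_mixture:
  assumes p: "p \<in> M"
  shows "(\<rho> has_derivative (\<lambda>v. (\<Sum>k\<in>UNIV. w k *\<^sub>R grad M (\<rho>s k) p) \<bullet> v)) (at p within M)"
proof -
  have "((\<lambda>p. \<Sum>k\<in>UNIV. w k * \<rho>s k p) has_derivative (\<lambda>v. \<Sum>k\<in>UNIV. w k * (grad M (\<rho>s k) p \<bullet> v))) (at p within M)"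
    by (intro has_derivative_sum has_derivative_mult_right has_derivative_grad p differentiable_\<rho>s)
  then show ?thesis
    by (simp add: mixture_def[abs_def] inner_sum_left)
qed

lemma differentiable_mixture: "p \<in> M \<Longrightarrow> \<rho> differentiable (at p within M)"
  using has_derivative_mixture by (auto simp: differentiable_def)

lemma grad_mixture: "p \<in> M \<Longrightarrow> grad M \<rho> p = (\<Sum>k\<in>UNIV. w k *\<^sub>R grad M (\<rho>s k) p)"
  by (intro grad_eqI has_derivative_mixture subspace_sum[OF subspace_tangent_space]
      subspace_scale[OF subspace_tangent_space] grad_in_tangent_space differentiable_\<rho>s)

lemma continuous_on_grad_mixture: "continuous_on M (grad M \<rho>)"
proof -
  have "continuous_on M (\<lambda>p. \<Sum>k\<in>UNIV. w k *\<^sub>R grad M (\<rho>s k) p)"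
    by (intro continuous_on_sum continuous_on_scaleR continuous_on_const continuous_on_grad_\<rho>s)
  then show ?thesis
    by (rule continuous_on_eq) (simp add: grad_mixture)
qed

lemma continuous_on_mixture: "continuous_on M \<rho>"
  unfolding mixture_def[abs_def]
  by (intro continuous_on_sum continuous_on_mult continuous_on_const continuous_on_\<rho>s)

lemma measurable_\<rho>s [measurable]: "\<rho>s k \<in> borel_measurable V"
  and measurable_mixture [measurable]: "\<rho> \<in> borel_measurable V"
  and measurable_grad_\<rho>s [measurable]: "grad M (\<rho>s k) \<in> borel_measurable V"
  and measurable_grad_mixture [measurable]: "grad M \<rho> \<in> borel_measurable V"
  by (intro measurable_V_if_continuous_on continuous_on_\<rho>s continuous_on_mixture
      continuous_on_grad_\<rho>s continuous_on_grad_mixture)+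

lemma integrable_mixture: "integrable V \<rho>"
  and integral_mixture: "(\<integral>x. \<rho> x \<partial>V) = 1"
  unfolding mixture_def[abs_def] using integrable_\<rho>s integral_\<rho>s w_sum by auto

lemma w_\<rho>s_le: "p \<in> M \<Longrightarrow> w k * \<rho>s k p \<le> \<rho> p"
  unfolding mixture_def using w_pos \<rho>s_nonneg
  by (intro member_le_sum) (auto simp: less_imp_le)

sublocale mix: weight V \<rho>
  by unfold_locales (auto simp: space_V less_imp_le mixture_pos)

sublocale comp: weight V "\<rho>s k" for k
  by unfold_locales (auto simp: space_V \<rho>s_nonneg)

text \<open>Since w k * \<rho>s k \<le> \<rho>, the component weight is dominated by a multiple of
  the mixture.\<close>

lemma sq_integrable_component:
  fixes f :: "'a \<Rightarrow> 'b::euclidean_space"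
  assumes "sq_integrable V \<rho> f"
  shows "sq_integrable V (\<rho>s k) f"
proof -
  have [measurable]: "f \<in> borel_measurable V" using assms by (simp add: sq_integrable_def)
  have "integrable V (\<lambda>x. (norm (f x))\<^sup>2 * \<rho>s k x)"
  proof (rule Bochner_Integration.integrable_bound)
    show "integrable V (\<lambda>x. inverse (w k) * ((norm (f x))\<^sup>2 * \<rho> x))"
      using assms by (auto simp: sq_integrable_def)
    show "AE x in V. norm ((norm (f x))\<^sup>2 * \<rho>s k x) \<le> norm (inverse (w k) * ((norm (f x))\<^sup>2 * \<rho> x))"
    proof (rule AE_I2)
      fix x assume "x \<in> space V"
      then have x: "x \<in> M" by (simp add: space_V)
      have "\<rho>s k x \<le> inverse (w k) * \<rho> x"
        using w_\<rho>s_le[OF x, of k] w_pos[of k] by (simp add: field_simps)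
      then have "(norm (f x))\<^sup>2 * \<rho>s k x \<le> (norm (f x))\<^sup>2 * (inverse (w k) * \<rho> x)"
        by (rule mult_left_mono) simp
      then show "norm ((norm (f x))\<^sup>2 * \<rho>s k x) \<le> norm (inverse (w k) * ((norm (f x))\<^sup>2 * \<rho> x))"
        using \<rho>s_nonneg[OF x, of k] mixture_pos[OF x] w_pos[of k] by (simp add: abs_mult mult_ac)
    qed
  qed measurable
  then show ?thesis by (simp add: sq_integrable_def)
qed

lemma wip_mixture:
  fixes f g :: "'a \<Rightarrow> 'b::euclidean_space"
  assumes "sq_integrable V \<rho> f" "sq_integrable V \<rho> g"
  shows "wip V \<rho> f g = (\<Sum>k\<in>UNIV. w k * wip V (\<rho>s k) f g)"
proof -
  have "wip V \<rho> f g = (\<integral>x. (\<Sum>k\<in>UNIV. w k * ((f x \<bullet> g x) * \<rho>s k x)) \<partial>V)"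
    unfolding wip_def mixture_def by (simp add: sum_distrib_left mult_ac)
  also have "\<dots> = (\<Sum>k\<in>UNIV. w k * wip V (\<rho>s k) f g)"
    unfolding wip_def
    by (subst Bochner_Integration.integral_sum)
      (auto intro!: comp.integrable_inner sq_integrable_component assms)
  finally show ?thesis .
qed

subsection \<open>The overlap\<close>

lemma q_sq: "p \<in> M \<Longrightarrow> (q k p)\<^sup>2 * \<rho> p = \<rho>s k p"
  using \<rho>s_nonneg[of p k] mixture_pos[of p] by simp

lemma sq_integrable_q: "sq_integrable V \<rho> (q k)"
proof -
  have "integrable V (\<lambda>x. (norm (q k x))\<^sup>2 * \<rho> x) \<longleftrightarrow> integrable V (\<rho>s k)"
    by (rule Bochner_Integration.integrable_cong) (auto simp: space_V q_sq)
  then show ?thesis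
    by (simp add: sq_integrable_def integrable_\<rho>s)
qed

lemma wip_q_self: "wip V \<rho> (q k) (q k) = 1"
proof -
  have "wip V \<rho> (q k) (q k) = (\<integral>x. \<rho>s k x \<partial>V)"
    unfolding wip_def
    by (intro Bochner_Integration.integral_cong) (auto simp: space_V q_sq simp flip: power2_eq_square)
  then show ?thesis by (simp add: integral_\<rho>s)
qed

lemma integrable_overlap: "integrable V (\<lambda>x. \<rho>s i x * \<rho>s j x / \<rho> x)"
proof (rule Bochner_Integration.integrable_bound)
  show "integrable V (\<lambda>x. inverse (w j) * \<rho>s i x)"
    using integrable_\<rho>s by auto
  show "AE x in V. norm (\<rho>s i x * \<rho>s j x / \<rho> x) \<le> norm (inverse (w j) * \<rho>s i x)"
  proof (rule AE_I2)
    fix x assume "x \<in> space V"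
    then have x: "x \<in> M" by (simp add: space_V)
    have "\<rho>s j x / \<rho> x \<le> inverse (w j)"
      using w_\<rho>s_le[OF x, of j] w_pos[of j] mixture_pos[OF x] by (simp add: field_simps)
    then have "\<rho>s i x * (\<rho>s j x / \<rho> x) \<le> \<rho>s i x * inverse (w j)"
      by (rule mult_left_mono) (rule \<rho>s_nonneg[OF x])
    then show "norm (\<rho>s i x * \<rho>s j x / \<rho> x) \<le> norm (inverse (w j) * \<rho>s i x)"
      using \<rho>s_nonneg[OF x] mixture_pos[OF x] w_pos[of j] by (simp add: abs_mult mult.commute)
  qed
qed measurable

lemma overlap_integral_le:
  assumes "i \<noteq> j"
  shows "(\<integral>x. \<rho>s i x * \<rho>s j x / \<rho> x \<partial>V) \<le> overlap V w \<rho>s"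
proof -
  have "{(\<integral>x. \<rho>s i x * \<rho>s j x / \<rho> x \<partial>V) | i j. i \<noteq> j} \<subseteq>
      (\<lambda>(i, j). \<integral>x. \<rho>s i x * \<rho>s j x / \<rho> x \<partial>V) ` UNIV"
    by auto
  then have "finite {(\<integral>x. \<rho>s i x * \<rho>s j x / \<rho> x \<partial>V) | i j. i \<noteq> j}"
    by (rule finite_subset) simp
  then show ?thesis
    unfolding overlap_def using assms by (intro Max_ge) auto
qed

lemma overlap_integral_nonneg: "(\<integral>x. \<rho>s i x * \<rho>s j x / \<rho> x \<partial>V) \<ge> 0"
  using \<rho>s_nonneg mixture_pos
  by (intro Bochner_Integration.integral_nonneg) (auto simp: space_V less_imp_le)

lemma overlap_nonneg:
  assumes "CARD('n) \<ge> 2"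
  shows "overlap V w \<rho>s \<ge> 0"
proof -
  obtain i j :: 'n where "i \<noteq> j"
    using assms by (metis (full_types) One_nat_def UNIV_I card_le_Suc0_iff_eq finite not_less_eq_eq numeral_2_eq_2)
  then show ?thesis
    using overlap_integral_le overlap_integral_nonneg order_trans by blast
qed

text \<open>With X = q i * q j, the integral of X^2 against the probability measure \<rho> dx is the
  overlap of i and j, while its mean is the inner product m. Nonnegativity of the variance of X
  gives m^2 \<le> S.\<close>

lemma wip_q_le:
  assumes ij: "i \<noteq> j"
  shows "\<bar>wip V \<rho> (q i) (q j)\<bar> \<le> sqrt (overlap V w \<rho>s)"
proof -
  define X where "X x = q i x * q j x" for x
  define m where "m = wip V \<rho> (q i) (q j)"
  have eq: "(X x)\<^sup>2 * \<rho> x = \<rho>s i x * \<rho>s j x / \<rho> x" if "x \<in> M" for x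
    using \<rho>s_nonneg[OF that] mixture_pos[OF that]
    by (simp add: X_def power_mult_distrib power_divide)
  have "integrable V (\<lambda>x. (norm (X x))\<^sup>2 * \<rho> x) \<longleftrightarrow> integrable V (\<lambda>x. \<rho>s i x * \<rho>s j x / \<rho> x)"
    by (rule Bochner_Integration.integrable_cong) (auto simp: space_V eq)
  moreover have "X \<in> borel_measurable V"
    unfolding X_def[abs_def] by measurable
  ultimately have X: "sq_integrable V \<rho> X"
    using integrable_overlap by (simp add: sq_integrable_def)
  have one: "sq_integrable V \<rho> (\<lambda>x. m)"
    using integrable_mixture by (simp add: sq_integrable_def)
  have "wip V \<rho> X X = (\<integral>x. \<rho>s i x * \<rho>s j x / \<rho> x \<partial>V)"
    unfolding wip_def
    by (intro Bochner_Integration.integral_cong) (auto simp: space_V eq simp flip: power2_eq_square)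
  then have XX: "wip V \<rho> X X \<le> overlap V w \<rho>s"
    using overlap_integral_le[OF ij] by simp
  have Xm: "wip V \<rho> X (\<lambda>x. m) = m * m"
  proof -
    have "wip V \<rho> X (\<lambda>x. m) = (\<integral>x. m * (q i x * q j x * \<rho> x) \<partial>V)"
      by (simp add: wip_def X_def mult_ac)
    also have "\<dots> = m * wip V \<rho> (q i) (q j)"
      by (simp add: wip_def)
    finally show ?thesis by (simp add: m_def)
  qed
  have mm: "wip V \<rho> (\<lambda>x. m) (\<lambda>x. m) = m * m"
    unfolding wip_def by (simp add: integral_mixture)
  have "0 \<le> wip V \<rho> (\<lambda>x. X x - m) (\<lambda>x. X x - m)"
    by (rule mix.wip_nonneg)
  also have "\<dots> = wip V \<rho> X X - m * m"
    unfolding mix.wip_diff_diff[OF X one X one] wip_commute[of V \<rho> "\<lambda>x. m" X] Xm mm by simp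
  finally have "m\<^sup>2 \<le> overlap V w \<rho>s"
    using XX by (simp add: power2_eq_square)
  then show ?thesis
    unfolding m_def[symmetric] by (intro real_le_rsqrt) simp
qed

subsection \<open>The coupling\<close>

lemma
  assumes p: "p \<in> M"
  shows differentiable_quotient: "(\<lambda>p. \<rho>s k p / \<rho> p) differentiable (at p within M)"
    and grad_quotient: "grad M (\<lambda>p. \<rho>s k p / \<rho> p) p =
      (1 / \<rho> p) *\<^sub>R grad M (\<rho>s k) p - (\<rho>s k p / (\<rho> p)\<^sup>2) *\<^sub>R grad M \<rho> p"
proof -
  let ?g = "(1 / \<rho> p) *\<^sub>R grad M (\<rho>s k) p - (\<rho>s k p / (\<rho> p)\<^sup>2) *\<^sub>R grad M \<rho> p"
  have "\<rho> p \<noteq> 0" using mixture_pos[OF p] by simp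
  have "((\<lambda>p. \<rho>s k p / \<rho> p) has_derivative
      (\<lambda>v. ((grad M (\<rho>s k) p \<bullet> v) * \<rho> p - \<rho>s k p * (grad M \<rho> p \<bullet> v)) / (\<rho> p * \<rho> p))) (at p within M)"
    by (intro has_derivative_divide' has_derivative_grad p differentiable_\<rho>s differentiable_mixture) fact
  also have "(\<lambda>v. ((grad M (\<rho>s k) p \<bullet> v) * \<rho> p - \<rho>s k p * (grad M \<rho> p \<bullet> v)) / (\<rho> p * \<rho> p)) = (\<lambda>v. ?g \<bullet> v)"
    using \<open>\<rho> p \<noteq> 0\<close> by (auto simp: inner_diff_left field_simps power2_eq_square)
  finally have D: "((\<lambda>p. \<rho>s k p / \<rho> p) has_derivative (\<lambda>v. ?g \<bullet> v)) (at p within M)" .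
  then show "(\<lambda>p. \<rho>s k p / \<rho> p) differentiable (at p within M)"
    by (auto simp: differentiable_def)
  show "grad M (\<lambda>p. \<rho>s k p / \<rho> p) p = ?g"
    by (intro grad_eqI[OF p _ D] subspace_diff[OF subspace_tangent_space] subspace_scale[OF subspace_tangent_space]
        grad_in_tangent_space p differentiable_\<rho>s differentiable_mixture)
qed

text \<open>The gradient of sqrt (\<rho>s k / \<rho>) is q k / 2 times the difference of the
  logarithmic gradients of \<rho>s k and \<rho>. The energy is therefore the coupling integral, and
  the factor 1/4 in \<open>coupling_k\<close> is the square of this 1/2.\<close>

lemma
  assumes finite: "coupling_k M V w \<rho>s k < \<infinity>"
  shows q_H1: "q k \<in> H1 T M V \<rho>"
    and dirichlet_form_q: "dirichlet_form T M V \<rho> (q k) (q k) = enn2real (coupling_k M V w \<rho>s k)"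
proof -
  define X where "X p = grad M (\<rho>s k) p /\<^sub>R \<rho>s k p - grad M \<rho> p /\<^sub>R \<rho> p" for p
  define g where "g p = (if \<rho>s k p > 0 then (q k p / 2) *\<^sub>R X p else 0)" for p
  have [measurable]: "X \<in> borel_measurable V"
    unfolding X_def[abs_def] by measurable
  have [measurable]: "g \<in> borel_measurable V"
    unfolding g_def[abs_def] by measurable
  have energy: "ennreal ((norm (g p))\<^sup>2 * \<rho> p) =
      ennreal ((norm (X p))\<^sup>2 * \<rho>s k p) * indicator {x. \<rho>s k x > 0} p / 4" if "p \<in> M" for p
  proof (cases "\<rho>s k p > 0")
    case True
    have "(norm (g p))\<^sup>2 * \<rho> p = (norm (X p))\<^sup>2 * ((q k p)\<^sup>2 * \<rho> p) / 4"
      using True by (simp add: g_def power_mult_distrib power_divide)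
    also have "\<dots> = (norm (X p))\<^sup>2 * \<rho>s k p / 4"
      unfolding q_sq[OF that] ..
    finally have "ennreal ((norm (g p))\<^sup>2 * \<rho> p) = ennreal ((norm (X p))\<^sup>2 * \<rho>s k p) / ennreal 4"
      using True by (simp only: divide_ennreal zero_le_mult_iff zero_le_power2 less_imp_le zero_less_numeral simp_thms)
    then show ?thesis
      using True by simp
  qed (simp add: g_def)
  have nn: "(\<integral>\<^sup>+p. ennreal ((norm (g p))\<^sup>2 * \<rho> p) \<partial>V) = coupling_k M V w \<rho>s k"
  proof -
    have "(\<integral>\<^sup>+p. ennreal ((norm (g p))\<^sup>2 * \<rho> p) \<partial>V) =
        (\<integral>\<^sup>+p. ennreal ((norm (X p))\<^sup>2 * \<rho>s k p) * indicator {x. \<rho>s k x > 0} p / 4 \<partial>V)"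
      by (intro nn_integral_cong energy) (simp add: space_V)
    also have "\<dots> = coupling_k M V w \<rho>s k"
      unfolding coupling_k_def X_def[symmetric] by (rule nn_integral_divide) measurable
    finally show ?thesis .
  qed
  have nonneg: "AE p in V. 0 \<le> (norm (g p))\<^sup>2 * \<rho> p"
    by (auto simp: space_V mixture_pos less_imp_le)
  have int: "integrable V (\<lambda>p. (norm (g p))\<^sup>2 * \<rho> p)"
    using finite nn nonneg by (intro integrableI_nonneg) auto
  have g: "has_weak_gradient T M V \<rho> (q k) g"
  proof (rule has_weak_gradient_sqrt[OF differentiable_quotient _ _ continuous_on_mixture mixture_pos _ int])
    show "continuous_on M (grad M (\<lambda>p. \<rho>s k p / \<rho> p))"
    proof (rule continuous_on_eq)
      show "continuous_on M (\<lambda>p. (1 / \<rho> p) *\<^sub>R grad M (\<rho>s k) p - (\<rho>s k p / (\<rho> p)\<^sup>2) *\<^sub>R grad M \<rho> p)"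
        using mixture_pos
        by (intro continuous_intros continuous_on_mixture continuous_on_\<rho>s continuous_on_grad_\<rho>s continuous_on_grad_mixture)
          (auto simp: order.strict_implies_not_eq[OF mixture_pos, symmetric])
    qed (simp add: grad_quotient)
    show "\<rho>s k p / \<rho> p \<ge> 0" if "p \<in> M" for p
      using \<rho>s_nonneg[OF that] mixture_pos[OF that] by simp
    show "g p = (if \<rho>s k p / \<rho> p > 0 then grad M (\<lambda>p. \<rho>s k p / \<rho> p) p /\<^sub>R (2 * sqrt (\<rho>s k p / \<rho> p)) else 0)"
      if "p \<in> M" for p
    proof (cases "\<rho>s k p > 0")
      case True
      define r where "r = q k p"
      have r: "\<rho>s k p / \<rho> p = r * r" "r > 0"
        using True mixture_pos[OF that] by (simp_all add: r_def)
      have "grad M (\<lambda>p. \<rho>s k p / \<rho> p) p = (\<rho>s k p / \<rho> p) *\<^sub>R X p"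
        using True mixture_pos[OF that]
        by (simp add: grad_quotient[OF that] X_def scaleR_diff_right power2_eq_square field_simps)
      also have "\<dots> /\<^sub>R (2 * r) = (r / 2) *\<^sub>R X p"
      proof -
        have "inverse (2 * r) * (r * r) = r / 2"
          using r(2) by (simp add: divide_simps)
        then show ?thesis by (simp only: r(1) scaleR_scaleR)
      qed
      finally have "g p = grad M (\<lambda>p. \<rho>s k p / \<rho> p) p /\<^sub>R (2 * r)"
        using True by (simp add: g_def r_def)
      then show ?thesis
        using True mixture_pos[OF that] by (simp add: r_def)
    qed (use mixture_pos[OF that] in \<open>simp add: g_def zero_less_divide_iff\<close>)
  qed
  have L2: "q k \<in> L2 V \<rho>"
    using sq_integrable_q by (simp add: L2_eq)
  have \<rho>_nonneg: "p \<in> M \<Longrightarrow> \<rho> p \<ge> 0" for p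
    using mixture_pos by (simp add: less_imp_le)
  show "q k \<in> H1 T M V \<rho>"
    by (rule H1I[OF continuous_on_mixture \<rho>_nonneg g L2 int])
  have "dirichlet_form T M V \<rho> (q k) (q k) = (\<integral>p. (norm (g p))\<^sup>2 * \<rho> p \<partial>V)"
    by (rule dirichlet_form_eq[OF continuous_on_mixture \<rho>_nonneg g])
  also have "\<dots> = enn2real (\<integral>\<^sup>+p. ennreal ((norm (g p))\<^sup>2 * \<rho> p) \<partial>V)"
    using nonneg by (intro integral_eq_nn_integral) auto
  finally show "dirichlet_form T M V \<rho> (q k) (q k) = enn2real (coupling_k M V w \<rho>s k)"
    by (simp add: nn)
qed

subsection \<open>Spectral estimates\<close>

lemma
  assumes "u \<in> H1 T M V \<rho>"
  shows H1_sq_integrable: "sq_integrable V \<rho> u"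
    and H1_weak_gradient: "has_weak_gradient T M V \<rho> u (weak_grad T M V \<rho> u)"
    and H1_sq_integrable_grad: "sq_integrable V \<rho> (weak_grad T M V \<rho> u)"
proof -
  show "sq_integrable V \<rho> u"
    using assms by (simp add: H1_def L2_eq)
  show *: "has_weak_gradient T M V \<rho> u (weak_grad T M V \<rho> u)"
    using assms someI_ex[of "has_weak_gradient T M V \<rho> u"] by (simp add: H1_def weak_grad_def)
  show "sq_integrable V \<rho> (weak_grad T M V \<rho> u)"
    using assms has_weak_gradientD(1)[OF *] by (simp add: H1_def sq_integrable_def)
qed

lemma dirichlet_form_wip: "dirichlet_form T M V \<rho> u v = wip V \<rho> (weak_grad T M V \<rho> u) (weak_grad T M V \<rho> v)"
  by (simp add: dirichlet_form_def wip_def)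

context
  fixes ev us
  assumes eigenbasis: "eigenbasis T M V \<rho> ev us"
begin

lemma ev_mono: "i \<le> j \<Longrightarrow> ev i \<le> ev j"
  using eigenbasis by (auto simp: eigenbasis_def incseq_def)

lemma us_H1: "us l \<in> H1 T M V \<rho>"
  using eigenbasis by (auto simp: eigenbasis_def weighted_laplacian_def)

lemma us_orthonormal: "wip V \<rho> (us i) (us j) = (if i = j then 1 else 0)"
  using eigenbasis by (auto simp: eigenbasis_def ip_eq_wip)

lemma us_weak: "v \<in> H1 T M V \<rho> \<Longrightarrow> wip V \<rho> v (us l) * ev l = dirichlet_form T M V \<rho> v (us l)"
proof -
  assume v: "v \<in> H1 T M V \<rho>"
  have "ip V \<rho> (\<lambda>x. ev l * us l x) v = dirichlet_form T M V \<rho> (us l) v"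
    using eigenbasis v by (auto simp: eigenbasis_def weighted_laplacian_def)
  moreover have "ip V \<rho> (\<lambda>x. ev l * us l x) v = wip V \<rho> v (us l) * ev l"
    by (simp add: ip_def wip_def mult_ac flip: Bochner_Integration.integral_mult_right_zero)
  ultimately show ?thesis
    by (simp add: dirichlet_form_wip wip_commute)
qed

text \<open>The weak eigenvalue equation of one eigenfunction is tested with another.\<close>

lemma grad_us_orthogonal:
  "wip V \<rho> (weak_grad T M V \<rho> (us i)) (weak_grad T M V \<rho> (us j)) = (if i = j then ev i else 0)"
  using us_weak[OF us_H1[of i], of j] by (auto simp: us_orthonormal dirichlet_form_wip split: if_splits)

lemma ev_nonneg: "ev l \<ge> 0"
  using grad_us_orthogonal[of l l] mix.wip_nonneg[of "weak_grad T M V \<rho> (us l)"] by simp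

text \<open>By completeness the squared error is the sum of the squared coefficients from index n
  on. Each of them carries an eigenvalue of at least \<open>ev n\<close>, and Bessel's inequality
  for the gradients bounds the sum weighted by the eigenvalues by the energy of Q.\<close>

lemma spectral_projection_error:
  assumes Q: "Q \<in> H1 T M V \<rho>" and n: "ev n > 0"
  shows "wip V \<rho> (\<lambda>x. Q x - (\<Sum>l<n. wip V \<rho> Q (us l) *\<^sub>R us l x)) (\<lambda>x. Q x - (\<Sum>l<n. wip V \<rho> Q (us l) *\<^sub>R us l x))
    \<le> dirichlet_form T M V \<rho> Q Q / ev n"
proof -
  define a where "a l = wip V \<rho> Q (us l)" for l
  define E where "E n = wip V \<rho> (\<lambda>x. Q x - (\<Sum>l<n. a l *\<^sub>R us l x)) (\<lambda>x. Q x - (\<Sum>l<n. a l *\<^sub>R us l x))" for n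
  have sq: "sq_integrable V \<rho> Q" "sq_integrable V \<rho> (us l)" for l
    using H1_sq_integrable Q us_H1 by auto
  have E: "E n = wip V \<rho> Q Q - (\<Sum>l<n. (a l)\<^sup>2)" for n
    unfolding E_def
    by (subst mix.wip_diff_sum_diff_sum[where m = "\<lambda>_. 1"])
      (auto simp: sq us_orthonormal a_def power2_eq_square)
  have "E \<longlonglongrightarrow> 0"
  proof -
    have "Q \<in> L2 V \<rho>" using Q by (simp add: H1_def)
    then have "(\<lambda>n. \<integral>x. (Q x - (\<Sum>l<n. ip V \<rho> Q (us l) * us l x))\<^sup>2 * \<rho> x \<partial>V) \<longlonglongrightarrow> 0"
      using eigenbasis by (auto simp: eigenbasis_def)
    then show ?thesis
      by (simp add: E_def[abs_def] wip_def[of _ _ "\<lambda>x. _ x - _ x"] a_def ip_eq_wip power2_eq_square)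
  qed
  moreover have "E n - E k \<le> dirichlet_form T M V \<rho> Q Q / ev n" if "n \<le> k" for k
  proof -
    let ?G = "weak_grad T M V \<rho>"
    \<comment> \<open>This is Bessel's inequality for the gradients of the eigenfunctions, which are
      orthogonal with squared norms \<open>ev l\<close>.\<close>
    have "0 \<le> wip V \<rho> (\<lambda>x. ?G Q x - (\<Sum>l<k. a l *\<^sub>R ?G (us l) x)) (\<lambda>x. ?G Q x - (\<Sum>l<k. a l *\<^sub>R ?G (us l) x))"
      by (rule mix.wip_nonneg)
    also have "\<dots> = dirichlet_form T M V \<rho> Q Q - (\<Sum>l<k. a l * a l * ev l)"
    proof -
      have "wip V \<rho> (?G Q) (?G (us l)) = a l * ev l" for l
        using us_weak[OF Q, of l] by (simp add: a_def dirichlet_form_wip)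
      then show ?thesis
        unfolding dirichlet_form_wip
        by (intro mix.wip_diff_sum_diff_sum[where m = ev])
          (auto simp: H1_sq_integrable_grad Q us_H1 grad_us_orthogonal)
    qed
    finally have "(\<Sum>l<k. a l * a l * ev l) \<le> dirichlet_form T M V \<rho> Q Q" by simp
    \<comment> \<open>The difference of two errors is a finite block of squared coefficients, so no
      infinite series is needed.\<close>
    have "ev n * (E n - E k) = (\<Sum>l\<in>{n..<k}. (a l)\<^sup>2 * ev n)"
      using sum_diff_nat_ivl[of 0 n k "\<lambda>l. (a l)\<^sup>2"] that
      by (simp add: E lessThan_atLeast0 sum_distrib_left mult.commute)
    also have "\<dots> \<le> (\<Sum>l\<in>{n..<k}. a l * a l * ev l)"
      by (intro sum_mono) (auto simp: power2_eq_square intro!: mult_left_mono ev_mono)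
    also have "\<dots> \<le> (\<Sum>l<k. a l * a l * ev l)"
      by (rule sum_mono2) (auto intro!: mult_nonneg_nonneg[OF zero_le_square ev_nonneg])
    also have "\<dots> \<le> dirichlet_form T M V \<rho> Q Q" by fact
    finally show ?thesis
      using n by (simp add: field_simps)
  qed
  then have "eventually (\<lambda>k. E n - E k \<le> dirichlet_form T M V \<rho> Q Q / ev n) sequentially"
    by (auto simp: eventually_sequentially)
  \<comment> \<open>The bound is uniform in k, and \<open>E k\<close> tends to 0 by completeness of
    the eigenbasis.\<close>
  ultimately have "E n - 0 \<le> dirichlet_form T M V \<rho> Q Q / ev n"
    by (intro tendsto_upperbound[of "\<lambda>k. E n - E k"] tendsto_intros) auto
  then show ?thesis by (simp add: E_def a_def)
qed

text \<open>This is the min-max principle with f in the span of N + 1 eigenfunctions. The component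
  inequalities, added with the weights w, give \<Theta> times the squared norm of f as a lower bound
  for its energy in L2(\<rho>); the spectral expansion bounds the same energy above by
  \<open>ev N\<close> times the squared norm.\<close>

lemma indivisibility_le_ev: "indivisibility T M V \<rho>s \<le> ev (CARD('n))"
proof -
  let ?N = "CARD('n)" and ?\<Theta> = "indivisibility T M V \<rho>s" and ?G = "\<lambda>l. weak_grad T M V \<rho> (us l)"
  \<comment> \<open>The vector \<open>b l\<close> collects the means of \<open>us l\<close> under
    the N components. Indices up to N give N + 1 vectors in dimension N, so they are linearly
    dependent.\<close>
  define b :: "nat \<Rightarrow> real^'n" where "b l = (\<chi> k. wip V (\<rho>s k) (\<lambda>_. 1) (us l))" for l
  obtain c where c: "\<exists>l\<le>?N. c l \<noteq> 0" "(\<Sum>l\<le>?N. c l *\<^sub>R b l) = 0"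
    using linear_dependence by blast
  define f where "f x = (\<Sum>l\<le>?N. c l *\<^sub>R us l x)" for x
  define g where "g x = (\<Sum>l\<le>?N. c l *\<^sub>R ?G l x)" for x
  have f: "sq_integrable V \<rho> f" and g: "sq_integrable V \<rho> g"
    unfolding f_def[abs_def] g_def[abs_def]
    by (rule mix.sq_integrable_sum; simp add: H1_sq_integrable H1_sq_integrable_grad us_H1)+
  have grad: "has_weak_gradient T M V \<rho> f g"
    unfolding f_def[abs_def] g_def[abs_def] real_scaleR_def
    by (intro has_weak_gradient_sum H1_weak_gradient us_H1) auto
  have ineq: "?\<Theta> * wip V (\<rho>s k) f f \<le> wip V (\<rho>s k) g g" for k
  proof -
    have gk: "has_weak_gradient T M V (\<rho>s k) f g"
      by (rule has_weak_gradient_mono[OF grad mixture_pos])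
    have fH1: "f \<in> H1 T M V (\<rho>s k)"
      using sq_integrable_component[OF f, of k] sq_integrable_component[OF g, of k]
      by (intro H1I[OF continuous_on_\<rho>s \<rho>s_nonneg gk]) (auto simp: L2_eq sq_integrable_def)
    have dir: "dirichlet_form T M V (\<rho>s k) f f = wip V (\<rho>s k) g g"
      using dirichlet_form_eq[OF continuous_on_\<rho>s \<rho>s_nonneg gk] by (simp add: wip_def power2_norm_eq_inner)
    have one: "sq_integrable V (\<rho>s k) (\<lambda>_. 1)"
      using integrable_\<rho>s by (simp add: sq_integrable_def)
    have "ip V (\<rho>s k) f (\<lambda>_. 1) = wip V (\<rho>s k) (\<lambda>_. 1) f"
      by (simp add: ip_eq_wip wip_commute)
    also have "\<dots> = (\<Sum>l\<le>?N. c l * wip V (\<rho>s k) (\<lambda>_. 1) (us l))"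
      unfolding f_def[abs_def]
      by (rule comp.wip_sum_right[OF one]) (intro sq_integrable_component H1_sq_integrable us_H1)
    also have "\<dots> = (\<Sum>l\<le>?N. c l *\<^sub>R b l) $ k"
      by (simp add: b_def)
    finally have orth: "ip V (\<rho>s k) f (\<lambda>_. 1) = 0"
      using c(2) by simp
    show ?thesis
    \<comment> \<open>If f vanishes in L2(\<rho>s k) it is no competitor in the infimum, but then
      the left-hand side is 0.\<close>
    proof (cases "wip V (\<rho>s k) f f = 0")
      case True
      then show ?thesis using comp.wip_nonneg[of k g] by simp
    next
      case False
      then have pos: "wip V (\<rho>s k) f f > 0"
        using comp.wip_nonneg[of k f] by simp
      let ?S = "{dirichlet_form T M V (\<rho>s k) u u / ip V (\<rho>s k) u u | u.
            u \<in> H1 T M V (\<rho>s k) \<and> ip V (\<rho>s k) u u \<noteq> 0 \<and> ip V (\<rho>s k) u (\<lambda>_. 1) = 0}"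
      have "bdd_below ?S"
      proof (rule bdd_belowI[of _ 0])
        fix y assume "y \<in> ?S"
        then obtain u where "y = dirichlet_form T M V (\<rho>s k) u u / ip V (\<rho>s k) u u" by blast
        then have y: "y = wip V (\<rho>s k) (weak_grad T M V (\<rho>s k) u) (weak_grad T M V (\<rho>s k) u) / wip V (\<rho>s k) u u"
          by (simp add: dirichlet_form_def wip_def ip_def)
        show "0 \<le> y"
          unfolding y by (intro divide_nonneg_nonneg comp.wip_nonneg)
      qed
      moreover have "wip V (\<rho>s k) g g / wip V (\<rho>s k) f f \<in> ?S"
        using fH1 orth False by (intro CollectI exI[of _ f]) (simp add: ip_eq_wip dir)
      ultimately have "indivisibility_k T M V (\<rho>s k) \<le> wip V (\<rho>s k) g g / wip V (\<rho>s k) f f"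
        unfolding indivisibility_k_def by (intro cInf_lower)
      moreover have "?\<Theta> \<le> indivisibility_k T M V (\<rho>s k)"
        unfolding indivisibility_def by (intro Min_le) auto
      ultimately have "?\<Theta> \<le> wip V (\<rho>s k) g g / wip V (\<rho>s k) f f" by simp
      then show ?thesis using pos by (simp add: field_simps)
    qed
  qed
  have ff: "wip V \<rho> f f = (\<Sum>l\<le>?N. c l * c l * 1)"
    unfolding f_def[abs_def]
    by (rule mix.wip_sum_sum) (auto simp: H1_sq_integrable us_H1 us_orthonormal)
  have "?\<Theta> * wip V \<rho> f f = (\<Sum>k\<in>UNIV. w k * (?\<Theta> * wip V (\<rho>s k) f f))"
    by (simp add: wip_mixture[OF f f] sum_distrib_left mult_ac)
  also have "\<dots> \<le> (\<Sum>k\<in>UNIV. w k * wip V (\<rho>s k) g g)"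
    using w_pos by (intro sum_mono mult_left_mono ineq) (auto simp: less_imp_le)
  also have "\<dots> = wip V \<rho> g g"
    by (simp add: wip_mixture[OF g g])
  also have "\<dots> = (\<Sum>l\<le>?N. c l * c l * ev l)"
    unfolding g_def[abs_def]
    by (rule mix.wip_sum_sum) (auto simp: H1_sq_integrable_grad us_H1 grad_us_orthogonal)
  also have "\<dots> \<le> (\<Sum>l\<le>?N. c l * c l * ev ?N)"
    by (intro sum_mono mult_left_mono ev_mono) auto
  also have "\<dots> = ev ?N * wip V \<rho> f f"
    by (simp add: ff sum_distrib_left mult.commute)
  finally have *: "?\<Theta> * wip V \<rho> f f \<le> ev ?N * wip V \<rho> f f" .
  \<comment> \<open>A nontrivial combination of orthonormal functions has positive norm, so the
    factor can be cancelled.\<close>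
  have "(\<Sum>l\<le>?N. c l * c l * 1) > 0"
    using c(1) by (auto intro!: sum_pos2 simp: zero_less_mult_iff linorder_neq_iff)
  then show ?thesis
    using * ff by simp
qed

end

end

context mixture_model
begin

text \<open>
  The Gram matrix of the coefficients of the \<open>q\<close> in the eigenfunctions is almost the identity, so
  that Gram--Schmidt moves these coefficients only a little.
\<close>
lemma orthonormal_approximation:
  fixes ev us and idx :: "'n \<Rightarrow> nat"
  assumes eb: "eigenbasis T M V \<rho> ev us" and idx: "bij_betw idx UNIV {..<CARD('n)}"
    and \<kappa>: "\<And>k. dirichlet_form T M V \<rho> (q k) (q k) \<le> \<kappa> * ev (CARD('n))"
    and H1: "\<And>k. q k \<in> H1 T M V \<rho>" and ev: "ev (CARD('n)) > 0"
    and \<tau>: "sqrt (overlap V w \<rho>s) + \<kappa> \<le> \<tau>" "real CARD('n) * \<tau> < 1" "\<kappa> \<le> \<tau>"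
  shows "\<exists>v :: 'n \<Rightarrow> real^'n. (\<forall>i j. v i \<bullet> v j = (if i = j then 1 else 0)) \<and>
    (\<forall>k. wip V \<rho> (\<lambda>x. q k x - embedding (us \<circ> idx) x \<bullet> v k) (\<lambda>x. q k x - embedding (us \<circ> idx) x \<bullet> v k)
      \<le> 2 * (1 - sqrt (1 - real CARD('n) * \<tau>)))"
proof -
  define a :: "'n \<Rightarrow> real^'n" where "a k = (\<chi> i. wip V \<rho> (q k) (us (idx i)))" for k
  define R where "R k x = q k x - (\<Sum>l<CARD('n). wip V \<rho> (q k) (us l) *\<^sub>R us l x)" for k x
  have sq: "sq_integrable V \<rho> (us l)" "sq_integrable V \<rho> (R k)" for l k
  proof -
    show sq: "sq_integrable V \<rho> (us l)" for l
      by (rule H1_sq_integrable[OF us_H1[OF eb]])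
    show "sq_integrable V \<rho> (R k)"
      unfolding R_def[abs_def]
      by (intro mix.sq_integrable_diff sq_integrable_q mix.sq_integrable_sum sq finite_lessThan)
  qed
  have R_small: "wip V \<rho> (R k) (R k) \<le> \<kappa>" for k
  proof -
    have "wip V \<rho> (R k) (R k) \<le> dirichlet_form T M V \<rho> (q k) (q k) / ev (CARD('n))"
      unfolding R_def[abs_def] by (rule spectral_projection_error[OF eb H1 ev])
    also have "\<dots> \<le> \<kappa>"
      using \<kappa>[of k] ev by (simp add: field_simps)
    finally show ?thesis .
  qed
  \<comment> \<open>Positivity of the squared norms of R i - R j and R i + R j bounds the mixed
    inner product by the mean of the two squared norms.\<close>
  have R_abs: "\<bar>wip V \<rho> (R i) (R j)\<bar> \<le> \<kappa>" for i j
  proof -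
    have "0 \<le> wip V \<rho> (\<lambda>x. R i x - c * R j x) (\<lambda>x. R i x - c * R j x)" for c
      by (rule mix.wip_nonneg)
    moreover have "wip V \<rho> (\<lambda>x. R i x - c * R j x) (\<lambda>x. R i x - c * R j x) =
        wip V \<rho> (R i) (R i) - 2 * c * wip V \<rho> (R i) (R j) + c * c * wip V \<rho> (R j) (R j)" for c
    proof -
      have cR: "sq_integrable V \<rho> (\<lambda>x. c * R j x)"
        using mix.sq_integrable_scaleR[OF sq(2), of c j] by simp
      have "wip V \<rho> f (\<lambda>x. c * R j x) = c * wip V \<rho> f (R j)"
        "wip V \<rho> (\<lambda>x. c * R j x) f = c * wip V \<rho> (R j) f" for f
        by (simp_all add: wip_def mult_ac flip: Bochner_Integration.integral_mult_right_zero)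
      then show ?thesis
        unfolding mix.wip_diff_diff[OF sq(2) cR sq(2) cR]
        by (simp add: wip_commute[of V \<rho> "R j" "R i"])
    qed
    ultimately have "0 \<le> wip V \<rho> (R i) (R i) - 2 * c * wip V \<rho> (R i) (R j) + c * c * wip V \<rho> (R j) (R j)" for c
      by metis
    from this[of 1] this[of "-1"] show ?thesis
      using R_small[of i] R_small[of j] by simp
  qed
  \<comment> \<open>By Pythagoras the Gram matrix of the projections is that of the
    \<open>q k\<close> minus that of the residuals. The former deviates from the identity by the
    overlap, the latter is at most \<kappa> in every entry.\<close>
  have a_inner: "a i \<bullet> a j = wip V \<rho> (q i) (q j) - wip V \<rho> (R i) (R j)" for i j
  proof -
    have "a i \<bullet> a j = (\<Sum>l\<in>UNIV. wip V \<rho> (q i) (us (idx l)) * wip V \<rho> (q j) (us (idx l)))"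
      by (simp add: a_def inner_vec_def)
    also have "\<dots> = (\<Sum>l<CARD('n). wip V \<rho> (q i) (us l) * wip V \<rho> (q j) (us l) * 1)"
      using sum.reindex_bij_betw[OF idx, of "\<lambda>l. wip V \<rho> (q i) (us l) * wip V \<rho> (q j) (us l)"] by simp
    also have "\<dots> = wip V \<rho> (q i) (q j) - wip V \<rho> (R i) (R j)"
      unfolding R_def[abs_def]
      by (subst mix.wip_diff_sum_diff_sum[where m = "\<lambda>_. 1"])
        (auto simp: sq sq_integrable_q us_orthonormal[OF eb])
    finally show ?thesis .
  qed
  have "\<bar>a i \<bullet> a j - (if i = j then 1 else 0)\<bar> \<le> \<tau>" for i j
  proof (cases "i = j")
    case True
    then show ?thesis
      using R_abs[of j j] \<tau>(3) by (simp add: a_inner wip_q_self)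
  next
    case False
    then show ?thesis
      using R_abs[of i j] wip_q_le[OF False] \<tau>(1) by (simp add: a_inner)
  qed
  then have "(1 - real CARD('n) * \<tau>) * (\<Sum>k\<in>UNIV. (x k)\<^sup>2) \<le> (norm (\<Sum>k\<in>UNIV. x k *\<^sub>R a k))\<^sup>2" for x
    by (rule coercive_if_almost_orthonormal)
  then obtain v where v: "\<And>i j. v i \<bullet> v j = (if i = j then 1 else 0)"
      "\<And>k. sqrt (1 - real CARD('n) * \<tau>) \<le> a k \<bullet> v k"
    using Gram_Schmidt_coercive[of UNIV "1 - real CARD('n) * \<tau>" a] \<tau>(2) by auto
  have "wip V \<rho> (\<lambda>x. q k x - embedding (us \<circ> idx) x \<bullet> v k) (\<lambda>x. q k x - embedding (us \<circ> idx) x \<bullet> v k)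
      \<le> 2 * (1 - sqrt (1 - real CARD('n) * \<tau>))" for k
  proof -
    define F where "F x = (\<Sum>i\<in>UNIV. (v k $ i) *\<^sub>R us (idx i) x)" for x
    have F: "embedding (us \<circ> idx) x \<bullet> v k = F x" for x
      by (simp add: embedding_def inner_vec_def F_def mult.commute)
    have inj: "idx i = idx j \<longleftrightarrow> i = j" for i j
      using idx by (auto simp: bij_betw_def inj_eq)
    have sqF: "sq_integrable V \<rho> F"
      unfolding F_def[abs_def] by (intro mix.sq_integrable_sum sq) simp
    have FF: "wip V \<rho> F F = 1"
    proof -
      have "wip V \<rho> F F = (\<Sum>i\<in>UNIV. v k $ i * v k $ i * 1)"
        unfolding F_def[abs_def] by (rule mix.wip_sum_sum) (auto simp: sq us_orthonormal[OF eb] inj)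
      also have "\<dots> = v k \<bullet> v k" by (simp add: inner_vec_def)
      finally show ?thesis by (simp add: v(1))
    qed
    have qF: "wip V \<rho> (q k) F = a k \<bullet> v k"
      unfolding F_def[abs_def]
      by (subst mix.wip_sum_right) (auto simp: sq sq_integrable_q a_def inner_vec_def mult.commute)
    \<comment> \<open>Both functions have norm 1, so their squared distance is 2 minus twice the
      inner product, which Gram-Schmidt bounds below.\<close>
    have "wip V \<rho> (\<lambda>x. q k x - F x) (\<lambda>x. q k x - F x) = 1 - 2 * (a k \<bullet> v k) + 1"
      unfolding mix.wip_diff_diff[OF sq_integrable_q sqF sq_integrable_q sqF] wip_commute[of V \<rho> F "q k"]
      by (simp add: qF FF wip_q_self)
    then show ?thesis
      unfolding F using v(2)[of k] by simp
  qed
  with v(1) show ?thesis by blast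
qed

section \<open>Exceptional sets and their mixture measure\<close>

lemma emeasure_mixture_space:
  "emeasure \<nu> (space \<nu>) = 1"
proof -
  have "emeasure \<nu> (space \<nu>) =
      (\<integral>\<^sup>+x. ennreal (\<rho> x) \<partial>V)"
    by (subst emeasure_density) (auto intro!: nn_integral_cong)
  then show "emeasure \<nu> (space \<nu>) = 1"
    using integrable_mixture integral_mixture mixture_pos
    by (subst (asm) nn_integral_eq_integral) (auto simp: space_V less_imp_le)
qed

lemma finite_measure_mixture: "finite_measure \<nu>"
  by (rule finite_measureI) (simp only: emeasure_mixture_space ennreal_one_neq_top infinity_ennreal_def not_False_eq_True)

text \<open>Markov's inequality for a function h that dominates the indicator of A; it estimates
  both exceptional sets below.\<close>

lemma measure_mixture_le:
  assumes A: "A \<in> sets V" and h: "integrable V (\<lambda>x. h x * \<rho> x)"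
    and "\<And>x. x \<in> M \<Longrightarrow> 0 \<le> h x" "\<And>x. x \<in> A \<Longrightarrow> 1 \<le> h x"
  shows "measure \<nu> A \<le> (\<integral>x. h x * \<rho> x \<partial>V)"
proof -
  interpret finite_measure "\<nu>" by (rule finite_measure_mixture)
  have A': "A \<subseteq> M" using sets.sets_into_space[OF A] by (simp add: space_V)
  have "measure \<nu> A = (\<integral>x. indicator A x \<partial>\<nu>)"
    using A' by (simp add: Int_absorb2 space_V)
  also have "\<dots> = (\<integral>x. \<rho> x * indicator A x \<partial>V)"
    using A mixture_pos by (subst integral_density) (auto simp: space_V less_imp_le)
  also have "\<dots> \<le> (\<integral>x. h x * \<rho> x \<partial>V)"
  proof (rule integral_mono_AE)
    show "integrable V (\<lambda>x. \<rho> x * indicator A x)"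
      using integrable_mult_indicator[OF A integrable_mixture] by (simp add: mult.commute)
    show "AE x in V. \<rho> x * indicator A x \<le> h x * \<rho> x"
    proof (rule AE_I2)
      fix x assume "x \<in> space V"
      then have "x \<in> M" by (simp add: space_V)
      then show "\<rho> x * indicator A x \<le> h x * \<rho> x"
        using assms(3,4)[of x] mixture_pos[of x] by (auto simp: indicator_def)
    qed
  qed (rule h)
  finally show ?thesis .
qed

text \<open>The squares of the \<open>q k\<close> add up to the sum of the \<rho>s k divided by
  \<rho>, and \<rho> is at most w_max times that sum. This is where the radius 1 / sqrt w_max
  originates.\<close>

lemma norm_q_ge:
  assumes x: "x \<in> M"
  shows "1 / sqrt (Max (range w)) \<le> norm (\<chi> k. q k x)"
proof -
  let ?w = "Max (range w)"
  have max: "w k \<le> ?w" for k by (intro Max_ge) auto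
  have pos: "?w > 0" using w_pos max less_le_trans by blast
  have "\<rho> x \<le> (\<Sum>k\<in>UNIV. ?w * \<rho>s k x)"
    unfolding mixture_def using \<rho>s_nonneg[OF x] by (intro sum_mono mult_right_mono max)
  then have "\<rho> x \<le> ?w * (\<Sum>k\<in>UNIV. \<rho>s k x)"
    by (simp only: sum_distrib_left)
  then have "1 / ?w \<le> (\<Sum>k\<in>UNIV. \<rho>s k x) / \<rho> x"
    using pos mixture_pos[OF x] by (simp add: field_simps)
  also have "\<dots> = (\<Sum>k\<in>UNIV. \<rho>s k x / \<rho> x)"
    by (rule sum_divide_distrib)
  also have "\<dots> = (\<Sum>k\<in>UNIV. (q k x)\<^sup>2)"
    using \<rho>s_nonneg[OF x] mixture_pos[OF x] by (simp add: less_imp_le)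
  also have "\<dots> = (norm (\<chi> k. q k x))\<^sup>2"
    unfolding power2_norm_eq_inner by (simp add: inner_vec_def power2_eq_square)
  finally have "sqrt (1 / ?w) \<le> norm (\<chi> k. q k x)"
    by (intro real_le_lsqrt) auto
  then show ?thesis by (simp add: real_sqrt_divide)
qed

text \<open>The pointwise bound of \<open>off_cone_bound\<close> is integrated against \<rho> dx.
  Each of the N^2 index pairs contributes at most S; the diagonal contributes 0, which is at most S
  because S is nonnegative.\<close>

lemma measure_off_cones_le:
  assumes \<sigma>: "0 < \<sigma>" "\<sigma> < pi / 2" and N: "CARD('n) \<ge> 2"
    and A: "A = {x \<in> M. \<forall>k. q k x \<le> cos \<sigma> * norm (\<chi> k. q k x)}"
  shows "A \<in> sets V"
    and "measure \<nu> A \<le>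
      (cos \<sigma>)\<^sup>2 / (1 - (cos \<sigma>)\<^sup>2) * ((real CARD('n))\<^sup>2 * overlap V w \<rho>s)"
proof -
  let ?K = "(cos \<sigma>)\<^sup>2 / (1 - (cos \<sigma>)\<^sup>2)"
  have K: "?K \<ge> 0"
    by (simp flip: sin_squared_eq)
  define h where "h x = ?K * (\<Sum>i\<in>UNIV. \<Sum>j\<in>UNIV. if i = j then 0 else \<rho>s i x * \<rho>s j x / (\<rho> x)\<^sup>2)" for x
  have "norm (\<chi> k. q k x) = sqrt (\<Sum>k\<in>UNIV. (q k x)\<^sup>2)" for x
    by (simp add: norm_vec_def L2_set_def)
  then have [measurable]: "(\<lambda>x. norm (\<chi> k. q k x)) \<in> borel_measurable V"
    by simp
  have "{x \<in> space V. \<forall>k. q k x \<le> cos \<sigma> * norm (\<chi> k. q k x)} \<in> sets V"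
    by measurable
  then show A_sets: "A \<in> sets V" by (simp add: A space_V)
  have h_nonneg: "0 \<le> h x" if "x \<in> M" for x
    unfolding h_def using K \<rho>s_nonneg[OF that] by (intro mult_nonneg_nonneg sum_nonneg) auto
  have h_ge: "1 \<le> h x" if "x \<in> A" for x
    using that unfolding h_def A
    by (intro off_cone_bound[OF \<rho>s_nonneg w_pos w_sum mixture_def mixture_pos \<sigma>]) auto
  have h_\<rho>: "h x * \<rho> x = ?K * (\<Sum>i\<in>UNIV. \<Sum>j\<in>UNIV. if i = j then 0 else \<rho>s i x * \<rho>s j x / \<rho> x)" if "x \<in> M" for x
  proof -
    have "(\<Sum>i\<in>UNIV. \<Sum>j\<in>UNIV. if i = j then 0 else \<rho>s i x * \<rho>s j x / (\<rho> x)\<^sup>2) * \<rho> x =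
        (\<Sum>i\<in>UNIV. \<Sum>j\<in>UNIV. if i = j then 0 else \<rho>s i x * \<rho>s j x / \<rho> x)"
      unfolding sum_distrib_right using mixture_pos[OF that]
      by (intro sum.cong) (auto simp: power2_eq_square)
    then show ?thesis by (simp add: h_def mult.assoc)
  qed
  have int: "integrable V (\<lambda>x. if i = j then 0 else \<rho>s i x * \<rho>s j x / \<rho> x)" for i j
    using integrable_overlap by (cases "i = j") auto
  have "integrable V (\<lambda>x. h x * \<rho> x) \<longleftrightarrow> integrable V (\<lambda>x. ?K * (\<Sum>i\<in>UNIV. \<Sum>j\<in>UNIV. if i = j then 0 else \<rho>s i x * \<rho>s j x / \<rho> x))"
    by (rule Bochner_Integration.integrable_cong) (auto simp: space_V h_\<rho>)
  then have h_int: "integrable V (\<lambda>x. h x * \<rho> x)"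
    using int by (simp del: integrable_mult_right_iff)
  have "measure \<nu> A \<le> (\<integral>x. h x * \<rho> x \<partial>V)"
    by (rule measure_mixture_le[OF A_sets h_int h_nonneg h_ge])
  also have "\<dots> = (\<integral>x. ?K * (\<Sum>i\<in>UNIV. \<Sum>j\<in>UNIV. if i = j then 0 else \<rho>s i x * \<rho>s j x / \<rho> x) \<partial>V)"
    by (intro Bochner_Integration.integral_cong) (auto simp: space_V h_\<rho>)
  also have "\<dots> = ?K * (\<Sum>i\<in>UNIV. \<Sum>j\<in>UNIV. (\<integral>x. (if i = j then 0 else \<rho>s i x * \<rho>s j x / \<rho> x) \<partial>V))"
    using int by (simp only: Bochner_Integration.integral_mult_right_zero Bochner_Integration.integral_sum
        Bochner_Integration.integrable_sum)
  also have "\<dots> \<le> ?K * (\<Sum>i\<in>(UNIV :: 'n set). \<Sum>j\<in>(UNIV :: 'n set). overlap V w \<rho>s)"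
  proof (intro mult_left_mono sum_mono K)
    fix i j :: 'n
    show "(\<integral>x. (if i = j then 0 else \<rho>s i x * \<rho>s j x / \<rho> x) \<partial>V) \<le> overlap V w \<rho>s"
      using overlap_integral_le[of i j] overlap_nonneg[OF N] by (cases "i = j") auto
  qed
  also have "\<dots> = ?K * ((real CARD('n))\<^sup>2 * overlap V w \<rho>s)"
    by (simp add: power2_eq_square)
  finally show "measure \<nu> A \<le> ?K * ((real CARD('n))\<^sup>2 * overlap V w \<rho>s)" .
qed

text \<open>The loss \<delta> + t^2 has two sources: the set A where the vector of the
  \<open>q k\<close> lies in no cone, controlled by the overlap, and the set B where the embedding
  in the basis v is too far from this vector, controlled by the mean square error.\<close>

lemma orthogonal_cone_structure_if_near_q:
  fixes F :: "'a \<Rightarrow> real^'n" and v :: "'n \<Rightarrow> real^'n"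
  assumes F: "F \<in> borel_measurable V" and N: "CARD('n) \<ge> 2"
    and v: "\<And>i j. v i \<bullet> v j = (if i = j then 1 else 0)"
    and sq: "\<And>k. sq_integrable V \<rho> (\<lambda>x. q k x - F x \<bullet> v k)"
    and near: "\<And>k. wip V \<rho> (\<lambda>x. q k x - F x \<bullet> v k) (\<lambda>x. q k x - F x \<bullet> v k) \<le> \<epsilon>"
    and \<sigma>: "0 < \<sigma>" "0 < s" "s + \<sigma> < pi / 4"
    and \<epsilon>: "real CARD('n) * \<epsilon> \<le> t\<^sup>2 * (sin s)\<^sup>2 / Max (range w)"
    and \<delta>: "(cos \<sigma>)\<^sup>2 / (1 - (cos \<sigma>)\<^sup>2) * ((real CARD('n))\<^sup>2 * overlap V w \<rho>s) \<le> \<delta>"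
  shows "orthogonal_cone_structure (distr \<nu> borel F)
      (\<sigma> + s) (\<delta> + t\<^sup>2) ((1 - sin s) / sqrt (Max (range w)))"
proof -
  let ?w = "Max (range w)"
  interpret finite_measure \<nu> by (rule finite_measure_mixture)
  note [measurable] = F
  have "w k \<le> ?w" for k by (intro Max_ge) auto
  then have w: "?w > 0" using w_pos less_le_trans by blast
  have sin: "sin s > 0" using \<sigma> by (intro sin_gt_zero) auto
  have "sin s < sin (pi / 2)" using \<sigma> by (intro sin_monotone_2pi) auto
  then have sin1: "sin s < 1" by simp
  define W where "W x = (\<chi> k. q k x)" for x
  define p where "p x = (\<chi> k. F x \<bullet> v k)" for x
  define A where "A = {x \<in> M. \<forall>k. q k x \<le> cos \<sigma> * norm (\<chi> k. q k x)}"
  \<comment> \<open>The vector W x has norm at least 1 / sqrt ?w, so an error below c is below sin s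
    times its norm and turns it by at most s.\<close>
  define c where "c = sin s / sqrt ?w"
  have c: "c > 0" using sin w by (simp add: c_def)
  define E where "E x = (\<Sum>k\<in>UNIV. (q k x - F x \<bullet> v k)\<^sup>2)" for x
  have E: "E x = (norm (W x - p x))\<^sup>2" for x
    unfolding power2_norm_eq_inner by (simp add: E_def W_def p_def inner_vec_def power2_eq_square)
  define B where "B = {x \<in> M. c\<^sup>2 \<le> E x}"
  have "{x \<in> space V. c\<^sup>2 \<le> E x} \<in> sets V"
    unfolding E_def by measurable
  then have B: "B \<in> sets V" by (simp add: B_def space_V)
  have A: "A \<in> sets V" and "measure \<nu> A \<le> \<delta>"
    using measure_off_cones_le[OF _ _ N A_def] \<sigma> \<delta> by auto
  have "measure \<nu> B \<le> t\<^sup>2"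
  proof -
    have int: "integrable V (\<lambda>x. (q k x - F x \<bullet> v k)\<^sup>2 * \<rho> x)" for k
      using sq[of k] by (simp add: sq_integrable_def)
    have eq: "E x / c\<^sup>2 * \<rho> x = inverse (c\<^sup>2) * (\<Sum>k\<in>UNIV. (q k x - F x \<bullet> v k)\<^sup>2 * \<rho> x)" for x
      unfolding E_def sum_distrib_right[symmetric] by (simp add: divide_inverse mult_ac)
    have "measure \<nu> B \<le> (\<integral>x. E x / c\<^sup>2 * \<rho> x \<partial>V)"
    proof (rule measure_mixture_le[OF B])
      show "integrable V (\<lambda>x. E x / c\<^sup>2 * \<rho> x)"
        unfolding eq using int by (intro integrable_mult_right Bochner_Integration.integrable_sum) auto
      show "0 \<le> E x / c\<^sup>2" for x by (simp add: E)
      show "1 \<le> E x / c\<^sup>2" if "x \<in> B" for x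
        using that c by (simp add: B_def)
    qed
    also have "\<dots> = inverse (c\<^sup>2) * (\<Sum>k\<in>UNIV. \<integral>x. (q k x - F x \<bullet> v k)\<^sup>2 * \<rho> x \<partial>V)"
      unfolding eq using int
      by (simp only: Bochner_Integration.integral_mult_right_zero Bochner_Integration.integral_sum)
    also have "\<dots> \<le> inverse (c\<^sup>2) * (\<Sum>k\<in>(UNIV :: 'n set). \<epsilon>)"
      using near by (intro mult_left_mono sum_mono) (auto simp: wip_def power2_eq_square)
    also have "\<dots> = inverse (c\<^sup>2) * (real CARD('n) * \<epsilon>)" by simp
    also have "\<dots> \<le> inverse (c\<^sup>2) * (t\<^sup>2 * (sin s)\<^sup>2 / ?w)"
      using \<epsilon> by (intro mult_left_mono) auto
    also have "\<dots> = t\<^sup>2"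
      using sin w by (simp add: c_def power_divide field_simps)
    finally show ?thesis .
  qed
  define K where "K = (\<Union>e\<in>range v. cone_sector e (\<sigma> + s) ((1 - sin s) / sqrt ?w))"
  have K: "K \<in> sets borel"
  proof -
    have "cone_sector e \<alpha> r \<in> sets borel" for e :: "real^'n" and \<alpha> r
      unfolding cone_sector_def by measurable
    then show ?thesis unfolding K_def by auto
  qed
  have sub: "M - (A \<union> B) \<subseteq> F -` K \<inter> M"
  proof
    fix x assume x: "x \<in> M - (A \<union> B)"
    then obtain k where k: "q k x > cos \<sigma> * norm (W x)"
      by (auto simp: A_def W_def not_le)
    have "F x \<in> cone_sector (v k) (\<sigma> + s) ((1 - sin s) * (1 / sqrt ?w))"
    proof (rule mem_cone_sector[OF v])
      show "0 < \<sigma>" "0 < s" "s + \<sigma> < pi / 2" using \<sigma> by auto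
      show "1 / sqrt ?w > 0" using w by simp
      show "W x $ k > cos \<sigma> * norm (W x)" using k by (simp add: W_def)
      show "1 / sqrt ?w \<le> norm (W x)" using norm_q_ge x by (simp add: W_def)
      have "(norm (W x - p x))\<^sup>2 < c\<^sup>2"
        using x by (simp add: B_def E not_le)
      then have "norm (W x - p x) < c"
        using c by (simp add: power_less_imp_less_base)
      then show "norm (W x - (\<chi> k. F x \<bullet> v k)) < sin s * (1 / sqrt ?w)"
        by (simp add: p_def c_def)
    qed
    then show "x \<in> F -` K \<inter> M"
      using x by (auto simp: K_def)
  qed
  have "1 - (\<delta> + t\<^sup>2) \<le> 1 - measure \<nu> (A \<union> B)"
    using measure_Un_le[of A \<nu> B] A B \<open>measure \<nu> A \<le> \<delta>\<close> \<open>measure \<nu> B \<le> t\<^sup>2\<close> by simp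
  also have "\<dots> = measure \<nu> (M - (A \<union> B))"
  proof -
    have "measure \<nu> (space \<nu>) = 1"
      using emeasure_mixture_space by (simp only: measure_def enn2real_1)
    then show ?thesis
      using finite_measure_compl[of "A \<union> B"] A B by (simp add: space_V)
  qed
  also have "\<dots> \<le> measure \<nu> (F -` K \<inter> M)"
    using measurable_sets[OF F K] by (intro finite_measure_mono sub) (simp add: space_V)
  also have "\<dots> = measure (distr \<nu> borel F) K"
    using K F by (subst measure_distr) (auto simp: space_V)
  finally have meas: "1 - (\<delta> + t\<^sup>2) \<le> measure (distr \<nu> borel F) K" .
  \<comment> \<open>Nonnegativity of the second parameter is part of the cone structure; it holds
    because \<delta> bounds a measure.\<close>
  have "0 \<le> \<delta>" using \<open>measure \<nu> A \<le> \<delta>\<close> measure_nonneg order_trans by blast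
  then show ?thesis
    unfolding orthogonal_cone_structure_def
  proof (intro conjI exI[of _ "range v"])
    show "\<forall>e\<in>range v. norm e = 1" using v by (auto simp: norm_eq_sqrt_inner)
  qed (use \<sigma> sin1 w meas pairwise_orthogonal_range[OF v] span_orthonormal[OF v] in \<open>auto simp: K_def\<close>)
qed

end

text \<open>For 0 < y \<le> 1 one has 1 - y \<le> 1 / y - 1, and the power of N is at least 1. With
  y = sqrt (1 - N * \<tau>) this compares the Gram-Schmidt error with the condition imposed on s and
  t.\<close>

lemma one_minus_sqrt_bound:
  fixes N y z :: real
  assumes "1 \<le> N" "0 < y" "y \<le> 1"
  shows "2 * (1 - y) \<le> N * z\<^sup>2 + 4 * N powr (3/2) * (1 / y - 1)"
proof -
  have "0 \<le> (1 - y)\<^sup>2" by simp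
  then have "(1 - y) * y \<le> 1 - y" by (simp add: power2_eq_square algebra_simps)
  then have "1 - y \<le> 1 / y - 1" using assms by (simp add: field_simps)
  moreover have "1 \<le> N powr (3/2)" using assms by (intro ge_one_powr_ge_zero) auto
  ultimately have b: "1 * (1 - y) \<le> N powr (3/2) * (1 / y - 1)"
    using assms by (intro mult_mono) auto
  have c: "0 \<le> N * z\<^sup>2" using assms by simp
  have "2 * (1 - y) \<le> c + 4 * b" if "1 * (1 - y) \<le> b" "0 \<le> c" for b c
    using that assms(3) by argo
  from this[OF b c] show ?thesis by (simp only: mult.assoc)
qed

theorem theorem2p5:
  fixes M :: "'a::euclidean_space set" and V :: "'a measure"
    and \<rho>s :: "'n::finite \<Rightarrow> 'a \<Rightarrow> real" and w :: "'n \<Rightarrow> real"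
    and u :: "'n \<Rightarrow> 'a \<Rightarrow> real"
    and \<sigma> s t :: real
  defines "N \<equiv> real CARD('n)"
    and "\<rho> \<equiv> mixture w \<rho>s"
    and "S \<equiv> overlap V w \<rho>s"
    and "C \<equiv> enn2real (coupling M V w \<rho>s)"
    and "\<Theta> \<equiv> indivisibility TYPE('m::finite) M V \<rho>s"
    and "w_max \<equiv> Max (range w)"
    and "w_min \<equiv> Min (range w)"
  defines "\<tau> \<equiv> 4 * inverse (sqrt (\<Theta> * (1 - N * S) / C) - sqrt (N * S) / (1 - S)) + sqrt S"
    and "\<delta>_star \<equiv> w_max * (cos \<sigma>)\<^sup>2 * N\<^sup>2 * S / (w_min * (1 - (cos \<sigma>)\<^sup>2))"
  assumes manifold: "smooth_submanifold TYPE('m) M" "connected M" "orientable TYPE('m) M"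
      "compact M \<or> M = UNIV"
    and volume: "is_volume_measure TYPE('m) M V"
    and N: "CARD('n) \<ge> 2"
    and densities: "\<And>k. C1_on_manifold M (\<rho>s k)" "\<And>k. probability_density M V (\<rho>s k)"
    and weights: "\<And>k. w k > 0" "(\<Sum>k\<in>UNIV. w k) = 1"
    and pos: "\<And>x. x \<in> M \<Longrightarrow> \<rho> x > 0"
    and spectrum: "\<And>k. discrete_spectrum TYPE('m) M V (\<rho>s k)" "discrete_spectrum TYPE('m) M V \<rho>"
    and eigenfunctions: "first_eigenfunctions TYPE('m) M V \<rho> u"
    and \<sigma>: "0 < \<sigma>" "\<sigma> < pi / 4"
    and S: "S < w_min * (1 - (cos \<sigma>)\<^sup>2) / (w_max * (cos \<sigma>)\<^sup>2 * N\<^sup>2)"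
    and \<tau>: "\<tau> - sqrt S > 0" "\<tau> * N < 1"
    and st: "s > 0" "t > 0"
      "t\<^sup>2 * (sin s)\<^sup>2 / (N * w_max) \<ge>
         N * ((\<tau> - sqrt S) / 2)\<^sup>2 + 4 * N powr (3/2) * (1 / sqrt (1 - N * \<tau>) - 1)"
      "s + \<sigma> < pi / 4"
  shows "\<forall>\<delta>. \<delta>_star \<le> \<delta> \<and> \<delta> < 1 \<longrightarrow>
    orthogonal_cone_structure (distr (density V (\<lambda>x. ennreal (\<rho> x))) borel (embedding u))
      (\<sigma> + s) (\<delta> + t\<^sup>2) ((1 - sin s) / sqrt w_max)"
proof -
  interpret mixture_model "TYPE('m)" M V \<rho>s w
    using manifold(1) volume densities weights pos
    by unfold_locales (auto simp: \<rho>_def)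
  obtain ev us idx where eb: "eigenbasis TYPE('m) M V (mixture w \<rho>s) ev us"
    and idx: "bij_betw idx (UNIV :: 'n set) {..<CARD('n)}" and u: "\<And>i. u i = us (idx i)"
    using eigenfunctions by (auto simp: first_eigenfunctions_def \<rho>_def)
  have u_eq: "u = us \<circ> idx" using u by auto
  have N2: "N \<ge> 2" using N by (simp add: N_def)
  have S0: "S \<ge> 0" unfolding S_def by (rule overlap_nonneg[OF N])
  have w_max: "w_max > 0" "w k \<le> w_max" and w_min: "w_min > 0" "w_min \<le> w k" for k
  proof -
    show max: "w k \<le> w_max" and "w_min \<le> w k" for k
      unfolding w_max_def w_min_def by (auto intro: Max_ge Min_le)
    show "w_max > 0" using weights(1) max less_le_trans by blast
    have "Min (range w) \<in> range w" by (intro Min_in) auto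
    then show "w_min > 0" using weights(1) unfolding w_min_def by auto
  qed
  have "sin \<sigma> > 0" "cos \<sigma> > 0"
    using \<sigma> by (auto intro!: sin_gt_zero cos_gt_zero_pi)
  then have cos\<sigma>: "1 - (cos \<sigma>)\<^sup>2 > 0" "(cos \<sigma>)\<^sup>2 > 0"
    by (auto simp flip: sin_squared_eq)
  define X where "X = sqrt (\<Theta> * (1 - N * S) / C) - sqrt (N * S) / (1 - S)"
  define \<gamma> where "\<gamma> = \<tau> - sqrt S"
  have \<gamma>: "\<gamma> = 4 * inverse X" by (simp add: \<gamma>_def \<tau>_def X_def)
  \<comment> \<open>Since \<gamma> = 4 * inverse X is positive, X is positive too; X = 0 is excluded
    because \<open>inverse 0\<close> is 0.\<close>
  have X: "X > 0" using \<tau>(1) by (simp add: \<gamma>[symmetric, unfolded \<gamma>_def] \<tau>_def X_def)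
  have \<gamma>0: "\<gamma> > 0" using \<tau>(1) by (simp add: \<gamma>_def)
  have sqrtS: "sqrt S \<ge> 0" using S0 by simp
  have \<gamma>_\<tau>: "\<gamma> \<le> \<tau>" using S0 by (simp add: \<gamma>_def)
  have \<tau>0: "\<tau> > 0" using \<gamma>0 sqrtS unfolding \<gamma>_def by linarith
  have \<tau>1: "\<tau> < 1"
  proof -
    have "\<tau> * 2 \<le> \<tau> * N" using N2 \<tau>0 by (intro mult_left_mono) auto
    then show ?thesis using \<tau>(2) by linarith
  qed
  have sqrtS_\<tau>: "sqrt S < \<tau>" using \<tau>(1) by simp
  then have sqrtS1: "sqrt S < 1" using \<tau>1 by linarith
  have "S = sqrt S * sqrt S" using S0 by simp
  also have "\<dots> \<le> sqrt S * 1" using sqrtS sqrtS1 by (intro mult_left_mono) auto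
  finally have S_\<tau>: "S < \<tau>" using sqrtS_\<tau> by linarith
  then have "N * S \<le> N * \<tau>" using N2 by (intro mult_left_mono) auto
  then have NS: "1 - N * S > 0" using \<tau>(2) by (simp add: mult.commute)
  have S1: "1 - S > 0" using S_\<tau> \<tau>1 by linarith
  have "sqrt (N * S) / (1 - S) \<ge> 0" using S0 S1 N2 by simp
  then have X_le: "X \<le> sqrt (\<Theta> * (1 - N * S) / C)" by (simp add: X_def)
  have "C \<ge> 0" by (simp add: C_def)
  have "\<Theta> * (1 - N * S) / C > 0"
    using X X_le by (metis less_le_trans real_sqrt_gt_0_iff)
  \<comment> \<open>C is 0 both for vanishing and for infinite coupling, and division by 0 gives 0.
    Positivity of the quotient excludes both cases, so the coupling is positive and finite.\<close>
  then have C: "C > 0" and \<Theta>: "\<Theta> > 0"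
    using \<open>C \<ge> 0\<close> NS by (auto simp: zero_less_divide_iff zero_less_mult_iff)
  define \<kappa> where "\<kappa> = C / \<Theta>"
  \<comment> \<open>X^2 \<le> \<Theta> / C gives \<kappa> \<le> (\<gamma> / 4)^2, and \<gamma> < 1
    makes this at most \<gamma> / 4.\<close>
  have \<kappa>_\<gamma>: "\<kappa> \<le> \<gamma>"
  proof -
    have "X\<^sup>2 \<le> (sqrt (\<Theta> * (1 - N * S) / C))\<^sup>2"
      using X X_le by (intro power_mono) auto
    also have "\<dots> = \<Theta> * (1 - N * S) / C"
      using \<open>\<Theta> * (1 - N * S) / C > 0\<close> by simp
    also have "\<dots> \<le> \<Theta> / C"
    proof (intro divide_right_mono)
      have "\<Theta> * (1 - N * S) \<le> \<Theta> * 1" using \<Theta> S0 N2 by (intro mult_left_mono) auto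
      then show "\<Theta> * (1 - N * S) \<le> \<Theta>" by simp
    qed (use C in simp)
    finally have "X\<^sup>2 \<le> \<Theta> / C" .
    then have "inverse (\<Theta> / C) \<le> inverse (X\<^sup>2)"
      using X by (intro le_imp_inverse_le) auto
    then have "\<kappa> \<le> (inverse X)\<^sup>2" by (simp add: \<kappa>_def power_inverse)
    also have "\<dots> = \<gamma> / 4 * (\<gamma> / 4)" by (simp add: \<gamma> power2_eq_square)
    also have "\<dots> \<le> \<gamma> / 4 * 1"
    proof (rule mult_left_mono)
      show "\<gamma> / 4 \<le> 1" using \<gamma>_\<tau> \<tau>1 by simp
    qed (use \<gamma>0 in simp)
    finally show ?thesis using \<gamma>0 by linarith
  qed
  have coupling: "coupling_k M V w \<rho>s k < \<infinity>" "enn2real (coupling_k M V w \<rho>s k) \<le> C" for k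
  proof -
    have le: "coupling_k M V w \<rho>s k \<le> coupling M V w \<rho>s"
      unfolding coupling_def by (intro Max_ge) auto
    have fin: "coupling M V w \<rho>s < \<infinity>"
      using C by (cases "coupling M V w \<rho>s = top") (auto simp: C_def less_top)
    show "coupling_k M V w \<rho>s k < \<infinity>" using le fin by (rule le_less_trans)
    show "enn2real (coupling_k M V w \<rho>s k) \<le> C"
      unfolding C_def using le fin by (intro enn2real_mono) auto
  qed
  have ev: "\<Theta> \<le> ev (CARD('n))"
    unfolding \<Theta>_def by (rule indivisibility_le_ev[OF eb])
  \<comment> \<open>\<kappa> is chosen so that \<kappa> * \<Theta> = C; the energies, bounded by C,
    are then bounded through \<Theta> \<le> ev N in the form in which the projection error divides
    by ev N.\<close>
  have dir: "dirichlet_form TYPE('m) M V (mixture w \<rho>s) (q k) (q k) \<le> \<kappa> * ev (CARD('n))" for k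
  proof -
    have "dirichlet_form TYPE('m) M V (mixture w \<rho>s) (q k) (q k) \<le> C"
      using dirichlet_form_q[OF coupling(1)] coupling(2) by simp
    also have "\<dots> = \<kappa> * \<Theta>" using \<Theta> by (simp add: \<kappa>_def)
    also have "\<dots> \<le> \<kappa> * ev (CARD('n))" using ev C \<Theta> by (intro mult_left_mono) (auto simp: \<kappa>_def)
    finally show ?thesis .
  qed
  have \<tau>': "sqrt (overlap V w \<rho>s) + \<kappa> \<le> \<tau>" "\<kappa> \<le> \<tau>" "real CARD('n) * \<tau> < 1"
    using \<kappa>_\<gamma> \<tau>(2) order_trans[OF \<kappa>_\<gamma> \<gamma>_\<tau>] by (auto simp: \<gamma>_def S_def N_def mult.commute)
  define y where "y = sqrt (1 - N * \<tau>)"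
  have y: "0 < y" "y \<le> 1"
    using \<tau>' \<tau>0 N2 by (auto simp: y_def N_def)
  obtain v :: "'n \<Rightarrow> real^'n" where v: "\<And>i j. v i \<bullet> v j = (if i = j then 1 else 0)"
    and near: "\<And>k. wip V (mixture w \<rho>s) (\<lambda>x. q k x - embedding u x \<bullet> v k) (\<lambda>x. q k x - embedding u x \<bullet> v k) \<le> 2 * (1 - y)"
    using orthonormal_approximation[OF eb idx dir q_H1[OF coupling(1)] less_le_trans[OF \<Theta> ev] \<tau>'(1,3,2)]
    unfolding u_eq y_def N_def by blast
  have sq_u: "sq_integrable V (mixture w \<rho>s) (u i)" for i
    unfolding u by (rule H1_sq_integrable[OF us_H1[OF eb]])
  have sq: "sq_integrable V (mixture w \<rho>s) (\<lambda>x. q k x - embedding u x \<bullet> v k)" for k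
  proof -
    have "sq_integrable V (mixture w \<rho>s) (\<lambda>x. \<Sum>i\<in>UNIV. (v k $ i) *\<^sub>R u i x)"
      by (intro mix.sq_integrable_sum sq_u) simp
    from mix.sq_integrable_diff[OF sq_integrable_q this] show ?thesis
      by (simp add: embedding_def inner_vec_def mult.commute)
  qed
  have meas: "embedding u \<in> borel_measurable V"
  proof (rule borel_measurable_euclidean_space[THEN iffD2, rule_format])
    fix b :: "real^'n" assume "b \<in> Basis"
    then obtain i where "b = axis i 1" by (auto simp: Basis_vec_def)
    then have "(\<lambda>x. embedding u x \<bullet> b) = u i" by (auto simp: embedding_def inner_axis)
    then show "(\<lambda>x. embedding u x \<bullet> b) \<in> borel_measurable V"
      using sq_u by (simp add: sq_integrable_def)
  qed
  \<comment> \<open>The errors of the N components add up, which accounts for the factor N beside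
    w_max in the condition on s and t.\<close>
  have \<epsilon>: "real CARD('n) * (2 * (1 - y)) \<le> t\<^sup>2 * (sin s)\<^sup>2 / w_max"
  proof -
    have "2 * (1 - y) \<le> N * ((\<tau> - sqrt S) / 2)\<^sup>2 + 4 * N powr (3/2) * (1 / y - 1)"
      using N2 y by (intro one_minus_sqrt_bound) auto
    also have "\<dots> \<le> t\<^sup>2 * (sin s)\<^sup>2 / (N * w_max)"
      using st(3) by (simp add: y_def)
    finally have "N * (2 * (1 - y)) \<le> N * (t\<^sup>2 * (sin s)\<^sup>2 / (N * w_max))"
      using N2 by (intro mult_left_mono) auto
    then show ?thesis using N2 by (simp add: N_def)
  qed
  \<comment> \<open>The quotient w_max / w_min in \<open_star_placeholder>\<close>
  have \<delta>_star: "(cos \<sigma>)\<^sup>2 / (1 - (cos \<sigma>)\<^sup>2) * (N\<^sup>2 * S) \<le> \<delta>_star"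
  proof -
    have "1 \<le> w_max / w_min"
      using order_trans[OF w_min(2) w_max(2)] w_min(1) by simp
    then have "1 * ((cos \<sigma>)\<^sup>2 / (1 - (cos \<sigma>)\<^sup>2) * (N\<^sup>2 * S)) \<le> w_max / w_min * ((cos \<sigma>)\<^sup>2 / (1 - (cos \<sigma>)\<^sup>2) * (N\<^sup>2 * S))"
      using cos\<sigma> S0 by (intro mult_right_mono) auto
    then show ?thesis by (simp add: \<delta>_star_def mult_ac)
  qed
  show ?thesis
  proof (intro allI impI)
    fix \<delta> assume "\<delta>_star \<le> \<delta> \<and> \<delta> < 1"
    then have "(cos \<sigma>)\<^sup>2 / (1 - (cos \<sigma>)\<^sup>2) * ((real CARD('n))\<^sup>2 * overlap V w \<rho>s) \<le> \<delta>"
      using \<delta>_star by (simp add: N_def S_def)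
    from orthogonal_cone_structure_if_near_q[OF meas N v sq near \<sigma>(1) st(1,4) \<epsilon>[unfolded w_max_def] this]
    show "orthogonal_cone_structure (distr (density V (\<lambda>x. ennreal (\<rho> x))) borel (embedding u))
        (\<sigma> + s) (\<delta> + t\<^sup>2) ((1 - sin s) / sqrt w_max)"
      by (simp add: \<rho>_def w_max_def)
  qed
qed

end
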